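(* Let $\mathcal{L}=\mathcal{L}_{3,d}(m_1,\dots,m_6)$ be a non-empty linear system of surfaces in $\mathbb{P}^3$ based at $6$ points $p_1,\dots,p_6\in\mathbb{P}^3$ in general position, and let $C$ be the twisted cubic through the six points. Then $\mathcal{L}$ is special only if its base locus contains either linear cycles $L_I$ or cones $\mathrm{J}(L_I,\sigma_t)$ over the secant varieties $\sigma_t$ of $C$. Moreover $$\dim(\mathcal{L})=\sigma\mathrm{ldim}(\mathcal{L}).$$
   Context: $\mathbb{P}^n$ is projective space over $\mathbb{C}$. The notation below is given for general $n$ and is used with $n=3$. $\mathcal{L}=\mathcal{L}_{n,d}(m_1,\dots,m_{n+3})$, with $d,m_i\ge0$ integers, is the linear system of degree-$d$ hypersurfaces of $\mathbb{P}^n$ with multiplicity at least $m_i$ at $p_i$, where $p_1,\dots,p_{n+3}$ are in general position. $\dim(\mathcal L)$ is the affine dimension, i.e. the dimension of the vector space of degree-$d$ forms defining it. The virtual dimension is $\mathrm{vdim}(\mathcal{L})=\binom{n+d}{n}-\sum_i\binom{n+m_i-1}{n}$, the expected dimension is $\max(\mathrm{vdim}(\mathcal L),0)$, and $\mathcal{L}$ is special if $\dim(\mathcal L)$ is strictly greater than the expected dimension. $C$ is the rational normal curve of degree $n$ through the $n+3$ points. $\sigma_t$ ($t\ge1$) is the closure of the union of the $\mathbb{P}^{t-1}$'s spanned by $t$ points of $C$, and $\sigma_0=\emptyset$. $L_I$ is the linear span of $\{p_i:i\in I\}$. $\mathrm{J}(L_I,\sigma_t)$ is the join of $L_I$ and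 $\sigma_t$, with $\mathrm J(L_I,\emptyset)=L_I$ and $\mathrm J(\emptyset,\sigma_t)=\sigma_t$. Set $k_C=\sum_{i=1}^{n+3}m_i-nd$, $k_{I,\sigma_t}=\sum_{i\in I}m_i+t\,k_C-(|I|+t-1)d$ and $r_{I,\sigma_t}=|I|+2t-1$. Secant linear expected dimension: write $n=2l+\epsilon$, $\epsilon\in\{0,1\}$. The (affine) secant linear virtual dimension of $\mathcal L$ is $$\sum_{I,t}(-1)^{|I|}\binom{n+k_{I,\sigma_t}-r_{I,\sigma_t}-1}{n},$$ summed over all $I\subset\{1,\dots,n+3\}$ and $t$ with $0\le t\le l+\epsilon$ and $0\le|I|\le n-2t$, where $\binom{a}{n}=0$ if $a<n$. If $\mathcal L$ is contained in a linear system with negative secant linear virtual dimension, then $\sigma\mathrm{ldim}(\mathcal L)=0$. Otherwise $\sigma\mathrm{ldim}(\mathcal L)$ is the maximum of the secant linear virtual dimension of $\mathcal L$ and $0$. *)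

theory Defs
  imports "HOL-Analysis.Analysis" "HOL-Library.Function_Algebras"
begin

(* Conventions. With CARD('n) = n + 1, points of P^n are represented by nonzero vectors of
   complex^'n, and a closed subset of P^n by its affine cone in complex^'n. The empty subset of P^n
   is then {0}, and for cones X, Y the set {x + y | x in X, y in Y} is the cone over the union of
   the lines joining X to Y; it is X when Y = {0}. The points are indexed by {1..n+3}. *)

abbreviation pdim :: "'n::finite itself \<Rightarrow> nat" where
  "pdim _ \<equiv> CARD('n) - 1"


section \<open>Forms and linear systems\<close>

(* Forms are taken as polynomial functions: over the infinite field of complex numbers a polynomial
   is determined by its values. *)

definition forms :: "nat \<Rightarrow> (complex^'n::finite \<Rightarrow> complex) set" where
  "forms d = {F. \<exists>c :: ('n \<Rightarrow> nat) \<Rightarrow> complex.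
     F = (\<lambda>x. \<Sum>a | sum a UNIV = d. c a * (\<Prod>i\<in>UNIV. x $ i ^ a i))}"

definition partial_deriv ::
  "'n::finite \<Rightarrow> (complex^'n \<Rightarrow> complex) \<Rightarrow> (complex^'n \<Rightarrow> complex)" where
  "partial_deriv i F = (\<lambda>x. deriv (\<lambda>z. F (x + z *s axis i 1)) 0)"

(* All partial derivatives of F of order less than k vanish at x. *)
definition mult_at_least :: "(complex^'n::finite \<Rightarrow> complex) \<Rightarrow> complex^'n \<Rightarrow> nat \<Rightarrow> bool" where
  "mult_at_least F x k \<longleftrightarrow>
     (\<forall>js :: 'n list. length js < k \<longrightarrow> foldr partial_deriv js F x = 0)"

definition lin_sys ::
  "(nat \<Rightarrow> complex^'n::finite) \<Rightarrow> nat \<Rightarrow> (nat \<Rightarrow> nat) \<Rightarrow> (complex^'n \<Rightarrow> complex) set" where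
  "lin_sys p d m = {F \<in> forms d. \<forall>i\<in>{1..pdim TYPE('n) + 3}. mult_at_least F (p i) (m i)}"

global_interpretation cfun:
  vector_space "\<lambda>(c::complex) (f::'a \<Rightarrow> complex) x. c * f x"
  defines cfun_dim = cfun.dim
  by unfold_locales (auto simp: fun_eq_iff algebra_simps)

definition base_locus :: "(complex^'n::finite \<Rightarrow> complex) set \<Rightarrow> (complex^'n) set" where
  "base_locus L = {x. \<forall>F\<in>L. F x = 0}"


section \<open>Linear spans, secant varieties and joins\<close>

definition general_position :: "(nat \<Rightarrow> complex^'n::finite) \<Rightarrow> bool" where
  "general_position p \<longleftrightarrow>
     (\<forall>I \<subseteq> {1..pdim TYPE('n) + 3}. card I \<le> pdim TYPE('n) + 1 \<longrightarrow>
        inj_on p I \<and> vec.independent (p ` I))"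

definition zariski_closure :: "(complex^'n::finite) set \<Rightarrow> (complex^'n) set" where
  "zariski_closure S =
     {x. \<forall>d. \<forall>F\<in>forms d. (\<forall>y\<in>S. F y = 0) \<longrightarrow> F x = 0}"

(* For n > 0: the image of P^1 under the n + 1 binary monomials of degree n, taken with respect to
   an arbitrary basis b. Scalar multiples are covered since complex numbers have n-th roots. *)
definition rational_normal_curve :: "(complex^'n::finite) set \<Rightarrow> bool" where
  "rational_normal_curve C \<longleftrightarrow>
     (let n = pdim TYPE('n) in
      \<exists>b :: nat \<Rightarrow> complex^'n. inj_on b {0..n} \<and> vec.independent (b ` {0..n}) \<and>
        C = {(\<Sum>j=0..n. (u ^ (n - j) * v ^ j) *s b j) | u v. True})"

definition lin_span :: "(nat \<Rightarrow> complex^'n::finite) \<Rightarrow> nat set \<Rightarrow> (complex^'n) set" where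
  "lin_span p I = vec.span (p ` I)"

(* For t = 0 this is {0}, the cone over the empty set. *)
definition secant :: "(complex^'n::finite) set \<Rightarrow> nat \<Rightarrow> (complex^'n) set" where
  "secant C t = zariski_closure
     (\<Union>S \<in> {S. S \<subseteq> C \<and> vec.independent S \<and> card S = t}. vec.span S)"

definition join :: "(complex^'n::finite) set \<Rightarrow> (complex^'n) set \<Rightarrow> (complex^'n) set" where
  "join X Y = zariski_closure {x + y | x y. x \<in> X \<and> y \<in> Y}"


section \<open>Virtual dimensions\<close>

definition vdim :: "nat \<Rightarrow> nat \<Rightarrow> (nat \<Rightarrow> nat) \<Rightarrow> int" where
  "vdim n d m = int ((n + d) choose n) - (\<Sum>i=1..n+3. int ((n + m i - 1) choose n))"

definition special :: "(nat \<Rightarrow> complex^'n::finite) \<Rightarrow> nat \<Rightarrow> (nat \<Rightarrow> nat) \<Rightarrow> bool" where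
  "special p d m \<longleftrightarrow> int (cfun_dim (lin_sys p d m)) > max (vdim (pdim TYPE('n)) d m) 0"

definition kC :: "nat \<Rightarrow> nat \<Rightarrow> (nat \<Rightarrow> nat) \<Rightarrow> int" where
  "kC n d m = (\<Sum>i=1..n+3. int (m i)) - int n * int d"

definition k_join :: "nat \<Rightarrow> nat \<Rightarrow> (nat \<Rightarrow> nat) \<Rightarrow> nat set \<Rightarrow> nat \<Rightarrow> int" where
  "k_join n d m I t =
     (\<Sum>i\<in>I. int (m i)) + int t * kC n d m - (int (card I) + int t - 1) * int d"

definition r_join :: "nat set \<Rightarrow> nat \<Rightarrow> int" where
  "r_join I t = int (card I) + 2 * int t - 1"

definition binom :: "int \<Rightarrow> nat \<Rightarrow> int" where
  "binom a n = (if a < int n then 0 else int (nat a choose n))"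

(* The condition 0 <= |I| <= n - 2t is written without truncated subtraction; n div 2 + n mod 2
   is l + epsilon. *)
definition secant_linear_vdim :: "nat \<Rightarrow> nat \<Rightarrow> (nat \<Rightarrow> nat) \<Rightarrow> int" where
  "secant_linear_vdim n d m =
     (\<Sum>(I, t) \<in> {(I, t). I \<subseteq> {1..n+3} \<and> t \<le> n div 2 + n mod 2 \<and> card I + 2 * t \<le> n}.
        (-1) ^ card I * binom (int n + k_join n d m I t - r_join I t - 1) n)"

definition secant_linear_dim ::
  "(nat \<Rightarrow> complex^'n::finite) \<Rightarrow> nat \<Rightarrow> (nat \<Rightarrow> nat) \<Rightarrow> int" where
  "secant_linear_dim p d m =
     (if \<exists>m'. lin_sys p d m \<subseteq> lin_sys p d m' \<and> secant_linear_vdim (pdim TYPE('n)) d m' < 0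
      then 0
      else max (secant_linear_vdim (pdim TYPE('n)) d m) 0)"

end

theory Submission
  imports Defs "HOL-Computational_Algebra.Polynomial"
begin

text \<open>
  The dimension of a non-empty system is shown to be equal to its secant linear virtual dimension
  (the formula, for short), by induction on the degree. Four of the six points can be taken as the
  coordinate points of a frame. A form of degree \<open>d\<close> with multiplicities
  \<open>m j\<close> there is a combination of the monomials whose exponents lie in the box with
  sides \<open>d - m j\<close>, and the conditions at the two other points are orthogonality
  relations with polynomials in the exponent. Reflecting exponents in the box is the standard
  Cremona transformation; it preserves the dimension (\<open>cremona_invariance\<close>) and changes
  the degree to \<open>3 d - S\<close>, where \<open>S\<close> is the sum of the four
  multiplicities. The formula is invariant as well (\<open>secant_formula_cremona\<close>): the
  transformation permutes its correction terms up to a symmetry of cubic polynomials, and in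
  particular it exchanges the twisted cubic with the line through the last two points. So if the
  four largest multiplicities have sum above \<open>2 d\<close>, the degree drops and induction
  applies.

  In the remaining case, called standard form, neither planes, nor cones, nor the twisted cubic
  contribute to the formula, and the contributing lines pass through the point of largest
  multiplicity or join the next two points. Hence the formula is a lower bound: intersecting systems
  based at two or three points, whose dimensions are numbers of monomials, already accounts for all
  these lines (\<open>sys_dim_lower_bound\<close>). It is also an upper bound: restriction to the
  plane through the first three points (\<open>sys_dim_upper_bound\<close>) bounds the dimension by
  that of a system of degree \<open>d - 1\<close> plus a number of plane monomials, and the formula
  satisfies the same recursion. The smaller system need not be in standard form, but it contains a
  product of planes (\<open>lin_sys_nonempty_planes\<close>), so the induction hypothesis gives its
  dimension.

  A system that contains a non-empty system is itself non-empty, so its formula is not negative;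
  this settles the exceptional clause in the definition of the secant linear dimension. Finally, if
  the dimension exceeds the virtual dimension, one of the positive correction terms is nonzero:
  either two of the multiplicities have sum above \<open>d\<close>, or all six have sum above
  \<open>3 d\<close>. By Bezout's theorem on a line or on the twisted cubic
  (\<open>form_vanishes_on_curve\<close>) that curve lies in the base locus.
\<close>

section \<open>Polynomial functions and multiplicity\<close>

inductive polyfun :: "(complex^'n::finite \<Rightarrow> complex) \<Rightarrow> bool" where
  polyfun_const: "polyfun (\<lambda>x. c)"
| polyfun_coord: "polyfun (\<lambda>x. x $ j)"
| polyfun_add: "polyfun F \<Longrightarrow> polyfun G \<Longrightarrow> polyfun (\<lambda>x. F x + G x)"
| polyfun_mult: "polyfun F \<Longrightarrow> polyfun G \<Longrightarrow> polyfun (\<lambda>x. F x * G x)"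

lemma polyfun_sum: "(\<And>i. i \<in> S \<Longrightarrow> polyfun (F i)) \<Longrightarrow> polyfun (\<lambda>x. \<Sum>i\<in>S. F i x)"
  by (induction S rule: infinite_finite_induct) (auto intro: polyfun_const polyfun_add)

lemma polyfun_power: "polyfun F \<Longrightarrow> polyfun (\<lambda>x. F x ^ k)"
  by (induction k) (auto intro: polyfun_const polyfun_mult)

lemma polyfun_prod: "(\<And>i. i \<in> S \<Longrightarrow> polyfun (F i)) \<Longrightarrow> polyfun (\<lambda>x. \<Prod>i\<in>S. F i x)"
  by (induction S rule: infinite_finite_induct) (auto intro: polyfun_const polyfun_mult)

lemma polyfun_differentiable_along_line:
  "polyfun F \<Longrightarrow> (\<lambda>z. F (x + z *s v)) field_differentiable (at z)"
  by (induction rule: polyfun.induct) (auto intro!: derivative_intros)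

lemma partial_deriv_const [simp]: "partial_deriv i (\<lambda>x. c) = (\<lambda>x. 0)"
  by (simp add: partial_deriv_def)

lemma partial_deriv_coord: "partial_deriv i (\<lambda>x. x $ j) = (\<lambda>x. if i = j then 1 else 0)"
  by (rule ext) (auto simp: partial_deriv_def axis_def intro!: DERIV_imp_deriv derivative_eq_intros)

lemma partial_deriv_add:
  assumes "polyfun F" "polyfun G"
  shows "partial_deriv i (\<lambda>x. F x + G x) = (\<lambda>x. partial_deriv i F x + partial_deriv i G x)"
  by (rule ext) (simp add: partial_deriv_def polyfun_differentiable_along_line[OF assms(1)]
      polyfun_differentiable_along_line[OF assms(2)])

lemma partial_deriv_mult:
  assumes "polyfun F" "polyfun G"
  shows "partial_deriv i (\<lambda>x. F x * G x) =
    (\<lambda>x. partial_deriv i F x * G x + F x * partial_deriv i G x)"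
  by (rule ext) (simp add: partial_deriv_def polyfun_differentiable_along_line[OF assms(1)]
      polyfun_differentiable_along_line[OF assms(2)])

lemma partial_deriv_cmult:
  "polyfun F \<Longrightarrow> partial_deriv i (\<lambda>x. c * F x) = (\<lambda>x. c * partial_deriv i F x)"
  using partial_deriv_mult[OF polyfun_const] by simp

lemma partial_deriv_sum:
  assumes "\<And>i. i \<in> S \<Longrightarrow> polyfun (F i)"
  shows "partial_deriv j (\<lambda>x. \<Sum>i\<in>S. F i x) = (\<lambda>x. \<Sum>i\<in>S. partial_deriv j (F i) x)"
  using assms
proof (induction S rule: infinite_finite_induct)
  case (insert i S)
  then have "polyfun (\<lambda>x. \<Sum>i\<in>S. F i x)" by (intro polyfun_sum) auto
  then show ?case using insert by (simp add: partial_deriv_add)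
qed auto

lemma polyfun_partial_deriv: "polyfun F \<Longrightarrow> polyfun (partial_deriv i F)"
proof (induction rule: polyfun.induct)
  case (polyfun_coord j) show ?case by (auto simp: partial_deriv_coord intro: polyfun_const)
qed (auto simp: partial_deriv_add partial_deriv_mult
     intro: polyfun.polyfun_const polyfun.polyfun_add polyfun.polyfun_mult)

lemma mult_at_least_0 [simp]: "mult_at_least F x 0"
  by (simp add: mult_at_least_def)

text \<open>
  The defining lists of directions are peeled from the inner end, so that an induction on the order
  of vanishing can pass from a function to its first partial derivatives, regarded as new functions.
\<close>

lemma mult_at_least_Suc:
  "mult_at_least F x (Suc k) \<longleftrightarrow> F x = 0 \<and> (\<forall>i. mult_at_least (partial_deriv i F) x k)"
proof
  assume L: "mult_at_least F x (Suc k)"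
  have "foldr partial_deriv js (partial_deriv i F) x = 0" if "length js < k" for js i
    using L[unfolded mult_at_least_def, rule_format, of "js @ [i]"] that by simp
  then show "F x = 0 \<and> (\<forall>i. mult_at_least (partial_deriv i F) x k)"
    using L[unfolded mult_at_least_def, rule_format, of "[]"] by (simp add: mult_at_least_def)
next
  assume R: "F x = 0 \<and> (\<forall>i. mult_at_least (partial_deriv i F) x k)"
  have "foldr partial_deriv js F x = 0" if "length js < Suc k" for js
    using R that by (cases js rule: rev_cases) (auto simp: mult_at_least_def)
  then show "mult_at_least F x (Suc k)" by (simp add: mult_at_least_def)
qed

lemma mult_at_least_mono: "mult_at_least F x k \<Longrightarrow> j \<le> k \<Longrightarrow> mult_at_least F x j"
  by (simp add: mult_at_least_def)

lemma mult_at_least_add: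
  assumes "polyfun F" "polyfun G" "mult_at_least F x k" "mult_at_least G x k"
  shows "mult_at_least (\<lambda>x. F x + G x) x k"
  using assms
  by (induction k arbitrary: F G)
     (auto simp: mult_at_least_Suc partial_deriv_add polyfun_partial_deriv)

lemma mult_at_least_cmult:
  assumes "polyfun F" "mult_at_least F x k"
  shows "mult_at_least (\<lambda>x. c * F x) x k"
  using assms
  by (induction k arbitrary: F)
     (auto simp: mult_at_least_Suc partial_deriv_cmult polyfun_partial_deriv)

lemma mult_at_least_zero [simp]: "mult_at_least (\<lambda>x. 0) x k"
  by (induction k) (auto simp: mult_at_least_Suc)

lemma mult_at_least_sum:
  assumes "\<And>i. i \<in> S \<Longrightarrow> polyfun (F i)" "\<And>i. i \<in> S \<Longrightarrow> mult_at_least (F i) x k"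
  shows "mult_at_least (\<lambda>x. \<Sum>i\<in>S. F i x) x k"
  using assms
proof (induction S rule: infinite_finite_induct)
  case (insert i S)
  then have "polyfun (\<lambda>x. \<Sum>i\<in>S. F i x)" by (intro polyfun_sum) auto
  then show ?case using insert by (auto intro!: mult_at_least_add)
qed auto

lemma mult_at_least_mult:
  assumes "polyfun U" "polyfun G" "mult_at_least G x k"
  shows "mult_at_least (\<lambda>x. U x * G x) x k"
  using assms
proof (induction k arbitrary: U G)
  case (Suc k)
  have "mult_at_least (\<lambda>x. partial_deriv i U x * G x + U x * partial_deriv i G x) x k" for i
    using Suc.prems
    by (intro mult_at_least_add Suc.IH polyfun_mult polyfun_partial_deriv)
       (auto simp: mult_at_least_Suc intro: mult_at_least_mono[of G x "Suc k" k])
  then show ?case using Suc.prems by (auto simp: mult_at_least_Suc partial_deriv_mult)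
qed auto

lemma mult_at_least_mult_vanishing:
  assumes "polyfun U" "polyfun G" "U x = 0" "mult_at_least G x k"
  shows "mult_at_least (\<lambda>x. U x * G x) x (Suc k)"
  using assms
proof (induction k arbitrary: G)
  case 0
  then show ?case by (simp add: mult_at_least_Suc)
next
  case (Suc k)
  have "mult_at_least (\<lambda>x. partial_deriv i U x * G x + U x * partial_deriv i G x) x (Suc k)" for i
    using Suc.prems mult_at_least_mult[OF polyfun_partial_deriv, of U G x "Suc k" i]
      Suc.IH[of "partial_deriv i G"]
    by (intro mult_at_least_add polyfun_mult polyfun_partial_deriv)
       (auto simp: mult_at_least_Suc[of G] polyfun_partial_deriv)
  then show ?case using Suc.prems by (subst mult_at_least_Suc) (auto simp: partial_deriv_mult)
qed

text \<open>
  A factor that does not vanish at the point is a unit in the local ring there. By the product rule,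
  every partial derivative of \<open>G\<close> inherits its order of vanishing from that of
  \<open>U G\<close> and from the lower order already obtained for \<open>G\<close>.
\<close>

lemma mult_at_least_cancel:
  assumes "polyfun U" "polyfun G" "U x \<noteq> 0" "mult_at_least (\<lambda>x. U x * G x) x k"
  shows "mult_at_least G x k"
  using assms
proof (induction k arbitrary: G)
  case (Suc k)
  have G: "mult_at_least G x k"
    using Suc.prems mult_at_least_mono[of "\<lambda>x. U x * G x" x "Suc k" k] by (auto intro: Suc.IH[of G])
  have "mult_at_least (partial_deriv i G) x k" for i
  proof (rule Suc.IH[OF Suc.prems(1)])
    note UP = polyfun_partial_deriv[OF Suc.prems(1), of i]
    note GP = Suc.prems(2) and GP' = polyfun_partial_deriv[OF Suc.prems(2), of i]
    show "polyfun (partial_deriv i G)" by (rule GP')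
    have "mult_at_least (\<lambda>x. partial_deriv i U x * G x + U x * partial_deriv i G x) x k"
      using Suc.prems by (auto simp: mult_at_least_Suc partial_deriv_mult)
    moreover have "mult_at_least (\<lambda>x. (-1) * (partial_deriv i U x * G x)) x k"
      by (rule mult_at_least_cmult[OF polyfun_mult[OF UP GP] mult_at_least_mult[OF UP GP G]])
    ultimately have "mult_at_least (\<lambda>x. (partial_deriv i U x * G x + U x * partial_deriv i G x)
        + (-1) * (partial_deriv i U x * G x)) x k"
      by (rule mult_at_least_add[OF polyfun_add[OF polyfun_mult[OF UP GP] polyfun_mult[OF Suc.prems(1) GP']]
            polyfun_mult[OF polyfun_const polyfun_mult[OF UP GP]]])
    then show "mult_at_least (\<lambda>x. U x * partial_deriv i G x) x k" by simp
  qed (rule Suc.prems)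
  then show ?case using Suc.prems by (auto simp: mult_at_least_Suc)
qed auto

lemma polyfun_linear:
  fixes A :: "complex^'n::finite^'m::finite"
  assumes "polyfun F" shows "polyfun (\<lambda>x. F (A *v x))"
  using assms
proof (induction rule: polyfun.induct)
  case (polyfun_coord j)
  show ?case by (auto simp: matrix_vector_mult_def
        intro!: polyfun_sum polyfun_mult polyfun_const polyfun.polyfun_coord)
qed (auto intro: polyfun.intros)

lemma partial_deriv_linear:
  fixes A :: "complex^'n::finite^'m::finite"
  assumes "polyfun F"
  shows "partial_deriv i (\<lambda>x. F (A *v x)) = (\<lambda>x. \<Sum>j\<in>UNIV. A $ j $ i * partial_deriv j F (A *v x))"
  using assms
proof (induction rule: polyfun.induct)
  case (polyfun_coord j)
  have "partial_deriv i (\<lambda>x. (A *v x) $ j) = partial_deriv i (\<lambda>x. \<Sum>l\<in>UNIV. A $ j $ l * x $ l)"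
    by (simp add: matrix_vector_mult_def)
  also have "\<dots> = (\<lambda>x. \<Sum>l\<in>UNIV. A $ j $ l * (if i = l then 1 else 0))"
    by (simp add: partial_deriv_sum[OF polyfun_mult[OF polyfun_const polyfun.polyfun_coord]]
        partial_deriv_cmult[OF polyfun.polyfun_coord] partial_deriv_coord)
  finally have "partial_deriv i (\<lambda>x. (A *v x) $ j) = (\<lambda>x. A $ j $ i)"
    by (simp add: if_distrib cong: if_cong)
  then show ?case by (simp add: partial_deriv_coord if_distrib cong: if_cong)
next
  case (polyfun_mult F G)
  note FG = polyfun_linear[OF polyfun_mult.hyps(1), of A] polyfun_linear[OF polyfun_mult.hyps(2), of A]
  show ?case
    by (simp add: partial_deriv_mult FG polyfun_mult sum.distrib ring_distribs sum_distrib_left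
        sum_distrib_right mult_ac)
next
  case (polyfun_add F G)
  note FG = polyfun_linear[OF polyfun_add.hyps(1), of A] polyfun_linear[OF polyfun_add.hyps(2), of A]
  show ?case
    by (simp add: partial_deriv_add FG polyfun_add sum.distrib ring_distribs)
qed simp

text \<open>
  The chain rule expresses first derivatives of the pulled back function as linear combinations of
  pulled back first derivatives, and induction does the rest.
\<close>

lemma mult_at_least_linear:
  fixes A :: "complex^'n::finite^'m::finite"
  assumes "polyfun F" "mult_at_least F (A *v x) k"
  shows "mult_at_least (\<lambda>x. F (A *v x)) x k"
  using assms
proof (induction k arbitrary: F)
  case (Suc k)
  have pd: "polyfun (\<lambda>x. partial_deriv j F (A *v x))" for j
    using Suc.prems(1) by (rule polyfun_linear[OF polyfun_partial_deriv])
  have "mult_at_least (\<lambda>x. partial_deriv j F (A *v x)) x k" for j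
    using Suc.prems by (intro Suc.IH polyfun_partial_deriv) (simp_all add: mult_at_least_Suc)
  then have "mult_at_least (\<lambda>x. \<Sum>j\<in>UNIV. A $ j $ i * partial_deriv j F (A *v x)) x k" for i
    by (intro mult_at_least_sum mult_at_least_cmult polyfun_mult[OF polyfun_const] pd)
  then show ?case
    using Suc.prems by (simp add: mult_at_least_Suc partial_deriv_linear)
qed simp

section \<open>Forms in coordinates\<close>

definition monom_fun :: "('n::finite \<Rightarrow> nat) \<Rightarrow> complex^'n \<Rightarrow> complex" where
  "monom_fun \<alpha> x = (\<Prod>i\<in>UNIV. x $ i ^ \<alpha> i)"

abbreviation exponents :: "nat \<Rightarrow> ('n::finite \<Rightarrow> nat) set" where
  "exponents d \<equiv> {\<alpha>. sum \<alpha> UNIV = d}"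

definition hom_form :: "nat \<Rightarrow> (('n::finite \<Rightarrow> nat) \<Rightarrow> complex) \<Rightarrow> complex^'n \<Rightarrow> complex" where
  "hom_form d c x = (\<Sum>\<alpha>\<in>exponents d. c \<alpha> * monom_fun \<alpha> x)"

lemma forms_eq_hom_form: "forms d = range (hom_form d)"
  by (auto simp: forms_def hom_form_def monom_fun_def fun_eq_iff)

lemma exponent_le_degree: "sum \<alpha> UNIV = d \<Longrightarrow> \<alpha> i \<le> (d::nat)" for \<alpha> :: "'n::finite \<Rightarrow> nat"
  using member_le_sum[of i UNIV \<alpha>] by auto

lemma finite_exponents [simp]: "finite (exponents d :: ('n::finite \<Rightarrow> nat) set)"
proof (rule finite_subset)
  show "exponents d \<subseteq> PiE (UNIV :: 'n set) (\<lambda>_. {..d})"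
    by (auto simp: exponent_le_degree)
qed (auto intro: finite_PiE)

lemma polyfun_monom_fun: "polyfun (monom_fun \<alpha>)"
  unfolding monom_fun_def[abs_def]
  by (intro polyfun_prod polyfun_power polyfun_coord)

lemma polyfun_hom_form: "polyfun (hom_form d c)"
  unfolding hom_form_def[abs_def]
  by (intro polyfun_sum polyfun_mult[OF polyfun_const polyfun_monom_fun])

lemma polyfun_forms: "F \<in> forms d \<Longrightarrow> polyfun F"
  by (auto simp: forms_eq_hom_form polyfun_hom_form)

lemma hom_form_scale: "hom_form d c (s *s x) = s ^ d * hom_form d c x"
  unfolding hom_form_def sum_distrib_left
  by (intro sum.cong refl)
     (auto simp: monom_fun_def power_mult_distrib prod.distrib power_sum mult_ac)

lemma forms_scale: "F \<in> forms d \<Longrightarrow> F (s *s x) = s ^ d * F x"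
  by (auto simp: forms_eq_hom_form hom_form_scale)

lemma hom_form_add: "hom_form d (\<lambda>\<alpha>. c \<alpha> + c' \<alpha>) = (\<lambda>x. hom_form d c x + hom_form d c' x)"
  by (simp add: hom_form_def fun_eq_iff sum.distrib ring_distribs)

lemma hom_form_cmult: "hom_form d (\<lambda>\<alpha>. s * c \<alpha>) = (\<lambda>x. s * hom_form d c x)"
  by (auto simp: hom_form_def fun_eq_iff sum_distrib_left mult_ac)

lemma hom_form_cong: "(\<And>\<alpha>. sum \<alpha> UNIV = d \<Longrightarrow> c \<alpha> = c' \<alpha>) \<Longrightarrow> hom_form d c = hom_form d c'"
  by (auto simp: hom_form_def fun_eq_iff intro!: sum.cong)

lemma monom_fun_split: "monom_fun \<alpha> x = x $ j ^ \<alpha> j * (\<Prod>i\<in>UNIV - {j}. x $ i ^ \<alpha> i)"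
  unfolding monom_fun_def by (subst prod.remove[of _ j]) auto

lemma monom_fun_upd: "monom_fun (\<alpha>(j := k)) x = x $ j ^ k * (\<Prod>i\<in>UNIV - {j}. x $ i ^ \<alpha> i)"
  by (simp add: monom_fun_split[of "\<alpha>(j := k)" x j] cong: prod.cong_simp)

lemma partial_deriv_monom_fun:
  "partial_deriv j (monom_fun \<alpha>) = (\<lambda>x. of_nat (\<alpha> j) * monom_fun (\<alpha>(j := \<alpha> j - 1)) x)"
proof
  fix x :: "complex^'a"
  let ?R = "\<Prod>i\<in>UNIV - {j}. x $ i ^ \<alpha> i"
  have "monom_fun \<alpha> (x + z *s axis j 1) = (x $ j + z) ^ \<alpha> j * ?R" for z
    by (simp add: monom_fun_split[of \<alpha> _ j] axis_def cong: prod.cong_simp)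
  then have eq: "deriv (\<lambda>z. monom_fun \<alpha> (x + z *s axis j 1)) 0 = deriv (\<lambda>z. (x $ j + z) ^ \<alpha> j * ?R) 0"
    by presburger
  have "((\<lambda>z. x $ j + z) has_field_derivative 1) (at 0)"
    using DERIV_add[OF DERIV_const DERIV_ident] by simp
  then have "((\<lambda>z. (x $ j + z) ^ \<alpha> j * ?R) has_field_derivative
      of_nat (\<alpha> j) * (1 * (x $ j + 0) ^ (\<alpha> j - Suc 0)) * ?R) (at 0)"
    by (rule DERIV_cmult_right[OF DERIV_power])
  then have eq': "deriv (\<lambda>z. (x $ j + z) ^ \<alpha> j * ?R) 0 =
      of_nat (\<alpha> j) * (1 * (x $ j + 0) ^ (\<alpha> j - Suc 0)) * ?R"
    by (rule DERIV_imp_deriv)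
  show "partial_deriv j (monom_fun \<alpha>) x = of_nat (\<alpha> j) * monom_fun (\<alpha>(j := \<alpha> j - 1)) x"
    by (simp add: partial_deriv_def eq eq' monom_fun_upd)
qed

lemma partial_deriv_hom_form:
  "partial_deriv j (hom_form d c) =
    (\<lambda>x. \<Sum>\<alpha>\<in>exponents d. c \<alpha> * of_nat (\<alpha> j) * monom_fun (\<alpha>(j := \<alpha> j - 1)) x)"
  unfolding hom_form_def[abs_def]
    partial_deriv_sum[OF polyfun_mult[OF polyfun_const polyfun_monom_fun]]
    partial_deriv_cmult[OF polyfun_monom_fun] partial_deriv_monom_fun
  by (simp add: mult.assoc)

lemma sum_upd_Suc:
  fixes \<beta> :: "'n::finite \<Rightarrow> nat"
  shows "sum (\<beta>(j := Suc (\<beta> j))) UNIV = Suc (sum \<beta> UNIV)"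
  using sum.remove[of UNIV j \<beta>] sum.remove[of UNIV j "\<beta>(j := Suc (\<beta> j))"] by (simp cong: sum.cong_simp)

lemma sum_upd_pred:
  fixes \<alpha> :: "'n::finite \<Rightarrow> nat"
  shows "0 < \<alpha> j \<Longrightarrow> sum (\<alpha>(j := \<alpha> j - 1)) UNIV = sum \<alpha> UNIV - 1"
  using sum_upd_Suc[of "\<alpha>(j := \<alpha> j - 1)" j] by simp

lemma partial_deriv_hom_form_0: "partial_deriv j (hom_form 0 c) = (\<lambda>x. 0)"
  by (auto simp: partial_deriv_hom_form fun_eq_iff)

lemma partial_deriv_hom_form_Suc:
  "partial_deriv j (hom_form (Suc d) c) =
    hom_form d (\<lambda>\<beta>. of_nat (Suc (\<beta> j)) * c (\<beta>(j := Suc (\<beta> j))))"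
proof
  fix x
  have "(\<Sum>\<alpha>\<in>exponents (Suc d). c \<alpha> * of_nat (\<alpha> j) * monom_fun (\<alpha>(j := \<alpha> j - 1)) x)
      = (\<Sum>\<alpha>\<in>{\<alpha> \<in> exponents (Suc d). 0 < \<alpha> j}. c \<alpha> * of_nat (\<alpha> j) * monom_fun (\<alpha>(j := \<alpha> j - 1)) x)"
    by (rule sum.mono_neutral_right) auto
  also have "\<dots> = (\<Sum>\<beta>\<in>exponents d. of_nat (Suc (\<beta> j)) * c (\<beta>(j := Suc (\<beta> j))) * monom_fun \<beta> x)"
    by (rule sum.reindex_bij_witness[of _ "\<lambda>\<beta>. \<beta>(j := Suc (\<beta> j))" "\<lambda>\<alpha>. \<alpha>(j := \<alpha> j - 1)"])
       (auto simp: sum_upd_Suc[unfolded fun_upd_def] sum_upd_pred[unfolded fun_upd_def One_nat_def])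
  finally show "partial_deriv j (hom_form (Suc d) c) x =
      hom_form d (\<lambda>\<beta>. of_nat (Suc (\<beta> j)) * c (\<beta>(j := Suc (\<beta> j)))) x"
    by (simp add: partial_deriv_hom_form hom_form_def)
qed

lemma monom_fun_axis:
  "monom_fun \<alpha> (axis i 1) = (if \<alpha> = (\<lambda>j. if j = i then sum \<alpha> UNIV else 0) then 1 else 0)"
proof (cases "\<forall>j. j \<noteq> i \<longrightarrow> \<alpha> j = 0")
  case True
  then have "sum \<alpha> UNIV = \<alpha> i" using sum.remove[of UNIV i \<alpha>] by auto
  then have "\<alpha> = (\<lambda>j. if j = i then sum \<alpha> UNIV else 0)" using True by auto
  moreover have "monom_fun \<alpha> (axis i 1) = 1"
    unfolding monom_fun_def by (rule prod.neutral) (use True in \<open>auto simp: axis_def\<close>)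
  ultimately show ?thesis by simp
next
  case False
  then obtain j where j: "j \<noteq> i" "\<alpha> j \<noteq> 0" by auto
  then have "monom_fun \<alpha> (axis i 1) = 0"
    unfolding monom_fun_def by (intro prod_zero) (auto simp: axis_def intro!: bexI[of _ j])
  moreover have "\<alpha> \<noteq> (\<lambda>j. if j = i then sum \<alpha> UNIV else 0)" using j by (metis)
  ultimately show ?thesis by auto
qed

lemma hom_form_axis: "hom_form d c (axis i 1) = c (\<lambda>j. if j = i then d else 0)"
proof -
  have "hom_form d c (axis i 1) =
      (\<Sum>\<alpha>\<in>exponents d. if \<alpha> = (\<lambda>j. if j = i then d else 0) then c \<alpha> else 0)"
    unfolding hom_form_def by (intro sum.cong refl) (auto simp: monom_fun_axis)
  then show ?thesis by (simp add: sum.delta)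
qed

text \<open>
  In the affine chart around the \<open>i\<close>-th coordinate point, the monomial with exponent
  \<open>\<alpha>\<close> has degree \<open>d - \<alpha> i\<close>, so multiplicity \<open>k\<close>
  forbids exactly the monomials with \<open>d - \<alpha> i < k\<close>. The induction avoids the
  chart: a monomial other than the pure power of \<open>x\<^sub>i\<close> is reached from a
  derivative in some other direction.
\<close>

lemma mult_at_least_axis_iff:
  "mult_at_least (hom_form d c) (axis i 1) k \<longleftrightarrow>
    (\<forall>\<alpha>. sum \<alpha> UNIV = d \<longrightarrow> d < \<alpha> i + k \<longrightarrow> c \<alpha> = 0)"
proof (induction k arbitrary: d c)
  case 0
  then show ?case using exponent_le_degree[of _ d i] by fastforce
next
  case (Suc k)
  note IH = Suc.IH
  show ?case
  proof (cases d)
    case 0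
    then show ?thesis
      by (auto simp: mult_at_least_Suc partial_deriv_hom_form_0 hom_form_axis)
  next
    case (Suc e)
    have "mult_at_least (hom_form d c) (axis i 1) (Suc k) \<longleftrightarrow> c (\<lambda>j. if j = i then d else 0) = 0 \<and>
       (\<forall>j. \<forall>\<beta>. sum \<beta> UNIV = e \<longrightarrow> e < \<beta> i + k \<longrightarrow> c (\<beta>(j := Suc (\<beta> j))) = 0)"
      unfolding Suc
      by (simp add: mult_at_least_Suc hom_form_axis partial_deriv_hom_form_Suc IH del: of_nat_Suc)
    also have "\<dots> \<longleftrightarrow> (\<forall>\<alpha>. sum \<alpha> UNIV = d \<longrightarrow> d < \<alpha> i + Suc k \<longrightarrow> c \<alpha> = 0)"
    proof safe
      fix \<alpha> :: "'a \<Rightarrow> nat" assume c: "c (\<lambda>j. if j = i then sum \<alpha> UNIV else 0) = 0"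
        and R: "\<forall>j \<beta>. sum \<beta> UNIV = e \<longrightarrow> e < \<beta> i + k \<longrightarrow> c (\<beta>(j := Suc (\<beta> j))) = 0"
        and \<alpha>: "sum \<alpha> UNIV < \<alpha> i + Suc k" "d = sum \<alpha> UNIV"
      show "c \<alpha> = 0"
      proof (cases "\<exists>j. j \<noteq> i \<and> 0 < \<alpha> j")
        case True
        then obtain j where j: "j \<noteq> i" "0 < \<alpha> j" by auto
        then have "c ((\<alpha>(j := \<alpha> j - 1))(j := Suc ((\<alpha>(j := \<alpha> j - 1)) j))) = 0"
          using \<alpha> Suc by (intro R[rule_format]) (auto simp: sum_upd_pred[unfolded fun_upd_def One_nat_def])
        then show ?thesis using j by simp
      next
        case False
        then have "sum \<alpha> UNIV = \<alpha> i" using sum.remove[of UNIV i \<alpha>] by auto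
        then have "\<alpha> = (\<lambda>j. if j = i then sum \<alpha> UNIV else 0)" using False by (auto simp: fun_eq_iff)
        then show ?thesis using c by simp
      qed
    next
      fix j and \<beta> :: "'a \<Rightarrow> nat"
      assume R: "\<forall>\<alpha>. sum \<alpha> UNIV = d \<longrightarrow> d < \<alpha> i + Suc k \<longrightarrow> c \<alpha> = 0"
        and \<beta>: "e = sum \<beta> UNIV" "sum \<beta> UNIV < \<beta> i + k"
      show "c (\<beta>(j := Suc (\<beta> j))) = 0"
        by (rule R[rule_format]) (use \<beta> Suc sum_upd_Suc[of \<beta> j] in auto)
    qed (use Suc in \<open>auto simp: hom_form_axis\<close>)
    finally show ?thesis .
  qed
qed

text \<open>
  The zero function has infinite multiplicity everywhere, so the criterion at a coordinate point,
  taken with a multiplicity above the degree, kills every coefficient.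
\<close>

lemma hom_form_eq_0_imp:
  assumes "hom_form d c = (\<lambda>x. 0)" "sum \<alpha> UNIV = d"
  shows "c \<alpha> = 0"
  using mult_at_least_axis_iff[of d c undefined "Suc d"] assms by simp

lemma euler_hom_form:
  "x $ j * partial_deriv j (hom_form d c) x = hom_form d (\<lambda>\<alpha>. of_nat (\<alpha> j) * c \<alpha>) x"
proof -
  have "of_nat (\<alpha> j) * (x $ j * monom_fun (\<alpha>(j := \<alpha> j - 1)) x) = of_nat (\<alpha> j) * monom_fun \<alpha> x" for \<alpha>
    unfolding monom_fun_upd monom_fun_split[of \<alpha> x j] by (cases "\<alpha> j") auto
  then show ?thesis
    unfolding partial_deriv_hom_form hom_form_def sum_distrib_left
    by (intro sum.cong refl) (simp add: mult_ac)
qed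

text \<open>
  Multiplicity tested with the Euler operators
  \<open>x\<^sub>j \<partial>/\<partial>x\<^sub>j\<close>. These act diagonally on monomials, so the
  condition reads: \<open>\<Sum>\<alpha>. q \<alpha> * c \<alpha> * a\<^sup>\<alpha> = 0\<close> for
  all products \<open>q\<close> of fewer than \<open>k\<close> coordinate functions of the exponent.
  In this form the symmetry \<open>\<alpha> \<mapsto> N - \<alpha>\<close> becomes visible.
\<close>

primrec euler_mult :: "nat \<Rightarrow> nat \<Rightarrow> (('n::finite \<Rightarrow> nat) \<Rightarrow> complex) \<Rightarrow> complex^'n \<Rightarrow> bool" where
  "euler_mult d 0 c a \<longleftrightarrow> True"
| "euler_mult d (Suc k) c a \<longleftrightarrow>
     hom_form d c a = 0 \<and> (\<forall>j. euler_mult d k (\<lambda>\<alpha>. of_nat (\<alpha> j) * c \<alpha>) a)"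

text \<open>
  Where no coordinate vanishes, the factors \<open>x\<^sub>j\<close> that distinguish Euler
  operators from partial derivatives are units.
\<close>

lemma mult_at_least_torus_iff:
  assumes "\<And>i. a $ i \<noteq> 0"
  shows "mult_at_least (hom_form d c) a k \<longleftrightarrow> euler_mult d k c a"
proof (induction k arbitrary: c)
  case (Suc k)
  have "mult_at_least (partial_deriv j (hom_form d c)) a k \<longleftrightarrow>
      mult_at_least (hom_form d (\<lambda>\<alpha>. of_nat (\<alpha> j) * c \<alpha>)) a k" for j
  proof -
    have "mult_at_least (partial_deriv j (hom_form d c)) a k \<longleftrightarrow>
        mult_at_least (\<lambda>x. x $ j * partial_deriv j (hom_form d c) x) a k"
      using mult_at_least_mult[OF polyfun_coord polyfun_partial_deriv[OF polyfun_hom_form]]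
        mult_at_least_cancel[OF polyfun_coord polyfun_partial_deriv[OF polyfun_hom_form] assms]
      by blast
    then show ?thesis by (simp add: euler_hom_form)
  qed
  then show ?case by (simp add: mult_at_least_Suc Suc.IH)
qed simp

lemma euler_mult_add:
  "euler_mult d k c a \<Longrightarrow> euler_mult d k c' a \<Longrightarrow> euler_mult d k (\<lambda>\<alpha>. c \<alpha> + c' \<alpha>) a"
  by (induction k arbitrary: c c') (auto simp: hom_form_add ring_distribs)

lemma euler_mult_cmult: "euler_mult d k c a \<Longrightarrow> euler_mult d k (\<lambda>\<alpha>. s * c \<alpha>) a"
  by (induction k arbitrary: c) (auto simp: hom_form_cmult mult.left_commute[of _ s])

lemma euler_mult_mono: "euler_mult d k c a \<Longrightarrow> j \<le> k \<Longrightarrow> euler_mult d j c a"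
proof (induction k arbitrary: c j)
  case (Suc k) then show ?case by (cases j) auto
qed auto

section \<open>Dimension counts in spaces of functions\<close>

abbreviation (input) cscale :: "complex \<Rightarrow> ('a \<Rightarrow> complex) \<Rightarrow> 'a \<Rightarrow> complex" where
  "cscale c f \<equiv> (\<lambda>x. c * f x)"

abbreviation clinear :: "(('a \<Rightarrow> complex) \<Rightarrow> ('b \<Rightarrow> complex)) \<Rightarrow> bool" where
  "clinear \<equiv> Vector_Spaces.linear cscale cscale"

global_interpretation cfun_pair: vector_space_pair
  "cscale :: complex \<Rightarrow> ('a \<Rightarrow> complex) \<Rightarrow> 'a \<Rightarrow> complex"
  "cscale :: complex \<Rightarrow> ('b \<Rightarrow> complex) \<Rightarrow> 'b \<Rightarrow> complex"
  by unfold_locales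

text \<open>
  The ambient function spaces are infinite dimensional, and there the dimension of a subspace
  carries information only if the subspace lies in a finitely generated one.
\<close>

definition fin_dim :: "('a \<Rightarrow> complex) set \<Rightarrow> bool" where
  "fin_dim V \<longleftrightarrow> (\<exists>W. finite W \<and> V \<subseteq> cfun.span W)"

lemma clinearI:
  assumes "\<And>f g. \<phi> (\<lambda>x. f x + g x) = (\<lambda>y. \<phi> f y + \<phi> g y)" "\<And>s f. \<phi> (\<lambda>x. s * f x) = (\<lambda>y. s * \<phi> f y)"
  shows "clinear \<phi>"
  using assms by unfold_locales (simp_all add: plus_fun_def)

lemma subspace_funI:
  assumes "(\<lambda>x. 0) \<in> V" "\<And>f g. f \<in> V \<Longrightarrow> g \<in> V \<Longrightarrow> (\<lambda>x. f x + g x) \<in> V"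
    "\<And>s f. f \<in> V \<Longrightarrow> (\<lambda>x. s * f x) \<in> V"
  shows "cfun.subspace V"
  using assms unfolding cfun.subspace_def by (simp add: plus_fun_def zero_fun_def)

lemma fin_dim_subset: "fin_dim V \<Longrightarrow> U \<subseteq> V \<Longrightarrow> fin_dim U"
  by (auto simp: fin_dim_def)

lemma fin_dim_basis:
  assumes "fin_dim V" "cfun.subspace V"
  obtains B where "finite B" "B \<subseteq> V" "\<not> cfun.dependent B" "cfun.span B = V" "card B = cfun_dim V"
proof -
  obtain B where B: "B \<subseteq> V" "\<not> cfun.dependent B" "V \<subseteq> cfun.span B" "card B = cfun_dim V"
    using cfun.basis_exists by blast
  obtain W where "finite W" "V \<subseteq> cfun.span W" using assms(1) by (auto simp: fin_dim_def)
  then have "finite B" using B cfun.independent_span_bound[of W B] by blast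
  moreover have "cfun.span B = V"
    using B assms(2) cfun.span_minimal by blast
  ultimately show ?thesis using that B by blast
qed

lemma cfun_dim_mono:
  assumes "fin_dim V" "cfun.subspace V" "cfun.subspace U" "U \<subseteq> V"
  shows "cfun_dim U \<le> cfun_dim V"
proof -
  obtain B where B: "finite B" "cfun.span B = V" "card B = cfun_dim V"
    using fin_dim_basis[OF assms(1,2)] by metis
  obtain C where C: "C \<subseteq> U" "\<not> cfun.dependent C" "card C = cfun_dim U"
    using fin_dim_basis[OF fin_dim_subset[OF assms(1,4)] assms(3)] by metis
  show ?thesis using cfun.independent_span_bound[of B C] B C assms(4) by auto
qed

lemma cfun_dim_eq_0_iff:
  assumes "fin_dim V" "cfun.subspace V"
  shows "cfun_dim V = 0 \<longleftrightarrow> V = {\<lambda>x. 0}"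
proof -
  obtain B where B: "finite B" "cfun.span B = V" "\<not> cfun.dependent B" "card B = cfun_dim V"
    using fin_dim_basis[OF assms] by metis
  show ?thesis
  proof
    assume "cfun_dim V = 0"
    then have "B = {}" using B by simp
    then show "V = {\<lambda>x. 0}" using B by (simp add: cfun.span_empty zero_fun_def)
  next
    assume "V = {\<lambda>x. 0}"
    then have "V \<subseteq> cfun.span {}" by (simp add: zero_fun_def)
    then show "cfun_dim V = 0" using cfun.dim_le_card[of V "{}"] by simp
  qed
qed

lemma cfun_dim_image_inj:
  assumes "clinear \<phi>" "cfun.subspace V" "inj_on \<phi> V"
  shows "cfun_dim (\<phi> ` V) = cfun_dim V"
proof -
  obtain B where B: "B \<subseteq> V" "\<not> cfun.dependent B" "V \<subseteq> cfun.span B" "card B = cfun_dim V"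
    using cfun.basis_exists by blast
  have sp: "cfun.span B = V" using B assms(2) cfun.span_minimal by blast
  have "\<not> cfun.dependent (\<phi> ` B)"
    using B sp assms by (intro cfun_pair.linear_independent_injective_image) auto
  moreover have "cfun.span (\<phi> ` B) = \<phi> ` V"
    using sp cfun_pair.linear_span_image[OF assms(1)] by simp
  ultimately have "cfun_dim (\<phi> ` V) = card (\<phi> ` B)"
    using cfun.dim_span_eq_card_independent by metis
  also have "\<dots> = card B" using B assms(3) by (intro card_image) (auto intro: inj_on_subset)
  finally show ?thesis using B by simp
qed

lemma kernel_subspace:
  assumes lin: "clinear \<phi>" and V: "cfun.subspace V"
  shows "cfun.subspace {v \<in> V. \<phi> v = (\<lambda>x. 0)}"
  unfolding cfun.subspace_def
  using cfun.subspace_0[OF V] cfun.subspace_add[OF V] cfun.subspace_scale[OF V]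
  by (auto simp: cfun_pair.linear_add[OF lin] cfun_pair.linear_scale[OF lin]
      cfun_pair.linear_0[OF lin] fun_eq_iff)

text \<open>
  The half of the rank-nullity theorem needed below: a basis of the kernel together with preimages
  of a basis of the image spans the whole space.
\<close>

lemma cfun_dim_le_kernel_image:
  assumes "clinear \<phi>" "cfun.subspace V" "fin_dim V"
  shows "cfun_dim V \<le> cfun_dim {v \<in> V. \<phi> v = (\<lambda>x. 0)} + cfun_dim (\<phi> ` V)"
proof -
  let ?K = "{v \<in> V. \<phi> v = (\<lambda>x. 0)}"
  have K: "cfun.subspace ?K"
    by (rule kernel_subspace) fact+
  obtain B where B: "finite B" "B \<subseteq> ?K" "cfun.span B = ?K" "card B = cfun_dim ?K"
    using fin_dim_basis[OF fin_dim_subset[OF assms(3)] K] by (metis (no_types, lifting) mem_Collect_eq subsetI)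
  obtain W where W: "finite W" "W \<subseteq> V" "cfun.span W = V"
    using fin_dim_basis[OF assms(3,2)] by metis
  have I: "cfun.subspace (\<phi> ` V)" "fin_dim (\<phi> ` V)"
  proof -
    have "\<phi> ` V = cfun.span (\<phi> ` W)"
      using cfun_pair.linear_span_image[OF assms(1)] W by simp
    then show "cfun.subspace (\<phi> ` V)" "fin_dim (\<phi> ` V)"
      using W by (auto simp: fin_dim_def intro!: exI[of _ "\<phi> ` W"])
  qed
  obtain C where C: "finite C" "C \<subseteq> \<phi> ` V" "cfun.span C = \<phi> ` V" "card C = cfun_dim (\<phi> ` V)"
    using fin_dim_basis[OF I(2,1)] by metis
  obtain P where P: "P \<subseteq> V" "finite P" "card P = card C" "\<phi> ` P = C"
    using C(1,2) by (metis subset_image_inj card_image finite_image_iff)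
  have "V \<subseteq> cfun.span (B \<union> P)"
  proof
    fix v assume v: "v \<in> V"
    then have "\<phi> v \<in> cfun.span (\<phi> ` P)" using C P by auto
    then obtain w where w: "w \<in> cfun.span P" "\<phi> w = \<phi> v"
      using cfun_pair.linear_span_image[OF assms(1)] by (metis imageE)
    have "w \<in> V" using w P assms(2) cfun.span_minimal by blast
    then have "v - w \<in> ?K" using v w assms(1,2)
      by (auto simp: cfun.subspace_diff cfun_pair.linear_diff fun_eq_iff)
    then have "v - w \<in> cfun.span (B \<union> P)" using B cfun.span_mono[of B "B \<union> P"] by auto
    moreover have "w \<in> cfun.span (B \<union> P)" using w cfun.span_mono[of P "B \<union> P"] by auto
    ultimately show "v \<in> cfun.span (B \<union> P)" using cfun.span_add[of "v - w" _ w] by simp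
  qed
  then have "cfun_dim V \<le> card (B \<union> P)" using B P by (intro cfun.dim_le_card) auto
  also have "\<dots> \<le> card B + card P" by (rule card_Un_le)
  finally show ?thesis using B P C by simp
qed

text \<open>
  Subspaces meet in at least the expected dimension. The map used here is the projection of
  \<open>V\<close> along \<open>B\<close> onto a complement; its restriction to \<open>A\<close> has
  kernel inside \<open>A \<inter> B\<close> and rank at most the codimension of \<open>B\<close>.
\<close>

lemma cfun_dim_Int_ge:
  assumes V: "fin_dim V" "cfun.subspace V"
    and A: "cfun.subspace A" "A \<subseteq> V" and B: "cfun.subspace B" "B \<subseteq> V"
  shows "cfun_dim A + cfun_dim B \<le> cfun_dim V + cfun_dim (A \<inter> B)"
proof -
  obtain b where b: "finite b" "b \<subseteq> B" "\<not> cfun.dependent b" "cfun.span b = B" "card b = cfun_dim B"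
    using fin_dim_basis[OF fin_dim_subset[OF V(1) B(2)] B(1)] by metis
  obtain v where v: "b \<subseteq> v" "v \<subseteq> V" "\<not> cfun.dependent v" "V \<subseteq> cfun.span v"
    using cfun.maximal_independent_subset_extend[of b V] b B by blast
  have spv: "cfun.span v = V" using v V cfun.span_minimal by blast
  have cv: "card v = cfun_dim V" using v cfun.basis_card_eq_dim by blast
  have fv: "finite v"
    using V(1) v cfun.independent_span_bound unfolding fin_dim_def by (metis subset_trans)
  define \<phi> where "\<phi> = cfun_pair.construct v (\<lambda>x. if x \<in> b then 0 else x)"
  have lin: "clinear \<phi>" unfolding \<phi>_def by (rule cfun_pair.linear_construct) (rule v)
  have on_basis: "\<phi> x = (if x \<in> b then 0 else x)" if "x \<in> v" for x
    unfolding \<phi>_def by (rule cfun_pair.construct_basis[OF v(3) that])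
  \<comment> \<open>The projection changes vectors only within \<open>B\<close>.\<close>
  have rem: "x - \<phi> x \<in> B" if "x \<in> V" for x
  proof -
    have "x \<in> cfun.span v" using that spv by simp
    then show ?thesis
    proof (induction rule: cfun.span_induct_alt)
      case base
      have "0 - \<phi> 0 = 0" using cfun_pair.linear_0[OF lin] by simp
      then show ?case using cfun.subspace_0[OF B(1)] by metis
    next
      case (step c x y)
      have "x - \<phi> x \<in> B" using on_basis[OF step(1)] b cfun.subspace_0[OF B(1)] by auto
      then have "cscale c (x - \<phi> x) + (y - \<phi> y) \<in> B"
        using step cfun.subspace_add[OF B(1)] cfun.subspace_scale[OF B(1)] by blast
      also have "cscale c (x - \<phi> x) + (y - \<phi> y) = cscale c x + y - \<phi> (cscale c x + y)"
        by (simp add: cfun_pair.linear_add[OF lin] cfun_pair.linear_scale[OF lin] fun_eq_iff algebra_simps)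
      finally show ?case .
    qed
  qed
  have "{x \<in> A. \<phi> x = (\<lambda>x. 0)} \<subseteq> A \<inter> B"
  proof safe
    fix x assume "x \<in> A" "\<phi> x = (\<lambda>x. 0)"
    then show "x \<in> B" using rem[of x] A(2) by (auto simp: zero_fun_def[symmetric])
  qed
  moreover have K: "cfun.subspace {x \<in> A. \<phi> x = (\<lambda>x. 0)}"
    by (rule kernel_subspace) fact+
  moreover have "cfun.subspace (A \<inter> B)" using A B cfun.subspace_inter by blast
  ultimately have 1: "cfun_dim {x \<in> A. \<phi> x = (\<lambda>x. 0)} \<le> cfun_dim (A \<inter> B)"
    using A B by (intro cfun_dim_mono fin_dim_subset[OF V(1)]) auto
  have "\<phi> ` V = cfun.span (\<phi> ` v)" using cfun_pair.linear_span_image[OF lin] spv by simp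
  also have "\<dots> \<subseteq> cfun.span (v - b)"
    by (intro cfun.span_minimal cfun.subspace_span) (auto simp: on_basis cfun.span_zero cfun.span_base)
  finally have "cfun_dim (\<phi> ` A) \<le> card (v - b)"
    using A fv by (intro cfun.dim_le_card) auto
  also have "\<dots> = cfun_dim V - cfun_dim B" using v b cv by (simp add: card_Diff_subset)
  finally have 2: "cfun_dim (\<phi> ` A) \<le> cfun_dim V - cfun_dim B" .
  have "cfun_dim B \<le> cfun_dim V" using cfun_dim_mono V B by blast
  then show ?thesis
    using 1 2 cfun_dim_le_kernel_image[OF lin A(1) fin_dim_subset[OF V(1) A(2)]] by linarith
qed

lemma coordinate_subspace:
  assumes S: "finite S"
  defines "V \<equiv> {c :: 'a \<Rightarrow> complex. \<forall>\<alpha>. \<alpha> \<notin> S \<longrightarrow> c \<alpha> = 0}"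
  shows "cfun.subspace V" "fin_dim V" "cfun_dim V = card S"
proof -
  let ?e = "\<lambda>\<alpha> \<beta>. if \<beta> = \<alpha> then 1 else (0 :: complex)"
  show V: "cfun.subspace V" by (rule subspace_funI) (auto simp: V_def)
  have inj: "inj_on ?e S" by (auto simp: inj_on_def fun_eq_iff split: if_splits)
  have ev: "(\<Sum>f\<in>?e ` S. cscale (u f) f) = (\<lambda>\<beta>. if \<beta> \<in> S then u (?e \<beta>) else 0)" for u
  proof -
    have "(\<Sum>f\<in>?e ` S. cscale (u f) f) = (\<Sum>\<alpha>\<in>S. cscale (u (?e \<alpha>)) (?e \<alpha>))"
      using inj by (simp add: sum.reindex)
    also have "\<dots> = (\<lambda>\<beta>. \<Sum>\<alpha>\<in>S. u (?e \<alpha>) * ?e \<alpha> \<beta>)"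
      using S by (induction S) (auto simp: plus_fun_def zero_fun_def)
    also have "\<dots> = (\<lambda>\<beta>. if \<beta> \<in> S then u (?e \<beta>) else 0)"
      using S by (simp add: if_distrib[of "\<lambda>x. _ * x"] cong: if_cong)
    finally show ?thesis .
  qed
  have sp: "V \<subseteq> cfun.span (?e ` S)"
  proof
    fix c assume c: "c \<in> V"
    let ?u = "\<lambda>f. c (THE \<alpha>. f = ?e \<alpha>)"
    have "(THE \<alpha>. ?e \<beta> = ?e \<alpha>) = \<beta>" for \<beta> :: 'a
      by (rule the_equality) (auto simp: fun_eq_iff split: if_splits)
    then have eq: "(\<Sum>f\<in>?e ` S. cscale (?u f) f) = c"
      unfolding ev using c by (auto simp: V_def fun_eq_iff)
    have "(\<Sum>f\<in>?e ` S. cscale (?u f) f) \<in> cfun.span (?e ` S)"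
      by (rule cfun.span_sum) (rule cfun.span_scale, erule cfun.span_base)
    then show "c \<in> cfun.span (?e ` S)" unfolding eq .
  qed
  then show "fin_dim V" using S by (auto simp: fin_dim_def)
  have "\<not> cfun.dependent (?e ` S)"
  proof
    assume "cfun.dependent (?e ` S)"
    then obtain u where u: "\<exists>f\<in>?e ` S. u f \<noteq> 0" "(\<Sum>f\<in>?e ` S. cscale (u f) f) = 0"
      unfolding cfun.dependent_finite[OF finite_imageI[OF S]] by blast
    from u(1) obtain \<alpha> where \<alpha>: "\<alpha> \<in> S" "u (?e \<alpha>) \<noteq> 0" by blast
    then show False using fun_cong[OF u(2)[unfolded ev], of \<alpha>] by simp
  qed
  moreover have "?e ` S \<subseteq> V" by (auto simp: V_def)
  ultimately have "card (?e ` S) = cfun_dim V"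
    using sp cfun.basis_card_eq_dim by blast
  then show "cfun_dim V = card S" using inj by (simp add: card_image)
qed

lemma clinear_hom_form: "clinear (hom_form d)"
  by (rule clinearI) (simp_all add: hom_form_add hom_form_cmult)

lemma subspace_image: "clinear \<phi> \<Longrightarrow> cfun.subspace V \<Longrightarrow> cfun.subspace (\<phi> ` V)"
  by (rule cfun_pair.linear_subspace_image)

lemma fin_dim_image: "clinear \<phi> \<Longrightarrow> fin_dim V \<Longrightarrow> fin_dim (\<phi> ` V)"
  unfolding fin_dim_def by (metis cfun_pair.linear_span_image finite_imageI image_mono)

lemma forms_subspace: "cfun.subspace (forms d :: (complex^'n::finite \<Rightarrow> complex) set)"
  and fin_dim_forms: "fin_dim (forms d :: (complex^'n::finite \<Rightarrow> complex) set)"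
proof -
  let ?V = "{c :: ('n \<Rightarrow> nat) \<Rightarrow> complex. \<forall>\<alpha>. \<alpha> \<notin> exponents d \<longrightarrow> c \<alpha> = 0}"
  have "(forms d :: (complex^'n \<Rightarrow> complex) set) = hom_form d ` ?V"
  proof -
    have "hom_form d c \<in> hom_form d ` ?V" for c :: "('n \<Rightarrow> nat) \<Rightarrow> complex"
      by (rule image_eqI[of _ _ "\<lambda>\<alpha>. if sum \<alpha> UNIV = d then c \<alpha> else 0"]) (auto intro: hom_form_cong)
    then show ?thesis by (auto simp: forms_eq_hom_form)
  qed
  then show "cfun.subspace (forms d :: (complex^'n \<Rightarrow> complex) set)"
    "fin_dim (forms d :: (complex^'n \<Rightarrow> complex) set)"
    using subspace_image[OF clinear_hom_form coordinate_subspace(1)[OF finite_exponents[of d]]]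
      fin_dim_image[OF clinear_hom_form coordinate_subspace(2)[OF finite_exponents[of d]]]
    by simp_all
qed

lemma lin_sys_subspace:
  fixes p :: "nat \<Rightarrow> complex^'n::finite"
  shows "cfun.subspace (lin_sys p d m)"
proof (rule subspace_funI)
  show "(\<lambda>x. 0) \<in> lin_sys p d m"
    using cfun.subspace_0[OF forms_subspace] by (simp add: lin_sys_def zero_fun_def)
next
  fix f g :: "complex^'n \<Rightarrow> complex" assume "f \<in> lin_sys p d m" "g \<in> lin_sys p d m"
  then show "(\<lambda>x. f x + g x) \<in> lin_sys p d m"
    using cfun.subspace_add[OF forms_subspace, of f d g]
    by (auto simp: lin_sys_def plus_fun_def intro!: mult_at_least_add polyfun_forms)
next
  fix s and f :: "complex^'n \<Rightarrow> complex" assume "f \<in> lin_sys p d m"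
  then show "(\<lambda>x. s * f x) \<in> lin_sys p d m"
    using cfun.subspace_scale[OF forms_subspace, of f d s]
    by (auto simp: lin_sys_def intro!: mult_at_least_cmult polyfun_forms)
qed

lemma fin_dim_lin_sys: "fin_dim (lin_sys p d m)"
  by (rule fin_dim_subset[OF fin_dim_forms[of d]]) (auto simp: lin_sys_def)

lemma lin_sys_nonempty_iff: "(\<exists>F\<in>lin_sys p d m. F \<noteq> (\<lambda>x. 0)) \<longleftrightarrow> 0 < cfun_dim (lin_sys p d m)"
  using cfun_dim_eq_0_iff[OF fin_dim_lin_sys lin_sys_subspace, of p d m]
    cfun.subspace_0[OF lin_sys_subspace, of p d m] by (auto simp: zero_fun_def)

section \<open>General position, frames and changes of coordinates\<close>

lemma distinct_4: "(1::4) \<noteq> 2" "(1::4) \<noteq> 3" "(1::4) \<noteq> 4" "(2::4) \<noteq> 3" "(2::4) \<noteq> 4" "(3::4) \<noteq> 4"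
  by simp_all

text \<open>
  In the type \<open>4\<close> the numeral 4 denotes 0, so the labels 1 to 4 of the frame points are
  listed by cases.
\<close>

definition frame_index :: "4 \<Rightarrow> nat" where
  "frame_index j = (if j = 1 then 1 else if j = 2 then 2 else if j = 3 then 3 else 4)"

lemma frame_index_simps [simp]: "frame_index 1 = 1" "frame_index 2 = 2" "frame_index 3 = 3" "frame_index 4 = 4"
  using distinct_4 by (simp_all add: frame_index_def)

lemma inj_frame_index: "frame_index i = frame_index j \<longleftrightarrow> i = j"
  using exhaust_4[of i] exhaust_4[of j] by auto

lemma set_1_6: "{1..6::nat} = {1,2,3,4,5,6}" by auto

lemma in_1_6: "k \<in> {1..6} \<longleftrightarrow> (\<exists>j. k = frame_index j) \<or> k = 5 \<or> k = 6"
proof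
  assume "k \<in> {1..6}"
  then have "k = frame_index 1 \<or> k = frame_index 2 \<or> k = frame_index 3 \<or> k = frame_index 4 \<or> k = 5 \<or> k = 6"
    unfolding set_1_6 frame_index_simps by blast
  then show "(\<exists>j. k = frame_index j) \<or> k = 5 \<or> k = 6" by blast
next
  have "frame_index j \<in> {1..6}" for j using exhaust_4[of j] by auto
  then show "(\<exists>j. k = frame_index j) \<or> k = 5 \<or> k = 6 \<Longrightarrow> k \<in> {1..6}" by auto
qed

lemma frame_index_range: "frame_index j \<in> {1..6}" "Suc 0 \<le> frame_index j" "frame_index j \<le> 6"
  using exhaust_4[of j] by auto

lemma frame_index_neq [simp]: "frame_index j \<noteq> 5" "frame_index j \<noteq> 6"
  using exhaust_4[of j] by auto

definition relation :: "(nat \<Rightarrow> complex^4) \<Rightarrow> (nat \<Rightarrow> complex) \<Rightarrow> bool" where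
  "relation p l \<longleftrightarrow> (\<Sum>k\<in>{1..6}. l k *s p k) = 0"

text \<open>
  General position phrased through linear relations: a relation among the six vectors that omits two
  of them is trivial. In this form it is inherited under linear maps and permutations, and can be
  computed in a frame.
\<close>

definition linearly_general :: "(nat \<Rightarrow> complex^4) \<Rightarrow> bool" where
  "linearly_general p \<longleftrightarrow> (\<forall>l. \<forall>x\<in>{1..6}. \<forall>y\<in>{1..6}. x \<noteq> y \<longrightarrow> l x = 0 \<longrightarrow> l y = 0 \<longrightarrow> relation p l \<longrightarrow>
     (\<forall>k\<in>{1..6}. l k = 0))"

lemma general_position_linearly_general:
  fixes p :: "nat \<Rightarrow> complex^4"
  assumes "general_position p" shows "linearly_general p"
  unfolding linearly_general_def
proof (intro allI ballI impI)
  fix l x y k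
  assume xy: "x \<in> {1..6}" "y \<in> {1..6}" "x \<noteq> y" and l: "l x = 0" "l y = 0" "relation p l"
    and k: "k \<in> {1..6::nat}"
  let ?I = "{1..6} - {x, y}"
  have "card ?I \<le> 4" using xy by (simp add: card_Diff_subset)
  then have inj: "inj_on p ?I" and ind: "vec.independent (p ` ?I)"
    using assms unfolding general_position_def by auto
  have "(\<Sum>k\<in>?I. l k *s p k) = 0"
    using l sum.mono_neutral_left[of "{1..6}" ?I "\<lambda>k. l k *s p k"] by (auto simp: relation_def)
  then have sum0: "(\<Sum>v\<in>p ` ?I. l (the_inv_into ?I p v) *s v) = 0"
    using inj by (simp add: sum.reindex the_inv_into_f_f)
  have "l k = 0" if "k \<in> ?I" for k
  proof (rule ccontr)
    assume "l k \<noteq> 0"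
    then have "\<exists>v\<in>p ` ?I. l (the_inv_into ?I p v) \<noteq> 0"
      using that inj by (intro bexI[of _ "p k"]) (simp_all add: the_inv_into_f_f)
    then have "vec.dependent (p ` ?I)"
      using sum0 by (subst vec.dependent_finite)
        (auto intro!: exI[of _ "\<lambda>v. l (the_inv_into ?I p v)"] simp del: image_eqI)
    then show False using ind by blast
  qed
  then show "l k = 0" using k l by blast
qed

definition framed :: "(nat \<Rightarrow> complex^4) \<Rightarrow> bool" where
  "framed p \<longleftrightarrow> (\<forall>j. p (frame_index j) = axis j 1)"

lemma framed_relation_iff:
  assumes "framed p"
  shows "relation p l \<longleftrightarrow> (\<forall>j. l (frame_index j) + l 5 * p 5 $ j + l 6 * p 6 $ j = 0)"
proof -
  have "p 1 = axis 1 1" "p 2 = axis 2 1" "p 3 = axis 3 1" "p 4 = axis 4 1"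
    using assms[unfolded framed_def, rule_format, of 1] assms[unfolded framed_def, rule_format, of 2]
      assms[unfolded framed_def, rule_format, of 3] assms[unfolded framed_def, rule_format, of 4] by auto
  then show ?thesis
    unfolding relation_def set_1_6 vec_eq_iff forall_4
    using distinct_4 by (simp add: axis_def add.assoc)
qed

text \<open>
  In the frame of the first four points, general position of the six says that all coordinates of
  the remaining two and all their two-by-two minors are nonzero. Both conditions survive the
  inversion of all coordinates, which is why a Cremona transformation leads to six points in general
  position again.
\<close>

definition generic_torus_pair :: "complex^4 \<Rightarrow> complex^4 \<Rightarrow> bool" where
  "generic_torus_pair a b \<longleftrightarrow> (\<forall>j. a $ j \<noteq> 0 \<and> b $ j \<noteq> 0) \<and> (\<forall>i j. i \<noteq> j \<longrightarrow> a $ i * b $ j \<noteq> a $ j * b $ i)"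

lemma linearly_generalD:
  assumes "linearly_general p" "relation p l" "x \<in> {1..6}" "y \<in> {1..6}" "x \<noteq> y" "l x = 0" "l y = 0" "k \<in> {1..6}"
  shows "l k = 0"
  using assms unfolding linearly_general_def by blast

text \<open>
  A vanishing coordinate or minor would produce a relation that omits two of the six points.
\<close>

lemma framed_general_torus:
  assumes "framed p" "linearly_general p" shows "generic_torus_pair (p 5) (p 6)"
proof -
  have a: "p 5 $ j \<noteq> 0" for j
  proof
    assume 0: "p 5 $ j = 0"
    define l where "l = (\<lambda>k. if k = 5 then 1 else if k = 6 then 0 else - (p 5 $ (inv frame_index k)))"
    have l: "l (frame_index i) = - (p 5 $ i)" for i by (simp add: l_def inv_f_f inj_def inj_frame_index)
    have "l 5 = 0"
    proof (rule linearly_generalD[OF assms(2), of _ "frame_index j" 6])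
      show "relation p l" unfolding framed_relation_iff[OF assms(1)] l by (simp add: l_def)
      show "l (frame_index j) = 0" by (simp add: l 0)
    qed (auto simp: frame_index_range, auto simp: l_def)
    then show False by (simp add: l_def)
  qed
  have b: "p 6 $ j \<noteq> 0" for j
  proof
    assume 0: "p 6 $ j = 0"
    define l where "l = (\<lambda>k. if k = 6 then 1 else if k = 5 then 0 else - (p 6 $ (inv frame_index k)))"
    have l: "l (frame_index i) = - (p 6 $ i)" for i by (simp add: l_def inv_f_f inj_def inj_frame_index)
    have "l 6 = 0"
    proof (rule linearly_generalD[OF assms(2), of _ "frame_index j" 5])
      show "relation p l" unfolding framed_relation_iff[OF assms(1)] l by (simp add: l_def)
      show "l (frame_index j) = 0" by (simp add: l 0)
    qed (auto simp: frame_index_range, auto simp: l_def)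
    then show False by (simp add: l_def)
  qed
  have "p 5 $ i * p 6 $ j \<noteq> p 5 $ j * p 6 $ i" if "i \<noteq> j" for i j
  proof
    assume eq: "p 5 $ i * p 6 $ j = p 5 $ j * p 6 $ i"
    define l where "l = (\<lambda>k. if k = 5 then p 6 $ i else if k = 6 then - p 5 $ i
      else p 5 $ i * p 6 $ (inv frame_index k) - p 6 $ i * p 5 $ (inv frame_index k))"
    have l: "l (frame_index k) = p 5 $ i * p 6 $ k - p 6 $ i * p 5 $ k" for k
      by (simp add: l_def inv_f_f inj_def inj_frame_index)
    have "l 5 = 0"
    proof (rule linearly_generalD[OF assms(2), of _ "frame_index i" "frame_index j"])
      show "relation p l" unfolding framed_relation_iff[OF assms(1)] l by (simp add: l_def)
      show "l (frame_index i) = 0" "l (frame_index j) = 0" using eq by (simp_all add: l mult_ac)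
    qed (use that in \<open>auto simp: frame_index_range inj_frame_index\<close>)
    then show False using b by (simp add: l_def)
  qed
  then show ?thesis using a b by (auto simp: generic_torus_pair_def)
qed

lemma framed_torus_general:
  assumes "framed p" and T: "generic_torus_pair (p 5) (p 6)" shows "linearly_general p"
  unfolding linearly_general_def
proof (intro allI ballI impI)
  fix l x y k
  assume xy: "x \<in> {1..6}" "y \<in> {1..6}" "x \<noteq> y" and l0: "l x = 0" "l y = 0" and R: "relation p l"
    and k: "k \<in> {1..6::nat}"
  note cases = xy(1)[unfolded in_1_6] xy(2)[unfolded in_1_6] k[unfolded in_1_6]
  have R: "l (frame_index j) + l 5 * p 5 $ j + l 6 * p 6 $ j = 0" for j
    using R by (simp add: framed_relation_iff[OF assms(1)])
  have a: "p 5 $ j \<noteq> 0" and b: "p 6 $ j \<noteq> 0" for j using T by (auto simp: generic_torus_pair_def)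
  have key: "l 5 = 0 \<and> l 6 = 0"
  proof (cases "l 5 = 0 \<or> l 6 = 0")
    case True
    show ?thesis
    proof (cases "\<exists>j. l (frame_index j) = 0")
      case T2: True
      then obtain j where "l (frame_index j) = 0" by blast
      then show ?thesis using True R[of j] a[of j] b[of j] by auto
    next
      case False
      then have "x = 5 \<or> x = 6" "y = 5 \<or> y = 6" using cases l0 by auto
      then show ?thesis using xy l0 by auto
    qed
  next
    case False
    then obtain i j where ij: "x = frame_index i" "y = frame_index j" using cases l0 by auto
    then have "i \<noteq> j" using xy by auto
    then have det: "p 5 $ i * p 6 $ j - p 5 $ j * p 6 $ i \<noteq> 0" using T by (auto simp: generic_torus_pair_def)
    have "l 5 * (p 5 $ i * p 6 $ j - p 5 $ j * p 6 $ i) =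
        p 6 $ j * (l 5 * p 5 $ i + l 6 * p 6 $ i) - p 6 $ i * (l 5 * p 5 $ j + l 6 * p 6 $ j)"
      by (simp add: algebra_simps)
    also have "\<dots> = 0" using R[of i] R[of j] l0 ij by simp
    finally have "l 5 = 0" using det by simp
    then show ?thesis using False by blast
  qed
  then have "l (frame_index j) = 0" for j using R[of j] by simp
  then show "l k = 0" using key cases by auto
qed

lemma linearly_general_permute:
  assumes "linearly_general p" "bij_betw \<pi> {1..6} {1..6}" shows "linearly_general (p \<circ> \<pi>)"
  unfolding linearly_general_def
proof (intro allI ballI impI)
  fix l x y k
  assume xy: "x \<in> {1..6}" "y \<in> {1..6}" "x \<noteq> y" and l0: "l x = 0" "l y = 0"
    and R: "relation (p \<circ> \<pi>) l" and k: "k \<in> {1..6::nat}"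
  let ?l = "l \<circ> the_inv_into {1..6} \<pi>"
  have inv: "the_inv_into {1..6} \<pi> (\<pi> i) = i" if "i \<in> {1..6}" for i
    using assms(2) that by (auto simp: bij_betw_def the_inv_into_f_f)
  have "(\<Sum>k\<in>{1..6}. ?l k *s p k) = (\<Sum>k\<in>{1..6}. ?l (\<pi> k) *s p (\<pi> k))"
    by (rule sum.reindex_bij_betw[OF assms(2), symmetric])
  also have "\<dots> = 0" using R inv by (simp add: relation_def)
  finally have rel: "relation p ?l" unfolding relation_def .
  have mem: "\<pi> i \<in> {1..6}" if "i \<in> {1..6}" for i using assms(2) that by (rule bij_betw_apply)
  have ne: "\<pi> x \<noteq> \<pi> y" using inv[OF xy(1)] inv[OF xy(2)] xy(3) by metis
  have "?l (\<pi> k) = 0"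
    by (rule linearly_generalD[OF assms(1) rel mem[OF xy(1)] mem[OF xy(2)] ne _ _ mem[OF k]])
       (simp_all only: comp_apply inv[OF xy(1)] inv[OF xy(2)] l0)
  then show "l k = 0" using inv[OF k] by simp
qed

lemma lin_sys_permute:
  fixes p :: "nat \<Rightarrow> complex^4"
  assumes "bij_betw \<pi> {1..6} {1..6}"
  shows "lin_sys (p \<circ> \<pi>) d (m \<circ> \<pi>) = lin_sys p d m"
proof -
  have im: "{1..6} = \<pi> ` {1..6}" using assms by (simp add: bij_betw_def)
  have "(\<forall>i\<in>{1..6}. mult_at_least F (p i) (m i)) \<longleftrightarrow>
      (\<forall>i\<in>{1..6}. mult_at_least F (p (\<pi> i)) (m (\<pi> i)))" for F
    by (subst im) (simp only: ball_simps)
  then show ?thesis by (simp add: lin_sys_def)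
qed

lemma monom_fun_in_forms: "monom_fun \<alpha> \<in> forms (sum \<alpha> UNIV)"
proof -
  have "hom_form (sum \<alpha> UNIV) (\<lambda>\<beta>. if \<beta> = \<alpha> then 1 else 0) = monom_fun \<alpha>"
    by (rule ext) (simp add: hom_form_def if_distrib[of "\<lambda>x. x * _"] cong: if_cong)
  then show ?thesis unfolding forms_eq_hom_form by (metis rangeI)
qed

lemma forms_cmult: "F \<in> forms d \<Longrightarrow> (\<lambda>x. s * F x) \<in> forms d"
  using cfun.subspace_scale[OF forms_subspace] .

lemma forms_sum: "(\<And>i. i \<in> S \<Longrightarrow> F i \<in> forms d) \<Longrightarrow> (\<lambda>x. \<Sum>i\<in>S. F i x) \<in> forms d"
proof (induction S rule: infinite_finite_induct)
  case (insert i S)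
  then have "F i + (\<lambda>x. \<Sum>i\<in>S. F i x) \<in> forms d"
    by (intro cfun.subspace_add[OF forms_subspace]) auto
  then show ?case using insert by (simp add: plus_fun_def)
qed (use cfun.subspace_0[OF forms_subspace] in \<open>simp_all add: zero_fun_def\<close>)

lemma monom_fun_add: "monom_fun (\<lambda>i. \<alpha> i + \<beta> i) x = monom_fun \<alpha> x * monom_fun \<beta> x"
  by (simp add: monom_fun_def power_add prod.distrib)

lemma forms_mult:
  assumes "F \<in> forms d" "G \<in> forms e"
  shows "(\<lambda>x. F x * G x) \<in> forms (d + e)"
proof -
  obtain c c' where F: "F = hom_form d c" and G: "G = hom_form e c'"
    using assms by (auto simp: forms_eq_hom_form)
  have "(\<lambda>x. F x * G x) = (\<lambda>x. \<Sum>\<alpha>\<in>exponents d. \<Sum>\<beta>\<in>exponents e.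
      (c \<alpha> * c' \<beta>) * monom_fun (\<lambda>i. \<alpha> i + \<beta> i) x)"
    unfolding F G hom_form_def sum_product by (simp add: monom_fun_add mult_ac)
  also have "\<dots> \<in> forms (d + e)"
  proof (intro forms_sum forms_cmult)
    fix \<alpha> \<beta> :: "'a \<Rightarrow> nat"
    assume "\<alpha> \<in> exponents d" "\<beta> \<in> exponents e"
    then show "monom_fun (\<lambda>i. \<alpha> i + \<beta> i) \<in> forms (d + e)"
      using monom_fun_in_forms[of "\<lambda>i. \<alpha> i + \<beta> i"] by (simp add: sum.distrib)
  qed
  finally show ?thesis .
qed

lemma forms_const: "(\<lambda>x. s) \<in> forms 0"
  using forms_cmult[OF monom_fun_in_forms[of "\<lambda>_. 0"], of s] by (simp add: monom_fun_def)

lemma forms_power: "F \<in> forms d \<Longrightarrow> (\<lambda>x. F x ^ k) \<in> forms (k * d)"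
  by (induction k) (auto simp: forms_const dest: forms_mult)

lemma forms_prod:
  "(\<And>i. i \<in> S \<Longrightarrow> F i \<in> forms (e i)) \<Longrightarrow> (\<lambda>x. \<Prod>i\<in>S. F i x) \<in> forms (sum e S)"
  by (induction S rule: infinite_finite_induct) (auto simp: forms_const forms_mult)

lemma forms_coord: "(\<lambda>x. x $ i) \<in> forms 1"
proof -
  have "monom_fun (\<lambda>j. if j = i then 1 else 0) = (\<lambda>x. x $ i)"
    by (simp add: fun_eq_iff monom_fun_split[of _ _ i])
  then show ?thesis using monom_fun_in_forms[of "\<lambda>j. if j = i then 1 else 0"] by simp
qed

lemma forms_linear:
  fixes A :: "complex^'n::finite^'m::finite"
  assumes "F \<in> forms d"
  shows "(\<lambda>x. F (A *v x)) \<in> forms d"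
proof -
  obtain c where F: "F = hom_form d c" using assms by (auto simp: forms_eq_hom_form)
  have 1: "(\<lambda>x. (A *v x) $ i) \<in> forms 1" for i
    unfolding matrix_vector_mult_def vec_lambda_beta
    by (intro forms_sum forms_cmult forms_coord)
  have "(\<lambda>x. monom_fun \<alpha> (A *v x)) \<in> forms (sum \<alpha> UNIV)" for \<alpha>
    using forms_prod[of UNIV "\<lambda>i x. (A *v x) $ i ^ \<alpha> i" \<alpha>] forms_power[OF 1] 
    unfolding monom_fun_def by simp
  then show ?thesis
    unfolding F hom_form_def by (intro forms_sum forms_cmult) auto
qed

text \<open>
  Pulling forms back along the matrix \<open>A\<close> identifies the two systems.
\<close>

lemma lin_sys_linear:
  fixes A B :: "complex^4^4"
  assumes AB: "A ** B = mat 1"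
  shows "cfun_dim (lin_sys (\<lambda>i. B *v p i) d m) = cfun_dim (lin_sys p d m)"
proof -
  have BA: "B ** A = mat 1" using AB by (simp add: matrix_left_right_inverse)
  have AB': "A *v (B *v x) = x" and BA': "B *v (A *v x) = x" for x
    using AB BA by (simp_all add: matrix_vector_mul_assoc)
  let ?\<phi> = "\<lambda>(F :: complex^4 \<Rightarrow> complex) x. F (A *v x)"
  have "lin_sys (\<lambda>i. B *v p i) d m = ?\<phi> ` lin_sys p d m"
  proof safe
    fix F assume F: "F \<in> lin_sys (\<lambda>i. B *v p i) d m"
    then have "(\<lambda>x. F (B *v x)) \<in> lin_sys p d m"
      by (auto simp: lin_sys_def intro!: forms_linear mult_at_least_linear polyfun_forms[of F d])
    then show "F \<in> ?\<phi> ` lin_sys p d m"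
      by (rule rev_image_eqI) (simp add: BA')
  next
    fix F assume "F \<in> lin_sys p d m"
    then show "(\<lambda>x. F (A *v x)) \<in> lin_sys (\<lambda>i. B *v p i) d m"
      by (auto simp: lin_sys_def AB' intro!: forms_linear mult_at_least_linear polyfun_forms[of F d])
  qed
  moreover have "clinear ?\<phi>" by (rule clinearI) auto
  moreover have "inj_on ?\<phi> (lin_sys p d m)"
    by (rule inj_onI) (metis AB' ext)
  ultimately show ?thesis using cfun_dim_image_inj[OF _ lin_sys_subspace] by simp
qed

text \<open>
  The first four vectors form a basis, which a linear change of coordinates turns into the standard
  one.
\<close>

lemma linearly_general_frame:
  assumes "linearly_general p"
  obtains q where "framed q" "linearly_general q" "\<And>d m. cfun_dim (lin_sys q d m) = cfun_dim (lin_sys p d m)"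
proof -
  define A :: "complex^4^4" where "A = (\<chi> i j. p (frame_index j) $ i)"
  have col: "column j A = p (frame_index j)" for j by (simp add: A_def column_def vec_eq_iff)
  have "\<exists>B. B ** A = mat 1"
    unfolding matrix_left_invertible_independent_columns col
  proof (intro allI impI)
    fix c j assume 0: "(\<Sum>i\<in>UNIV. c i *s p (frame_index i)) = 0"
    define l where "l k = (if k = 5 \<or> k = 6 then 0 else c (inv frame_index k))" for k :: nat
    have l: "l (frame_index i) = c i" for i by (simp add: l_def inv_f_f inj_def inj_frame_index)
    have "relation p l"
      unfolding relation_def set_1_6 using 0 l[of 1] l[of 2] l[of 3] l[of 4]
      by (simp add: sum_4 add.assoc) (simp add: l_def)
    then have "l (frame_index j) = 0"
      by (rule linearly_generalD[OF assms, of l 5 6]) (auto simp: l_def frame_index_range)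
    then show "c j = 0" by (simp add: l)
  qed
  then obtain B where BA: "B ** A = mat 1" by blast
  then have AB: "A ** B = mat 1" by (simp add: matrix_left_right_inverse)
  define q where "q = (\<lambda>i. B *v p i)"
  have "A *v axis j 1 = p (frame_index j)" for j
    by (simp add: A_def vec_eq_iff matrix_vector_mult_def axis_def if_distrib[of "\<lambda>x. _ * x"] cong: if_cong)
  then have "B *v p (frame_index j) = axis j 1" for j
    using BA by (metis matrix_vector_mul_assoc matrix_vector_mul_lid)
  then have "framed q" by (simp add: framed_def q_def)
  moreover have "linearly_general q"
    unfolding linearly_general_def
  proof (intro allI ballI impI)
    fix l x y k
    assume xy: "x \<in> {1..6}" "y \<in> {1..6}" "x \<noteq> y" "l x = 0" "l y = 0"
      and R: "relation q l" and k: "k \<in> {1..6::nat}"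
    have Aq: "A *v q i = p i" for i using AB by (simp add: q_def matrix_vector_mul_assoc)
    have "A *v (\<Sum>k\<in>{1..6}. l k *s q k) = (\<Sum>k\<in>{1..6}. l k *s (A *v q k))"
      by (simp only: vec.linear_sum[OF matrix_vector_mul_linear_gen] vec.linear_scale[OF matrix_vector_mul_linear_gen])
    then have "relation p l" using R unfolding relation_def Aq
      by (simp only: matrix_vector_mult_0_right)
    then show "l k = 0" using linearly_generalD[OF assms _ xy(1,2,3,4,5) k] by blast
  qed
  moreover have "cfun_dim (lin_sys q d m) = cfun_dim (lin_sys p d m)" for d m
    unfolding q_def by (rule lin_sys_linear[OF AB])
  ultimately show ?thesis using that by blast
qed

section \<open>Coefficient systems and the Cremona reflection\<close>

text \<open>
  Coefficient vectors of forms whose exponents lie in a box, with conditions of order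
  \<open>k\<close> and \<open>l\<close> at two points of the torus. For four points at the
  coordinate points the multiplicities \<open>m j\<close> amount to the box with sides
  \<open>N j = d - m j\<close>. The sides rather than the multiplicities are kept as parameters
  since they are what the reflection below preserves.
\<close>

definition coeff_sys ::
  "nat \<Rightarrow> ('n::finite \<Rightarrow> nat) \<Rightarrow> nat \<Rightarrow> complex^'n \<Rightarrow> nat \<Rightarrow> complex^'n \<Rightarrow> (('n \<Rightarrow> nat) \<Rightarrow> complex) set" where
  "coeff_sys d N k a l b =
     {c. (\<forall>\<alpha>. c \<alpha> \<noteq> 0 \<longrightarrow> sum \<alpha> UNIV = d \<and> (\<forall>j. \<alpha> j \<le> N j)) \<and> euler_mult d k c a \<and> euler_mult d l c b}"

lemma euler_mult_zero: "euler_mult d k (\<lambda>\<alpha>. 0) a"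
  by (induction k) (simp_all add: hom_form_def)

lemma coeff_sys_subspace: "cfun.subspace (coeff_sys d N k a l b)"
proof (rule subspace_funI)
  show "(\<lambda>x. 0) \<in> coeff_sys d N k a l b" by (simp add: coeff_sys_def euler_mult_zero)
next
  fix f g assume "f \<in> coeff_sys d N k a l b" "g \<in> coeff_sys d N k a l b"
  moreover from this have "sum \<alpha> UNIV = d \<and> (\<forall>j. \<alpha> j \<le> N j)" if "f \<alpha> + g \<alpha> \<noteq> 0" for \<alpha>
    using that unfolding coeff_sys_def by (metis (mono_tags, lifting) add_0 mem_Collect_eq)
  ultimately show "(\<lambda>x. f x + g x) \<in> coeff_sys d N k a l b"
    by (auto simp: coeff_sys_def intro: euler_mult_add)
next
  fix s f assume "f \<in> coeff_sys d N k a l b"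
  then show "(\<lambda>x. s * f x) \<in> coeff_sys d N k a l b"
    by (auto simp: coeff_sys_def intro: euler_mult_cmult)
qed

lemma fin_dim_coeff_sys: "fin_dim (coeff_sys d N k a l b)"
  by (rule fin_dim_subset[OF coordinate_subspace(2)[OF finite_exponents[of d]]])
     (auto simp: coeff_sys_def)

lemma inj_on_hom_form:
  assumes "\<And>c \<alpha>. c \<in> V \<Longrightarrow> c \<alpha> \<noteq> 0 \<Longrightarrow> sum \<alpha> UNIV = d"
  shows "inj_on (hom_form d) V"
proof (rule inj_onI, rule ext)
  fix c c' \<alpha> assume *: "c \<in> V" "c' \<in> V" "hom_form d c = hom_form d c'"
  show "c \<alpha> = c' \<alpha>"
  proof (cases "sum \<alpha> UNIV = d")
    case True
    have "hom_form d (\<lambda>\<alpha>. c \<alpha> + (-1) * c' \<alpha>) = (\<lambda>x. 0)"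
      unfolding hom_form_add hom_form_cmult using *(3) by simp
    from hom_form_eq_0_imp[OF this True] show ?thesis by simp
  next
    case False
    then show ?thesis using assms * by metis
  qed
qed

lemma lin_sys_framed_iff:
  assumes "framed p" "generic_torus_pair (p 5) (p 6)"
  shows "hom_form d c \<in> lin_sys p d m \<longleftrightarrow>
    (\<forall>\<alpha>. sum \<alpha> UNIV = d \<longrightarrow> c \<alpha> \<noteq> 0 \<longrightarrow> (\<forall>j. \<alpha> j + m (frame_index j) \<le> d)) \<and>
    euler_mult d (m 5) c (p 5) \<and> euler_mult d (m 6) c (p 6)"
proof -
  have "hom_form d c \<in> lin_sys p d m \<longleftrightarrow> (\<forall>i\<in>{1..6}. mult_at_least (hom_form d c) (p i) (m i))"
    by (simp add: lin_sys_def forms_eq_hom_form)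
  also have "\<dots> \<longleftrightarrow> (\<forall>j. mult_at_least (hom_form d c) (p (frame_index j)) (m (frame_index j))) \<and>
      mult_at_least (hom_form d c) (p 5) (m 5) \<and> mult_at_least (hom_form d c) (p 6) (m 6)"
    unfolding Ball_def in_1_6 by blast
  also have "mult_at_least (hom_form d c) (p 5) (m 5) \<longleftrightarrow> euler_mult d (m 5) c (p 5)"
    using assms(2) by (intro mult_at_least_torus_iff) (simp add: generic_torus_pair_def)
  also have "mult_at_least (hom_form d c) (p 6) (m 6) \<longleftrightarrow> euler_mult d (m 6) c (p 6)"
    using assms(2) by (intro mult_at_least_torus_iff) (simp add: generic_torus_pair_def)
  also have "(\<forall>j. mult_at_least (hom_form d c) (p (frame_index j)) (m (frame_index j))) \<longleftrightarrow>
      (\<forall>\<alpha>. sum \<alpha> UNIV = d \<longrightarrow> c \<alpha> \<noteq> 0 \<longrightarrow> (\<forall>j. \<alpha> j + m (frame_index j) \<le> d))"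
    using assms(1) unfolding framed_def by (simp add: mult_at_least_axis_iff not_le[symmetric]) blast
  finally show ?thesis .
qed

lemma lin_sys_framed:
  assumes "framed p" "generic_torus_pair (p 5) (p 6)" "\<forall>j. m (frame_index j) \<le> d"
  shows "lin_sys p d m = hom_form d ` coeff_sys d (\<lambda>j. d - m (frame_index j)) (m 5) (p 5) (m 6) (p 6)"
    (is "_ = _ ` ?K")
proof safe
  fix F assume F: "F \<in> lin_sys p d m"
  then obtain c where c: "F = hom_form d c" by (auto simp: lin_sys_def forms_eq_hom_form)
  let ?c = "\<lambda>\<alpha>. if sum \<alpha> UNIV = d then c \<alpha> else 0"
  have "F = hom_form d ?c" unfolding c by (rule hom_form_cong) simp
  moreover have "?c \<in> ?K"
    using F[unfolded \<open>F = hom_form d ?c\<close> lin_sys_framed_iff[OF assms(1,2)]] 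
    by (auto simp: coeff_sys_def le_diff_conv2 assms(3))
  ultimately show "F \<in> hom_form d ` ?K" by (rule image_eqI)
next
  fix c assume c: "c \<in> ?K"
  have "\<alpha> j + m (frame_index j) \<le> d" if "c \<alpha> \<noteq> 0" for \<alpha> j
  proof -
    have "\<alpha> j \<le> d - m (frame_index j)" using c that by (auto simp: coeff_sys_def)
    then show ?thesis using assms(3) by (simp add: le_diff_conv2)
  qed
  then show "hom_form d c \<in> lin_sys p d m"
    unfolding lin_sys_framed_iff[OF assms(1,2)] using c by (auto simp: coeff_sys_def)
qed

lemma lin_sys_framed_dim:
  assumes "framed p" "generic_torus_pair (p 5) (p 6)" "\<forall>j. m (frame_index j) \<le> d"
  shows "cfun_dim (lin_sys p d m) =
    cfun_dim (coeff_sys d (\<lambda>j. d - m (frame_index j)) (m 5) (p 5) (m 6) (p 6))"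
  unfolding lin_sys_framed[OF assms]
  by (rule cfun_dim_image_inj[OF clinear_hom_form coeff_sys_subspace inj_on_hom_form])
     (simp add: coeff_sys_def)

lemma framed_mult_le_degree:
  assumes "framed p" "generic_torus_pair (p 5) (p 6)" "0 < cfun_dim (lin_sys p d m)"
  shows "m (frame_index j) \<le> d"
proof (rule ccontr)
  assume j: "\<not> m (frame_index j) \<le> d"
  obtain F where F: "F \<in> lin_sys p d m" "F \<noteq> (\<lambda>x. 0)"
    using assms(3) lin_sys_nonempty_iff by blast
  then obtain c where c: "F = hom_form d c" by (auto simp: lin_sys_def forms_eq_hom_form)
  have "c \<alpha> = 0" if "sum \<alpha> UNIV = d" for \<alpha>
  proof (rule ccontr)
    assume "c \<alpha> \<noteq> 0"
    then have "\<alpha> j + m (frame_index j) \<le> d"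
      using F(1)[unfolded c lin_sys_framed_iff[OF assms(1,2)]] that by blast
    then show False using j by simp
  qed
  then have "F = hom_form d (\<lambda>_. 0)" unfolding c by (rule hom_form_cong)
  then show False using F(2) by (simp add: hom_form_def fun_eq_iff)
qed

text \<open>
  The standard Cremona transformation on coefficients: \<open>F(x)\<close> goes to
  \<open>x\<^sup>N F(1/x)\<close>, that is, exponents \<open>\<alpha>\<close> go to
  \<open>N - \<alpha>\<close>.
\<close>

definition reflect :: "('n \<Rightarrow> nat) \<Rightarrow> (('n \<Rightarrow> nat) \<Rightarrow> complex) \<Rightarrow> ('n \<Rightarrow> nat) \<Rightarrow> complex" where
  "reflect N c = (\<lambda>\<beta>. if \<forall>j. \<beta> j \<le> N j then c (\<lambda>j. N j - \<beta> j) else 0)"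

lemma clinear_reflect: "clinear (reflect N)"
  by (rule clinearI) (auto simp: reflect_def)

lemma hom_form_reflect:
  fixes a :: "complex^'n::finite"
  assumes a: "\<And>j. a $ j \<noteq> 0" and c: "\<And>\<alpha>. c \<alpha> \<noteq> 0 \<Longrightarrow> \<forall>j. \<alpha> j \<le> N j" and d: "d \<le> sum N UNIV"
  shows "hom_form (sum N UNIV - d) (reflect N c) (\<chi> j. inverse (a $ j)) * monom_fun N a = hom_form d c a"
proof -
  let ?b = "\<chi> j. inverse (a $ j)"
  have m: "monom_fun \<beta> ?b * monom_fun N a = monom_fun (\<lambda>j. N j - \<beta> j) a" if "\<forall>j. \<beta> j \<le> N j" for \<beta>
  proof -
    have "inverse (a $ j) ^ \<beta> j * a $ j ^ N j = a $ j ^ (N j - \<beta> j)" for j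
      using that a by (simp add: power_diff field_simps)
    then show ?thesis by (simp add: monom_fun_def flip: prod.distrib)
  qed
  have "hom_form (sum N UNIV - d) (reflect N c) ?b * monom_fun N a =
      (\<Sum>\<beta>\<in>{\<beta> \<in> exponents (sum N UNIV - d). \<forall>j. \<beta> j \<le> N j}. c (\<lambda>j. N j - \<beta> j) * monom_fun \<beta> ?b * monom_fun N a)"
    unfolding hom_form_def sum_distrib_right
    by (rule sum.mono_neutral_cong_right) (auto simp: reflect_def)
  also have "\<dots> = (\<Sum>\<alpha>\<in>{\<alpha> \<in> exponents d. \<forall>j. \<alpha> j \<le> N j}. c \<alpha> * monom_fun \<alpha> a)"
    by (rule sum.reindex_bij_witness[of _ "\<lambda>\<alpha> j. N j - \<alpha> j" "\<lambda>\<beta> j. N j - \<beta> j"])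
       (auto simp: sum_subtractf_nat d m mult.assoc)
  also have "\<dots> = hom_form d c a"
    unfolding hom_form_def by (rule sum.mono_neutral_left) (use c in auto)
  finally show ?thesis .
qed

lemma reflect_euler:
  "(\<lambda>\<beta>. of_nat (\<beta> j) * reflect N c \<beta>) =
     (\<lambda>\<beta>. of_nat (N j) * reflect N c \<beta> + (-1) * reflect N (\<lambda>\<alpha>. of_nat (\<alpha> j) * c \<alpha>) \<beta>)"
  by (auto simp: reflect_def fun_eq_iff of_nat_diff algebra_simps)

text \<open>
  Multiplication by an exponent \<open>\<beta> j = N j - \<alpha> j\<close> is an affine function of
  multiplication by \<open>\<alpha> j\<close>, so the conditions of order below \<open>k\<close> at
  \<open>a\<close> turn into those at the inverted point.
\<close>

lemma euler_mult_reflect: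
  fixes a :: "complex^'n::finite"
  assumes a: "\<And>j. a $ j \<noteq> 0" and d: "d \<le> sum N UNIV"
    and c: "\<And>\<alpha>. c \<alpha> \<noteq> 0 \<Longrightarrow> \<forall>j. \<alpha> j \<le> N j" and e: "euler_mult d k c a"
  shows "euler_mult (sum N UNIV - d) k (reflect N c) (\<chi> j. inverse (a $ j))"
  using c e
proof (induction k arbitrary: c)
  case (Suc k)
  have "monom_fun N a \<noteq> 0" using a by (simp add: monom_fun_def)
  moreover have "hom_form (sum N UNIV - d) (reflect N c) (\<chi> j. inverse (a $ j)) * monom_fun N a = 0"
    using Suc.prems hom_form_reflect[OF a Suc.prems(1) d] by simp
  ultimately have 0: "hom_form (sum N UNIV - d) (reflect N c) (\<chi> j. inverse (a $ j)) = 0" by simp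
  have 1: "euler_mult (sum N UNIV - d) k (reflect N c) (\<chi> j. inverse (a $ j))"
    using Suc.prems euler_mult_mono[of d "Suc k" c a k] by (intro Suc.IH) auto
  have 2: "euler_mult (sum N UNIV - d) k (reflect N (\<lambda>\<alpha>. of_nat (\<alpha> j) * c \<alpha>)) (\<chi> j. inverse (a $ j))" for j
    using Suc.prems by (intro Suc.IH) auto
  have "euler_mult (sum N UNIV - d) k (\<lambda>\<beta>. of_nat (\<beta> j) * reflect N c \<beta>) (\<chi> j. inverse (a $ j))" for j
    unfolding reflect_euler by (intro euler_mult_add euler_mult_cmult 1 2)
  then show ?case using 0 by simp
qed simp

lemma reflect_coeff_sys:
  fixes a b :: "complex^'n::finite"
  assumes a: "\<And>j. a $ j \<noteq> 0" and b: "\<And>j. b $ j \<noteq> 0" and d: "d \<le> sum N UNIV"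
    and c: "c \<in> coeff_sys d N k a l b"
  shows "reflect N c \<in> coeff_sys (sum N UNIV - d) N k (\<chi> j. inverse (a $ j)) l (\<chi> j. inverse (b $ j))"
    and "reflect N (reflect N c) = c"
proof -
  have supp: "\<And>\<alpha>. c \<alpha> \<noteq> 0 \<Longrightarrow> \<forall>j. \<alpha> j \<le> N j" and deg: "\<And>\<alpha>. c \<alpha> \<noteq> 0 \<Longrightarrow> sum \<alpha> UNIV = d"
    using c by (auto simp: coeff_sys_def)
  have "sum \<beta> UNIV = sum N UNIV - d" if "\<forall>j. \<beta> j \<le> N j" "c (\<lambda>j. N j - \<beta> j) \<noteq> 0" for \<beta>
  proof -
    have "sum N UNIV - sum \<beta> UNIV = d"
      using deg[OF that(2)] that(1) by (simp add: sum_subtractf_nat)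
    moreover have "sum \<beta> UNIV \<le> sum N UNIV" using that(1) by (intro sum_mono) auto
    ultimately show ?thesis by simp
  qed
  then show "reflect N c \<in> coeff_sys (sum N UNIV - d) N k (\<chi> j. inverse (a $ j)) l (\<chi> j. inverse (b $ j))"
    using c euler_mult_reflect[OF a d supp] euler_mult_reflect[OF b d supp]
    by (auto simp: coeff_sys_def reflect_def split: if_splits)
  show "reflect N (reflect N c) = c"
  proof
    fix \<alpha> show "reflect N (reflect N c) \<alpha> = c \<alpha>"
      using supp[of \<alpha>] by (auto simp: reflect_def)
  qed
qed

lemma coeff_sys_reflect_dim:
  fixes a b :: "complex^'n::finite"
  assumes a: "\<And>j. a $ j \<noteq> 0" and b: "\<And>j. b $ j \<noteq> 0" and d: "d \<le> sum N UNIV"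
  shows "cfun_dim (coeff_sys (sum N UNIV - d) N k (\<chi> j. inverse (a $ j)) l (\<chi> j. inverse (b $ j))) =
    cfun_dim (coeff_sys d N k a l b)" (is "cfun_dim ?K' = cfun_dim ?K")
proof -
  have "reflect N ` ?K = ?K'"
  proof
    show "reflect N ` ?K \<subseteq> ?K'" using reflect_coeff_sys(1)[OF a b d] by blast
    show "?K' \<subseteq> reflect N ` ?K"
    proof
      fix c assume c: "c \<in> ?K'"
      have *: "(\<chi> j. inverse (a $ j)) $ i \<noteq> 0" "(\<chi> j. inverse (b $ j)) $ i \<noteq> 0" for i
        using a b by auto
      have "reflect N c \<in> ?K" using reflect_coeff_sys(1)[OF * _ c] d by (simp add: vec_eq_iff)
      moreover have "c = reflect N (reflect N c)" using reflect_coeff_sys(2)[OF * _ c] by simp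
      ultimately show "c \<in> reflect N ` ?K" by (metis image_eqI)
    qed
  qed
  moreover have "inj_on (reflect N) ?K"
    by (rule inj_on_inverseI[of _ "reflect N"]) (rule reflect_coeff_sys(2)[OF a b d])
  ultimately show ?thesis
    using cfun_dim_image_inj[OF clinear_reflect coeff_sys_subspace] by metis
qed

section \<open>Consequences of the Cremona transformation\<close>

abbreviation (input) sys_dim :: "(nat \<Rightarrow> complex^4) \<Rightarrow> nat \<Rightarrow> (nat \<Rightarrow> nat) \<Rightarrow> nat" where
  "sys_dim p d m \<equiv> cfun_dim (lin_sys p d m)"

lemma bij_transpose_1_6:
  assumes "i \<in> {1..6}" "j \<in> {1..6::nat}"
  shows "bij_betw (Transposition.transpose i j) {1..6} {1..6}"
  using assms inj_on_subset[OF bij_is_inj[OF bij_transpose]] by (auto simp: bij_betw_def transpose_image_eq)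

lemma mult_le_degree:
  assumes "linearly_general p" "0 < sys_dim p d m" "i \<in> {1..6}"
  shows "m i \<le> d"
proof -
  let ?\<pi> = "Transposition.transpose 1 i"
  have bij: "bij_betw ?\<pi> {1..6} {1..6}" using assms(3) by (intro bij_transpose_1_6) auto
  obtain q where q: "framed q" "linearly_general q" "\<And>d m. sys_dim q d m = sys_dim (p \<circ> ?\<pi>) d m"
    using linearly_general_frame[OF linearly_general_permute[OF assms(1) bij]] by metis
  have "0 < sys_dim q d (m \<circ> ?\<pi>)" using assms(2) unfolding q(3) lin_sys_permute[OF bij] .
  then have "(m \<circ> ?\<pi>) (frame_index 1) \<le> d"
    by (rule framed_mult_le_degree[OF q(1) framed_general_torus[OF q(1,2)]])
  then show ?thesis by simp
qed

lemma coeff_sys_cong: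
  assumes "\<And>\<alpha>. sum \<alpha> UNIV = d \<Longrightarrow> (\<forall>j. \<alpha> j \<le> N j) = (\<forall>j. \<alpha> j \<le> N' j)"
  shows "coeff_sys d N k a l b = coeff_sys d N' k a l b"
  unfolding coeff_sys_def using assms by (intro Collect_cong) blast

definition frame_with :: "complex^4 \<Rightarrow> complex^4 \<Rightarrow> nat \<Rightarrow> complex^4" where
  "frame_with a b k = (if k = 5 then a else if k = 6 then b else axis (inv frame_index k) 1)"

lemma frame_with [simp]: "framed (frame_with a b)" "frame_with a b 5 = a" "frame_with a b 6 = b"
  by (simp_all add: frame_with_def framed_def inv_f_f inj_def inj_frame_index)

text \<open>
  The reflection keeps the box sides \<open>d - m j\<close> and replaces the degree \<open>d\<close>
  by their sum minus \<open>d\<close>, which is \<open>3 d - S\<close>. The multiplicity belonging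
  to an unchanged side is then \<open>m j + 2 d - S\<close>. If this number is negative, the side
  exceeds the new degree and imposes nothing; truncated subtraction records exactly this.
\<close>

lemma cremona_invariance:
  assumes gp: "linearly_general p" and pos: "0 < sys_dim p d m"
  defines "S \<equiv> m 1 + m 2 + m 3 + m 4"
  shows "S \<le> 3 * d"
    and "\<exists>q. linearly_general q \<and> sys_dim q (3 * d - S) (\<lambda>i. if i \<le> 4 then m i + 2 * d - S else m i) = sys_dim p d m"
proof -
  obtain q where q: "framed q" "linearly_general q" and hq: "\<And>d m. sys_dim q d m = sys_dim p d m"
    using linearly_general_frame[OF gp] by metis
  note tq = framed_general_torus[OF q]
  define N where "N j = d - m (frame_index j)" for j
  have md: "\<forall>j. m (frame_index j) \<le> d" using framed_mult_le_degree[OF q(1) tq] pos hq by auto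
  then have md': "m 1 \<le> d" "m 2 \<le> d" "m 3 \<le> d" "m 4 \<le> d"
    using md by (simp_all add: forall_4)
  have sN: "sum N UNIV + S = 4 * d" using md' by (simp add: sum_4 N_def S_def)
  let ?K = "coeff_sys d N (m 5) (q 5) (m 6) (q 6)"
  have hK: "sys_dim p d m = cfun_dim ?K"
    using lin_sys_framed_dim[OF q(1) tq md] hq by (simp add: N_def[abs_def])
  then have "?K \<noteq> {\<lambda>x. 0}"
    using cfun_dim_eq_0_iff[OF fin_dim_coeff_sys coeff_sys_subspace] pos by (metis less_numeral_extra(3))
  then obtain c where c: "c \<in> ?K" "c \<noteq> (\<lambda>x. 0)"
    using cfun.subspace_0[OF coeff_sys_subspace] by (metis empty_iff subsetI subset_singletonD singletonI)
  then obtain \<alpha> where "c \<alpha> \<noteq> 0" by auto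
  then have "sum \<alpha> UNIV = d" "\<forall>j. \<alpha> j \<le> N j" using c by (auto simp: coeff_sys_def)
  then have dN: "d \<le> sum N UNIV" using sum_mono[of UNIV \<alpha> N] by auto
  then show S: "S \<le> 3 * d" using sN by linarith
  have d': "sum N UNIV - d = 3 * d - S" using sN by linarith
  let ?a = "\<chi> j. inverse (q 5 $ j)" and ?b = "\<chi> j. inverse (q 6 $ j)"
  let ?q = "frame_with ?a ?b" and ?m = "\<lambda>i. if i \<le> 4 then m i + 2 * d - S else m i"
  have ab: "\<And>j. q 5 $ j \<noteq> 0" "\<And>j. q 6 $ j \<noteq> 0" using tq by (auto simp: generic_torus_pair_def)
  have t: "generic_torus_pair ?a ?b"
    using tq by (auto simp: generic_torus_pair_def field_simps)
  have i4: "frame_index j \<le> 4" for j using exhaust_4[of j] by auto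
  have md2: "\<forall>j. ?m (frame_index j) \<le> 3 * d - S" using md S i4 by (auto simp: diff_le_mono)
  \<comment> \<open>The two boxes differ only in sides longer than the degree.\<close>
  have "coeff_sys (3 * d - S) (\<lambda>j. 3 * d - S - ?m (frame_index j)) (m 5) ?a (m 6) ?b =
      coeff_sys (3 * d - S) N (m 5) ?a (m 6) ?b"
  proof (rule coeff_sys_cong)
    fix \<alpha> :: "4 \<Rightarrow> nat" assume "sum \<alpha> UNIV = 3 * d - S"
    then have le: "\<alpha> j \<le> 3 * d - S" for j by (rule exponent_le_degree)
    have "\<alpha> j \<le> 3 * d - S - ?m (frame_index j) \<longleftrightarrow> \<alpha> j \<le> N j" for j
    proof -
      have "?m (frame_index j) = m (frame_index j) + 2 * d - S" using i4 by simp
      then show ?thesis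
        unfolding N_def using le[of j] md[rule_format, of j] S by linarith
    qed
    then show "(\<forall>j. \<alpha> j \<le> 3 * d - S - ?m (frame_index j)) = (\<forall>j. \<alpha> j \<le> N j)" by blast
  qed
  then have "sys_dim ?q (3 * d - S) ?m = cfun_dim (coeff_sys (3 * d - S) N (m 5) ?a (m 6) ?b)"
    using lin_sys_framed_dim[of ?q ?m, OF _ _ md2] t by simp
  also have "\<dots> = cfun_dim ?K"
    using coeff_sys_reflect_dim[OF ab dN] unfolding d' by blast
  finally have "sys_dim ?q (3 * d - S) ?m = sys_dim p d m" using hK by simp
  moreover have "linearly_general ?q" using t by (intro framed_torus_general) simp_all
  ultimately show "\<exists>q. linearly_general q \<and> sys_dim q (3 * d - S) ?m = sys_dim p d m" by blast
qed

text \<open>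
  After a Cremona transformation centred at four of the five points, the claim is that the
  multiplicity at the fifth point does not exceed the degree.
\<close>

lemma five_point_bound:
  assumes gp: "linearly_general p" and pos: "0 < sys_dim p d m" and j: "j \<in> {1..6}"
  shows "sum m ({1..6} - {j}) \<le> 3 * d"
proof -
  let ?\<pi> = "Transposition.transpose 6 j" and ?m = "m \<circ> Transposition.transpose 6 j"
  have bij: "bij_betw ?\<pi> {1..6} {1..6}" using j by (intro bij_transpose_1_6) auto
  have pos': "0 < sys_dim (p \<circ> ?\<pi>) d ?m" using pos unfolding lin_sys_permute[OF bij] .
  note c = cremona_invariance[OF linearly_general_permute[OF gp bij] pos']
  have "?m 5 \<le> 3 * d - (?m 1 + ?m 2 + ?m 3 + ?m 4)"
  proof -
    obtain q where q: "linearly_general q" and eq: "sys_dim q (3 * d - (?m 1 + ?m 2 + ?m 3 + ?m 4))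
        (\<lambda>i. if i \<le> 4 then ?m i + 2 * d - (?m 1 + ?m 2 + ?m 3 + ?m 4) else ?m i) = sys_dim (p \<circ> ?\<pi>) d ?m"
      using c(2) by blast
    from mult_le_degree[OF q pos'[folded eq], of 5] show ?thesis by simp
  qed
  then have "?m 1 + ?m 2 + ?m 3 + ?m 4 + ?m 5 \<le> 3 * d"
    using c(1) by linarith
  moreover have "sum m ({1..6} - {j}) = sum ?m {1..5}"
  proof -
    have "?\<pi> ` {1..5} = {1..6} - {j}"
    proof -
      have "{1..5} = {1..6} - {6::nat}" by auto
      then have "?\<pi> ` {1..5} = ?\<pi> ` {1..6} - {?\<pi> 6}"
        using image_set_diff[OF bij_is_inj[OF bij_transpose], of 6 j "{1..6}" "{6}"] by simp
      then show ?thesis using bij by (simp add: bij_betw_def)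
    qed
    then have "bij_betw ?\<pi> {1..5} ({1..6} - {j})"
      using inj_on_subset[OF bij_is_inj[OF bij_transpose]] by (auto simp: bij_betw_def)
    from sum.reindex_bij_betw[OF this, of m] show ?thesis by simp
  qed
  moreover have "{1..5} = {1, 2, 3, 4, 5::nat}" by auto
  ultimately show ?thesis by (simp add: add.assoc)
qed

lemma coord_times_hom_form:
  "x $ j * hom_form e c x = hom_form (Suc e) (\<lambda>\<alpha>. if \<alpha> j = 0 then 0 else c (\<alpha>(j := \<alpha> j - 1))) x"
proof -
  have "hom_form (Suc e) (\<lambda>\<alpha>. if \<alpha> j = 0 then 0 else c (\<alpha>(j := \<alpha> j - 1))) x =
      (\<Sum>\<alpha>\<in>{\<alpha> \<in> exponents (Suc e). 0 < \<alpha> j}. c (\<alpha>(j := \<alpha> j - 1)) * monom_fun \<alpha> x)"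
    unfolding hom_form_def by (rule sum.mono_neutral_cong_right) auto
  also have "\<dots> = (\<Sum>\<beta>\<in>exponents e. c \<beta> * monom_fun (\<beta>(j := Suc (\<beta> j))) x)"
    by (rule sum.reindex_bij_witness[of _ "\<lambda>\<beta>. \<beta>(j := Suc (\<beta> j))" "\<lambda>\<alpha>. \<alpha>(j := \<alpha> j - 1)"])
       (auto simp: sum_upd_Suc[unfolded fun_upd_def] sum_upd_pred[unfolded fun_upd_def One_nat_def])
  also have "\<dots> = x $ j * hom_form e c x"
    unfolding hom_form_def sum_distrib_left monom_fun_upd
    by (intro sum.cong refl) (simp add: monom_fun_split[of _ x j] mult_ac)
  finally show ?thesis by simp
qed

lemma sort_six:
  fixes m :: "nat \<Rightarrow> nat"
  obtains \<pi> :: "nat \<Rightarrow> nat" where "bij_betw \<pi> {1..6} {1..6}" "m (\<pi> 1) \<ge> m (\<pi> 2)" "m (\<pi> 2) \<ge> m (\<pi> 3)"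
    "m (\<pi> 3) \<ge> m (\<pi> 4)" "m (\<pi> 4) \<ge> m (\<pi> 5)" "m (\<pi> 5) \<ge> m (\<pi> 6)"
proof -
  define xs where "xs = rev (sort_key m [1..<7])"
  have len: "length xs = 6" and set: "set xs = {1..6}" and dist: "distinct xs"
    by (auto simp: xs_def)
  have "bij_betw (\<lambda>i. xs ! i) {..<6} {1..6}"
    using bij_betw_nth[OF dist] len set by auto
  moreover have "bij_betw (\<lambda>i. i - 1) {1..6::nat} {..<6}"
    by (rule bij_betw_byWitness[of _ Suc]) auto
  ultimately have "bij_betw (\<lambda>i. xs ! (i - 1)) {1..6} {1..6}"
    using bij_betw_trans[of "\<lambda>i. i - 1"] unfolding comp_def by blast
  moreover have "sorted (map m (rev xs))" by (simp add: xs_def)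
  then have "sorted_wrt (\<ge>) (map m xs)"
    by (simp add: rev_map[symmetric] sorted_wrt_rev)
  then have "m (xs ! i) \<ge> m (xs ! Suc i)" if "Suc i < 6" for i
    using that len sorted_wrt_nth_less[of "(\<ge>)" "map m xs" i "Suc i"] by simp
  from this[of 0] this[of 1] this[of 2] this[of 3] this[of 4]
  have "m (xs ! 0) \<ge> m (xs ! 1)" "m (xs ! 1) \<ge> m (xs ! 2)" "m (xs ! 2) \<ge> m (xs ! 3)"
    "m (xs ! 3) \<ge> m (xs ! 4)" "m (xs ! 4) \<ge> m (xs ! 5)" by (simp_all add: eval_nat_numeral)
  ultimately show ?thesis using that[of "\<lambda>i. xs ! (i - 1)"] by simp
qed

text \<open>
  A member can be chosen as a product of \<open>d\<close> planes, each through three of the points: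
  spend a plane on the three points of largest multiplicity. The two inequalities are preserved,
  because more than three multiplicities equal to the degree would violate the bound on the sum.
\<close>

lemma lin_sys_nonempty_planes:
  assumes "linearly_general p" "\<forall>i\<in>{1..6}. m i \<le> d" "sum m {1..6} \<le> 3 * d"
  shows "0 < sys_dim p d m"
  using assms
proof (induction d arbitrary: p m)
  case 0
  then have "(\<lambda>x. 1) \<in> lin_sys p 0 m"
    by (auto simp: lin_sys_def forms_const)
  then show ?case unfolding lin_sys_nonempty_iff[symmetric]
    by (intro bexI[of _ "\<lambda>x. 1"]) (auto simp: fun_eq_iff)
next
  case (Suc d)
  obtain \<pi> :: "nat \<Rightarrow> nat" where bij: "bij_betw \<pi> {1..6} {1..6}" and s: "m (\<pi> 1) \<ge> m (\<pi> 2)" "m (\<pi> 2) \<ge> m (\<pi> 3)"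
    "m (\<pi> 3) \<ge> m (\<pi> 4)" "m (\<pi> 4) \<ge> m (\<pi> 5)" "m (\<pi> 5) \<ge> m (\<pi> 6)" by (rule sort_six)
  obtain q where q: "framed q" "linearly_general q" and hq: "\<And>d m. sys_dim q d m = sys_dim (p \<circ> \<pi>) d m"
    using linearly_general_frame[OF linearly_general_permute[OF Suc.prems(1) bij]] by metis
  let ?m = "m \<circ> \<pi>"
  let ?m' = "\<lambda>i. if i \<le> 3 then ?m i - 1 else ?m i"
  have sum: "?m 1 + ?m 2 + ?m 3 + ?m 4 + ?m 5 + ?m 6 \<le> 3 * Suc d"
    using Suc.prems(3) sum.reindex_bij_betw[OF bij, of m] by (simp add: eval_nat_numeral add_ac)
  have le: "?m i \<le> Suc d" if "i \<in> {1..6}" for i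
    using Suc.prems(2) bij_betw_apply[OF bij that] by simp
  have "0 < sys_dim q d ?m'"
  proof (rule Suc.IH[OF q(2)])
    show "\<forall>i\<in>{1..6}. ?m' i \<le> d"
      unfolding set_1_6 using s sum le[of 1] le[of 2] le[of 3] by auto
    show "sum ?m' {1..6} \<le> 3 * d"
      unfolding set_1_6 using s sum le[of 1] le[of 2] le[of 3] by auto
  qed
  then obtain G where G: "G \<in> lin_sys q d ?m'" "G \<noteq> (\<lambda>x. 0)"
    unfolding lin_sys_nonempty_iff[symmetric] by blast
  let ?F = "\<lambda>x. x $ 4 * G x"
  have pG: "polyfun G" using G(1) by (auto simp: lin_sys_def polyfun_forms)
  have "?F \<in> lin_sys q (Suc d) ?m"
  proof -
    have "?F \<in> forms (Suc d)" using forms_mult[OF forms_coord, of G d 4] G(1) by (simp add: lin_sys_def)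
    moreover have "mult_at_least ?F (q i) (?m i)" if i: "i \<in> {1..6}" for i
    proof -
      have Gi: "mult_at_least G (q i) (?m' i)" using G(1) i by (simp add: lin_sys_def)
      show ?thesis
      proof (cases "i \<le> 3")
        case True
        then have "i = frame_index 1 \<or> i = frame_index 2 \<or> i = frame_index 3" using i by auto
        then have "q i $ 4 = 0" using q(1) distinct_4 by (auto simp: framed_def axis_def simp del: frame_index_simps)
        then have "mult_at_least ?F (q i) (Suc (?m' i))"
          by (rule mult_at_least_mult_vanishing[OF polyfun_coord pG _ Gi])
        then show ?thesis using True by (auto intro: mult_at_least_mono)
      next
        case False
        then show ?thesis using mult_at_least_mult[OF polyfun_coord pG Gi] by simp
      qed
    qed
    ultimately show ?thesis by (simp add: lin_sys_def)
  qed
  moreover have "?F \<noteq> (\<lambda>x. 0)"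
  proof
    assume F: "?F = (\<lambda>x. 0)"
    obtain c where c: "G = hom_form d c" using G(1) by (auto simp: lin_sys_def forms_eq_hom_form)
    have "c \<beta> = 0" if "sum \<beta> UNIV = d" for \<beta>
      using hom_form_eq_0_imp[OF F[unfolded c coord_times_hom_form], of "\<beta>(4 := Suc (\<beta> 4))"] that
        sum_upd_Suc[of \<beta> 4] by simp
    then have "G = hom_form d (\<lambda>_. 0)" unfolding c by (rule hom_form_cong)
    then show False using G(2) by (simp add: hom_form_def fun_eq_iff)
  qed
  ultimately have "0 < sys_dim q (Suc d) ?m" unfolding lin_sys_nonempty_iff[symmetric] by blast
  then show ?case using hq lin_sys_permute[OF bij] by simp
qed

section \<open>Upper and lower bounds by monomial counts\<close>

text \<open>
  The monomials of degree \<open>d\<close> in four variables with multiplicities \<open>x\<close>,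
  \<open>y\<close>, \<open>z\<close> at three coordinate points.
\<close>

definition toric_exponents :: "nat \<Rightarrow> nat \<Rightarrow> nat \<Rightarrow> nat \<Rightarrow> (4 \<Rightarrow> nat) set" where
  "toric_exponents d x y z = {\<alpha>. sum \<alpha> UNIV = d \<and> \<alpha> 1 + x \<le> d \<and> \<alpha> 2 + y \<le> d \<and> \<alpha> 3 + z \<le> d}"

abbreviation toric_count :: "nat \<Rightarrow> nat \<Rightarrow> nat \<Rightarrow> nat \<Rightarrow> nat" where
  "toric_count d x y z \<equiv> card (toric_exponents d x y z)"

lemma finite_toric_exponents [simp]: "finite (toric_exponents d x y z)"
  by (rule finite_subset[OF _ finite_exponents[of d]]) (auto simp: toric_exponents_def)

lemma toric_dim:
  assumes gp: "linearly_general p" and m: "m 4 = 0" "m 5 = 0" "m 6 = 0" "m 1 \<le> d" "m 2 \<le> d" "m 3 \<le> d"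
  shows "sys_dim p d m = toric_count d (m 1) (m 2) (m 3)"
proof -
  obtain q where q: "framed q" "linearly_general q" and hq: "\<And>d m. sys_dim q d m = sys_dim p d m"
    using linearly_general_frame[OF gp] by metis
  have md: "\<forall>j. m (frame_index j) \<le> d" using m by (simp add: forall_4)
  have "sys_dim p d m = cfun_dim (coeff_sys d (\<lambda>j. d - m (frame_index j)) 0 (q 5) 0 (q 6))"
    using lin_sys_framed_dim[OF q(1) framed_general_torus[OF q] md] by (simp add: hq m)
  also have "coeff_sys d (\<lambda>j. d - m (frame_index j)) 0 (q 5) 0 (q 6) =
      {c. \<forall>\<alpha>. \<alpha> \<notin> toric_exponents d (m 1) (m 2) (m 3) \<longrightarrow> c \<alpha> = 0}"
  proof -
    have "\<alpha> \<in> toric_exponents d (m 1) (m 2) (m 3) \<longleftrightarrow> sum \<alpha> UNIV = d \<and> (\<forall>j. \<alpha> j \<le> d - m (frame_index j))" for \<alpha>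
      using m exponent_le_degree[of \<alpha> d 4] by (auto simp: toric_exponents_def forall_4)
    then show ?thesis unfolding coeff_sys_def by auto
  qed
  also have "cfun_dim \<dots> = toric_count d (m 1) (m 2) (m 3)"
    by (rule coordinate_subspace(3)) simp
  finally show ?thesis .
qed

abbreviation supported_on :: "nat set \<Rightarrow> (nat \<Rightarrow> nat) \<Rightarrow> nat \<Rightarrow> nat" where
  "supported_on X m \<equiv> (\<lambda>i. if i \<in> X then m i else 0)"

lemma sys_dim_submodular:
  fixes p :: "nat \<Rightarrow> complex^4"
  assumes "Z \<subseteq> X \<inter> Y"
  shows "sys_dim p d (supported_on X m) + sys_dim p d (supported_on Y m) \<le>
    sys_dim p d (supported_on Z m) + sys_dim p d (supported_on (X \<union> Y) m)"
proof -
  let ?L = "\<lambda>X. lin_sys p d (supported_on X m)"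
  have int: "?L X \<inter> ?L Y = ?L (X \<union> Y)" by (auto simp: lin_sys_def)
  have sub: "?L X \<subseteq> ?L Z" "?L Y \<subseteq> ?L Z" using assms by (auto simp: lin_sys_def)
  show ?thesis
    using cfun_dim_Int_ge[OF fin_dim_lin_sys lin_sys_subspace lin_sys_subspace sub(1) lin_sys_subspace sub(2)]
    unfolding int .
qed

lemma lin_sys_cong:
  fixes p :: "nat \<Rightarrow> complex^4"
  shows "(\<And>i. i \<in> {1..6} \<Longrightarrow> m i = m' i) \<Longrightarrow> lin_sys p d m = lin_sys p d m'"
  by (auto simp: lin_sys_def)

lemma two_point_dim:
  assumes gp: "linearly_general p" and j: "j \<in> {2..6}" and m: "m 1 \<le> d" "m j \<le> d"
  shows "sys_dim p d (supported_on {1, j} m) = toric_count d (m 1) (m j) 0"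
proof -
  let ?\<pi> = "Transposition.transpose 2 j"
  have bij: "bij_betw ?\<pi> {1..6} {1..6}" using j by (intro bij_transpose_1_6) auto
  let ?m = "\<lambda>i. if i = 1 then m 1 else if i = 2 then m j else 0"
  have "supported_on {1, j} m \<circ> ?\<pi> = ?m"
    using j by (auto simp: fun_eq_iff Transposition.transpose_def)
  then have "lin_sys p d (supported_on {1, j} m) = lin_sys (p \<circ> ?\<pi>) d ?m"
    using lin_sys_permute[OF bij, of p d "supported_on {1, j} m"] by simp
  moreover have "sys_dim (p \<circ> ?\<pi>) d ?m = toric_count d (m 1) (m j) 0"
    using toric_dim[OF linearly_general_permute[OF gp bij], of ?m d] m by simp
  ultimately show ?thesis by simp
qed

text \<open>
  Intersect, inside the forms with multiplicity \<open>m 1\<close> at the first point, the system of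
  the first three points with the three two-point systems of the first and the \<open>j\<close>-th
  point, for \<open>j = 4, 5, 6\<close>. Conditions that are dependent because of a multiple line
  through the first point, or through the second and third, are thus not counted twice.
\<close>

lemma sys_dim_lower_bound:
  assumes gp: "linearly_general p" and m: "\<forall>i\<in>{1..6}. m i \<le> d"
  shows "toric_count d (m 1) (m 2) (m 3) + toric_count d (m 1) (m 4) 0 + toric_count d (m 1) (m 5) 0
      + toric_count d (m 1) (m 6) 0 \<le> sys_dim p d m + 3 * toric_count d (m 1) 0 0"
proof -
  let ?D = "\<lambda>X. sys_dim p d (supported_on X m)"
  have m': "m 1 \<le> d" "m 2 \<le> d" "m 3 \<le> d" "m 4 \<le> d" "m 5 \<le> d" "m 6 \<le> d"
    using m unfolding set_1_6 by blast+
  have A: "?D {1,2,3} = toric_count d (m 1) (m 2) (m 3)"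
    using toric_dim[OF gp, of "supported_on {1,2,3} m" d] m' by simp
  have V: "?D {1} = toric_count d (m 1) 0 0"
    using toric_dim[OF gp, of "supported_on {1} m" d] m' by simp
  note B = two_point_dim[OF gp, of 4 m d, OF _ m'(1,4)] two_point_dim[OF gp, of 5 m d, OF _ m'(1,5)]
    two_point_dim[OF gp, of 6 m d, OF _ m'(1,6)]
  have U: "{1,2,3} \<union> {1,4} = {1,2,3,4::nat}" "{1,2,3,4} \<union> {1,5} = {1,2,3,4,5::nat}"
    "{1,2,3,4,5} \<union> {1,6} = {1,2,3,4,5,6::nat}" by auto
  have "?D {1,2,3} + ?D {1,4} \<le> ?D {1} + ?D {1,2,3,4}"
    using sys_dim_submodular[of "{1}" "{1,2,3}" "{1,4}" p d m] unfolding U by blast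
  moreover have "?D {1,2,3,4} + ?D {1,5} \<le> ?D {1} + ?D {1,2,3,4,5}"
    using sys_dim_submodular[of "{1}" "{1,2,3,4}" "{1,5}" p d m] unfolding U by blast
  moreover have "?D {1,2,3,4,5} + ?D {1,6} \<le> ?D {1} + ?D {1,2,3,4,5,6}"
    using sys_dim_submodular[of "{1}" "{1,2,3,4,5}" "{1,6}" p d m] unfolding U by blast
  moreover have "?D {1,2,3,4,5,6} = sys_dim p d m"
    by (rule arg_cong[OF lin_sys_cong]) (simp only: set_1_6 if_True)
  moreover have "?D {1,4} = toric_count d (m 1) (m 4) 0" "?D {1,5} = toric_count d (m 1) (m 5) 0"
    "?D {1,6} = toric_count d (m 1) (m 6) 0" using B by simp_all
  ultimately show ?thesis using A V by linarith
qed

lemma toric_count_boundary: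
  assumes "1 \<le> x" "1 \<le> y" "1 \<le> z" "x \<le> Suc d" "y \<le> Suc d" "z \<le> Suc d"
  shows "card {\<alpha> \<in> toric_exponents (Suc d) x y z. \<alpha> 4 = 0} + toric_count d (x - 1) (y - 1) (z - 1) =
    toric_count (Suc d) x y z"
proof -
  let ?T = "toric_exponents (Suc d) x y z"
  have "bij_betw (\<lambda>\<alpha>. \<alpha>(4 := Suc (\<alpha> 4))) (toric_exponents d (x - 1) (y - 1) (z - 1)) {\<alpha> \<in> ?T. \<alpha> 4 \<noteq> 0}"
    using distinct_4 assms
    by (intro bij_betw_byWitness[where f' = "\<lambda>\<alpha>. \<alpha>(4 := \<alpha> 4 - 1)"])
       (auto simp: toric_exponents_def sum_upd_Suc[unfolded fun_upd_def] sum_upd_pred[unfolded fun_upd_def One_nat_def])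
  then have "toric_count d (x - 1) (y - 1) (z - 1) = card {\<alpha> \<in> ?T. \<alpha> 4 \<noteq> 0}"
    by (rule bij_betw_same_card)
  moreover have "card ?T = card ({\<alpha> \<in> ?T. \<alpha> 4 = 0} \<union> {\<alpha> \<in> ?T. \<alpha> 4 \<noteq> 0})"
    by (rule arg_cong[where f = card]) auto
  moreover have "\<dots> = card {\<alpha> \<in> ?T. \<alpha> 4 = 0} + card {\<alpha> \<in> ?T. \<alpha> 4 \<noteq> 0}"
    by (rule card_Un_disjoint) auto
  ultimately show ?thesis by simp
qed

text \<open>
  Restriction to the plane through the first three points. The kernel consists of the multiples of
  the plane's equation \<open>x\<^sub>4\<close>, and dividing by it lowers the degree and the first
  three multiplicities by one. The image consists of plane forms, whose monomials are those with
  \<open>\<alpha> 4 = 0\<close>; their number is a difference of two counts in four variables.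
\<close>

lemma sys_dim_upper_bound:
  assumes gp: "linearly_general p" and m: "1 \<le> m 1" "1 \<le> m 2" "1 \<le> m 3" "\<forall>i\<in>{1..6}. m i \<le> Suc d"
  defines "m' \<equiv> \<lambda>i. if i \<le> 3 then m i - 1 else m i"
  shows "sys_dim p (Suc d) m + toric_count d (m 1 - 1) (m 2 - 1) (m 3 - 1) \<le>
    sys_dim p d m' + toric_count (Suc d) (m 1) (m 2) (m 3)"
proof -
  obtain q where q: "framed q" "linearly_general q" and hq: "\<And>d m. sys_dim q d m = sys_dim p d m"
    using linearly_general_frame[OF gp] by metis
  note tq = framed_general_torus[OF q]
  have m6: "m 1 \<le> Suc d" "m 2 \<le> Suc d" "m 3 \<le> Suc d" "m 4 \<le> Suc d" using m(4) by auto
  then have md: "\<forall>j. m (frame_index j) \<le> Suc d" by (simp add: forall_4)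
  define N where "N j = Suc d - m (frame_index j)" for j
  let ?K = "coeff_sys (Suc d) N (m 5) (q 5) (m 6) (q 6)"
  have hK: "sys_dim p (Suc d) m = cfun_dim ?K"
    using lin_sys_framed_dim[OF q(1) tq md] hq by (simp add: N_def[abs_def])
  let ?\<phi> = "\<lambda>(c :: (4 \<Rightarrow> nat) \<Rightarrow> complex) \<alpha>. if \<alpha> 4 = 0 then c \<alpha> else 0"
  let ?\<psi> = "\<lambda>(c :: (4 \<Rightarrow> nat) \<Rightarrow> complex) \<beta>. c (\<beta>(4 := Suc (\<beta> 4)))"
  let ?ker = "{c \<in> ?K. ?\<phi> c = (\<lambda>x. 0)}"
  let ?S = "{\<alpha> \<in> toric_exponents (Suc d) (m 1) (m 2) (m 3). \<alpha> 4 = 0}"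
  have lin: "clinear ?\<phi>" by (rule clinearI) (auto simp: fun_eq_iff)
  have "cfun_dim ?K \<le> cfun_dim ?ker + cfun_dim (?\<phi> ` ?K)"
    by (rule cfun_dim_le_kernel_image[OF lin coeff_sys_subspace fin_dim_coeff_sys])
  moreover have "cfun_dim (?\<phi> ` ?K) \<le> card ?S"
  proof -
    note cs = coordinate_subspace[of ?S]
    have "?\<phi> ` ?K \<subseteq> {c. \<forall>\<alpha>. \<alpha> \<notin> ?S \<longrightarrow> c \<alpha> = 0}"
    proof (intro image_subsetI CollectI allI impI)
      fix c \<alpha> assume c: "c \<in> ?K" and \<alpha>: "\<alpha> \<notin> ?S"
      show "?\<phi> c \<alpha> = 0"
      proof (rule ccontr)
        assume n: "?\<phi> c \<alpha> \<noteq> 0"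
        then have "sum \<alpha> UNIV = Suc d" "\<forall>j. \<alpha> j \<le> N j" "\<alpha> 4 = 0"
          using c by (auto simp: coeff_sys_def split: if_splits)
        then show False using \<alpha> m6 by (auto simp: toric_exponents_def N_def forall_4)
      qed
    qed
    then have "cfun_dim (?\<phi> ` ?K) \<le> cfun_dim {c :: (4 \<Rightarrow> nat) \<Rightarrow> complex. \<forall>\<alpha>. \<alpha> \<notin> ?S \<longrightarrow> c \<alpha> = 0}"
      by (intro cfun_dim_mono cs subspace_image[OF lin] coeff_sys_subspace) auto
    then show ?thesis using cs(3) by simp
  qed
  moreover have "cfun_dim ?ker \<le> sys_dim p d m'"
  proof -
    let ?\<chi> = "\<lambda>c. hom_form d (?\<psi> c)"
    have lin': "clinear ?\<chi>"
      by (rule clinearI) (simp_all add: hom_form_add hom_form_cmult)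
    have factor: "hom_form (Suc d) c = (\<lambda>x. x $ 4 * ?\<chi> c x)" if "c \<in> ?ker" for c
    proof -
      have "?\<phi> c = (\<lambda>x. 0)" using that by simp
      then have "c \<alpha> = 0" if "\<alpha> 4 = 0" for \<alpha> using that by (auto dest: fun_cong[of _ _ \<alpha>])
      then show ?thesis unfolding coord_times_hom_form by (intro hom_form_cong ext) auto
    qed
    have into: "?\<chi> ` ?ker \<subseteq> lin_sys q d m'"
    proof (rule image_subsetI)
      fix c assume cker: "c \<in> ?ker"
      then have c: "c \<in> ?K" and ker: "?\<phi> c = (\<lambda>x. 0)" by blast+
      have F: "hom_form (Suc d) c \<in> lin_sys q (Suc d) m"
        using c lin_sys_framed[OF q(1) tq md] by (auto simp: N_def[abs_def])
      have cancel: "mult_at_least (?\<chi> c) (q i) (m i)" if "i = 5 \<or> i = 6" for i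
      proof (rule mult_at_least_cancel[OF polyfun_coord polyfun_hom_form])
        show "q i $ 4 \<noteq> 0" using that tq by (auto simp: generic_torus_pair_def)
        have "hom_form (Suc d) c = (\<lambda>x. x $ 4 * ?\<chi> c x)" by (rule factor[OF cker])
        then show "mult_at_least (\<lambda>x. x $ 4 * ?\<chi> c x) (q i) (m i)"
          using F that by (auto simp: lin_sys_def)
      qed
      have coord: "mult_at_least (?\<chi> c) (axis j 1) (m' (frame_index j))" for j
        unfolding mult_at_least_axis_iff
      proof (intro allI impI, rule ccontr)
        fix \<beta> :: "4 \<Rightarrow> nat" assume \<beta>: "sum \<beta> UNIV = d" "d < \<beta> j + m' (frame_index j)" "c (\<beta>(4 := Suc (\<beta> 4))) \<noteq> 0"
        have "\<forall>j. \<alpha> j \<le> N j" if "c \<alpha> \<noteq> 0" for \<alpha> using c that by (simp add: coeff_sys_def)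
        from this[OF \<beta>(3)] have *: "\<forall>j. (\<beta>(4 := Suc (\<beta> 4))) j \<le> N j" .
        have box: "\<beta> 1 \<le> Suc d - m 1" "\<beta> 2 \<le> Suc d - m 2" "\<beta> 3 \<le> Suc d - m 3" "Suc (\<beta> 4) \<le> Suc d - m 4"
          using *[rule_format, of 1] *[rule_format, of 2] *[rule_format, of 3] *[rule_format, of 4] distinct_4
          by (simp_all add: N_def)
        have m'_eq: "m' 1 = m 1 - 1" "m' 2 = m 2 - 1" "m' 3 = m 3 - 1" "m' 4 = m 4" by (simp_all add: m'_def)
        consider "j = 1" | "j = 2" | "j = 3" | "j = 4" using exhaust_4[of j] by blast
        then show False
        proof cases
          case 1 then show ?thesis using box(1) m'_eq(1) \<beta>(2) m(1-3) m6(1) by simp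
        next
          case 2 then show ?thesis using box(2) m'_eq(2) \<beta>(2) m(1-3) m6(2) by simp
        next
          case 3 then show ?thesis using box(3) m'_eq(3) \<beta>(2) m(1-3) m6(3) by simp
        next
          case 4 then show ?thesis using box(4) m'_eq(4) \<beta>(2) m(1-3) m6(4) by simp
        qed
      qed
      have "mult_at_least (?\<chi> c) (q i) (m' i)" if i: "i \<in> {1..6}" for i
      proof -
        consider j where "i = frame_index j" | "i = 5 \<or> i = 6" using i unfolding in_1_6 by blast
        then show ?thesis
        proof cases
          case 1
          moreover have "q (frame_index j) = axis j 1" using q(1) by (simp add: framed_def)
          ultimately show ?thesis using coord[of j] by simp
        next
          case 2
          then have "m' i = m i" by (auto simp: m'_def)
          then show ?thesis using cancel[OF 2] by simp
        qed
      qed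
      then show "?\<chi> c \<in> lin_sys q d m'" by (simp add: lin_sys_def forms_eq_hom_form)
    qed
    have "inj_on ?\<chi> ?ker"
    proof (rule inj_onI)
      fix c c' assume cc: "c \<in> ?ker" "c' \<in> ?ker" "?\<chi> c = ?\<chi> c'"
      then have eq: "hom_form (Suc d) c = hom_form (Suc d) c'" by (simp only: factor)
      have "inj_on (hom_form (Suc d)) ?K" by (rule inj_on_hom_form) (simp add: coeff_sys_def)
      then show "c = c'" using cc(1,2) eq unfolding inj_on_def by blast
    qed
    note inj = this
    note ker_sub = kernel_subspace[OF lin coeff_sys_subspace, of "Suc d" N "m 5" "q 5" "m 6" "q 6"]
    have "cfun_dim ?ker = cfun_dim (?\<chi> ` ?ker)"
      by (rule cfun_dim_image_inj[OF lin' ker_sub inj, symmetric])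
    also have "\<dots> \<le> sys_dim q d m'"
      by (rule cfun_dim_mono[OF fin_dim_lin_sys lin_sys_subspace subspace_image[OF lin' ker_sub] into])
    finally have "cfun_dim ?ker \<le> sys_dim q d m'" .
    then show ?thesis by (simp add: hq)
  qed
  ultimately show ?thesis
    using toric_count_boundary[OF m(1-3) m6(1-3)] hK by linarith
qed

section \<open>Lattice points and the secant linear virtual dimension\<close>

lemma six_times_choose_3: "6 * int (n choose 3) = int n * (int n - 1) * (int n - 2)"
proof (induction n)
  case (Suc n)
  have 2: "2 * int (n choose 2) = int n * (int n - 1)"
    by (induction n) (simp_all add: numeral_2_eq_2 algebra_simps)
  have "Suc n choose 3 = (n choose 2) + (n choose 3)"
    by (simp add: numeral_3_eq_3 numeral_2_eq_2)
  then have "6 * int (Suc n choose 3) = 3 * (2 * int (n choose 2)) + 6 * int (n choose 3)" by simp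
  then show ?case unfolding 2 Suc.IH by (simp add: algebra_simps)
qed simp

lemma six_times_binom:
  "6 * binom x 3 = (if x < 3 then 0 else x * (x - 1) * (x - 2))"
  using six_times_choose_3[of "nat x"] by (simp add: binom_def)

lemma binom_eq_0: "x < 3 \<Longrightarrow> binom x 3 = 0"
  by (simp add: binom_def)

text \<open>
  The truncated binomial coefficient differs from the polynomial
  \<open>x (x - 1) (x - 2) / 6\<close> by its own mirror image, since the polynomial is odd about 1.
  This is how a correction term of one system becomes a correction term of its Cremona transform.
\<close>

lemma binom_antisym: "6 * (binom x 3 - binom (2 - x) 3) = x * (x - 1) * (x - 2)"
proof -
  consider "x < 0" | "x = 0" | "x = 1" | "x = 2" | "x > 2" by linarith
  then show ?thesis
    by cases (auto simp: right_diff_distrib six_times_binom algebra_simps)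
qed

lemma card_exponents_4: "card (exponents d :: (4 \<Rightarrow> nat) set) = (d + 3) choose 3"
proof -
  let ?L = "{l :: nat list. length l = 4 \<and> sum_list l = d}"
  let ?f = "\<lambda>\<alpha> :: 4 \<Rightarrow> nat. [\<alpha> 1, \<alpha> 2, \<alpha> 3, \<alpha> 4]"
  have "bij_betw ?f (exponents d) ?L"
    unfolding bij_betw_def
  proof
    show "inj_on ?f (exponents d)"
      by (rule inj_onI) (simp add: fun_eq_iff forall_4)
    show "?f ` exponents d = ?L"
    proof safe
      fix l :: "nat list" assume l: "length l = 4" "d = sum_list l"
      then obtain a b c e where abce: "l = [a, b, c, e]"
        by (auto simp: eval_nat_numeral length_Suc_conv)
      let ?\<alpha> = "\<lambda>j :: 4. if j = 1 then a else if j = 2 then b else if j = 3 then c else e"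
      have "l = ?f ?\<alpha>" "sum ?\<alpha> UNIV = sum_list l" using abce distinct_4 by (simp_all add: sum_4)
      then show "l \<in> ?f ` exponents (sum_list l)" by (intro image_eqI[of _ _ ?\<alpha>]) auto
    qed (simp_all add: sum_4)
  qed
  then have "card (exponents d :: (4 \<Rightarrow> nat) set) = card ?L" by (rule bij_betw_same_card)
  also have "\<dots> = (d + 3) choose d" using card_length_sum_list[of 4 d] by (simp add: add.commute)
  also have "\<dots> = (d + 3) choose 3" using binomial_symmetric[of d "d + 3"] by simp
  finally show ?thesis .
qed

lemma card_exponents_above:
  fixes s :: "4 \<Rightarrow> nat"
  shows "int (card {\<alpha> \<in> exponents d. \<forall>j. s j \<le> \<alpha> j}) = binom (int d - int (sum s UNIV) + 3) 3"
proof (cases "sum s UNIV \<le> d")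
  case True
  have "bij_betw (\<lambda>\<beta> j. \<beta> j + s j) (exponents (d - sum s UNIV)) {\<alpha> \<in> exponents d. \<forall>j. s j \<le> \<alpha> j}"
    using True by (intro bij_betw_byWitness[where f' = "\<lambda>\<alpha> j. \<alpha> j - s j"])
      (auto simp: sum.distrib sum_subtractf_nat)
  from bij_betw_same_card[OF this]
  have "card {\<alpha> \<in> exponents d. \<forall>j. s j \<le> \<alpha> j} = (d - sum s UNIV + 3) choose 3"
    unfolding card_exponents_4 by (rule sym)
  moreover have "nat (int d - int (sum s UNIV) + 3) = d - sum s UNIV + 3" using True by linarith
  ultimately show ?thesis using True unfolding binom_def by simp
next
  case False
  then have "{\<alpha> \<in> exponents d. \<forall>j. s j \<le> \<alpha> j} = {}"
    using sum_mono[of UNIV s] by fastforce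
  then have "card {\<alpha> \<in> exponents d. \<forall>j. s j \<le> \<alpha> j} = 0" by (simp only: card.empty)
  moreover have "binom (int d - int (sum s UNIV) + 3) 3 = 0"
    using False by (intro binom_eq_0) linarith
  ultimately show ?thesis by simp
qed

text \<open>
  Inclusion and exclusion over the three violated bounds. No exponent violates all three of them, by
  the bound on \<open>x + y + z\<close>.
\<close>

lemma toric_count_eq:
  assumes "x \<le> d" "y \<le> d" "z \<le> d" "x + y + z \<le> 2 * d + 2"
  shows "int (toric_count d x y z) = binom (int d + 3) 3
    - (binom (int x + 2) 3 + binom (int y + 2) 3 + binom (int z + 2) 3)
    + (binom (int x + int y - int d + 1) 3 + binom (int x + int z - int d + 1) 3
      + binom (int y + int z - int d + 1) 3)"
proof -
  let ?E = "exponents d :: (4 \<Rightarrow> nat) set"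
  let ?s = "\<lambda>u v w j :: 4. if j = 1 then u else if j = 2 then v else if j = 3 then w else (0 :: nat)"
  let ?A = "\<lambda>s. {\<alpha> \<in> ?E. \<forall>j. s j \<le> \<alpha> j}"
  define X Y Z where "X = {\<alpha> \<in> ?E. d < \<alpha> 1 + x}" and "Y = {\<alpha> \<in> ?E. d < \<alpha> 2 + y}"
    and "Z = {\<alpha> \<in> ?E. d < \<alpha> 3 + z}"
  note XYZ = X_def Y_def Z_def
  have s: "sum (?s u v w) UNIV = u + v + w" for u v w using distinct_4 by (simp add: sum_4)
  have fin: "finite X" "finite Y" "finite Z" by (simp_all add: XYZ)
  have eqs: "X = ?A (?s (Suc d - x) 0 0)" "Y = ?A (?s 0 (Suc d - y) 0)" "Z = ?A (?s 0 0 (Suc d - z))"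
    "X \<inter> Y = ?A (?s (Suc d - x) (Suc d - y) 0)" "X \<inter> Z = ?A (?s (Suc d - x) 0 (Suc d - z))"
    "Y \<inter> Z = ?A (?s 0 (Suc d - y) (Suc d - z))"
    using assms distinct_4 by (auto simp: XYZ forall_4)
  have card_box: "int (card (?A (?s u v w))) = binom (int d - int (u + v + w) + 3) 3" for u v w
    unfolding card_exponents_above s ..
  have cards: "int (card X) = binom (int x + 2) 3" "int (card Y) = binom (int y + 2) 3"
    "int (card Z) = binom (int z + 2) 3" "int (card (X \<inter> Y)) = binom (int x + int y - int d + 1) 3"
    "int (card (X \<inter> Z)) = binom (int x + int z - int d + 1) 3"
    "int (card (Y \<inter> Z)) = binom (int y + int z - int d + 1) 3"
    unfolding eqs(4-6) unfolding eqs(1-3) card_box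
    using assms by (auto simp: of_nat_diff intro!: arg_cong[where f = "\<lambda>e. binom e 3"])
  have "X \<inter> Y \<inter> Z = {}"
  proof safe
    fix \<alpha> assume "\<alpha> \<in> X" "\<alpha> \<in> Y" "\<alpha> \<in> Z"
    then show "\<alpha> \<in> {}" using assms by (auto simp: XYZ sum_4)
  qed
  then have e: "(X \<inter> Z) \<inter> (Y \<inter> Z) = {}" by blast
  have "toric_exponents d x y z = ?E - (X \<union> Y \<union> Z)"
    by (auto simp: toric_exponents_def XYZ)
  moreover have "X \<union> Y \<union> Z \<subseteq> ?E" by (auto simp: XYZ)
  ultimately have "card (toric_exponents d x y z) = card ?E - card (X \<union> Y \<union> Z)"
    "card (X \<union> Y \<union> Z) \<le> card ?E"
    by (simp_all add: card_Diff_subset fin card_mono)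
  moreover have "card (X \<union> Y) + card Z = card (X \<union> Y \<union> Z) + card ((X \<union> Y) \<inter> Z)"
    using fin by (intro card_Un_Int) auto
  moreover have "card ((X \<union> Y) \<inter> Z) = card (X \<inter> Z) + card (Y \<inter> Z)"
    unfolding Int_Un_distrib2 using e fin by (intro card_Un_disjoint) auto
  moreover have "card X + card Y = card (X \<union> Y) + card (X \<inter> Y)"
    using fin by (intro card_Un_Int)
  moreover have "int (card ?E) = binom (int d + 3) 3"
    using card_exponents_above[of d "\<lambda>_. 0"] by simp
  ultimately show ?thesis using cards by linarith
qed

text \<open>
  The secant linear virtual dimension written out for six points, with integer arguments: a Cremona
  transformation produces negative multiplicities, and the formula is invariant only before these
  are replaced by zero.
\<close>

definition secant_formula :: "int \<Rightarrow> int \<Rightarrow> int \<Rightarrow> int \<Rightarrow> int \<Rightarrow> int \<Rightarrow> int \<Rightarrow> int" where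
  "secant_formula D u v w x y z = (let k = u + v + w + x + y + z - 3 * D; b = (\<lambda>e. binom e 3) in
    b (D + 3) - (b (u + 2) + b (v + 2) + b (w + 2) + b (x + 2) + b (y + 2) + b (z + 2))
    + (b (u + v - D + 1) + b (u + w - D + 1) + b (u + x - D + 1) + b (u + y - D + 1) + b (u + z - D + 1)
      + b (v + w - D + 1) + b (v + x - D + 1) + b (v + y - D + 1) + b (v + z - D + 1)
      + b (w + x - D + 1) + b (w + y - D + 1) + b (w + z - D + 1)
      + b (x + y - D + 1) + b (x + z - D + 1) + b (y + z - D + 1))
    - (b (u + v + w - 2 * D) + b (u + v + x - 2 * D) + b (u + v + y - 2 * D) + b (u + v + z - 2 * D)
      + b (u + w + x - 2 * D) + b (u + w + y - 2 * D) + b (u + w + z - 2 * D)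
      + b (u + x + y - 2 * D) + b (u + x + z - 2 * D) + b (u + y + z - 2 * D)
      + b (v + w + x - 2 * D) + b (v + w + y - 2 * D) + b (v + w + z - 2 * D)
      + b (v + x + y - 2 * D) + b (v + x + z - 2 * D) + b (v + y + z - 2 * D)
      + b (w + x + y - 2 * D) + b (w + x + z - 2 * D) + b (w + y + z - 2 * D) + b (x + y + z - 2 * D))
    + b (k + 1)
    - (b (u + k - D) + b (v + k - D) + b (w + k - D) + b (x + k - D) + b (y + k - D) + b (z + k - D)))"

lemma sum_Pow_insert:
  assumes "finite A" "x \<notin> A"
  shows "(\<Sum>I\<in>Pow (insert x A). g I) = (\<Sum>I\<in>Pow A. g I) + (\<Sum>I\<in>Pow A. g (insert x I))"
proof -
  have "inj_on (insert x) (Pow A)" using assms(2) by (auto simp: inj_on_def)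
  moreover have "Pow A \<inter> insert x ` Pow A = {}" using assms(2) by auto
  ultimately show ?thesis using assms(1)
    by (simp add: Pow_insert sum.union_disjoint sum.reindex)
qed

lemma secant_linear_vdim_split:
  "secant_linear_vdim 3 d m =
    (\<Sum>I\<in>Pow {1..6}. if card I \<le> 3 then (-1) ^ card I * binom (k_join 3 d m I 0 + 3 - int (card I)) 3 else 0)
    + (\<Sum>I\<in>Pow {1..6}. if card I \<le> 1 then (-1) ^ card I * binom (k_join 3 d m I 1 + 1 - int (card I)) 3 else 0)"
proof -
  let ?S = "{(I :: nat set, t :: nat). I \<subseteq> {1..3+3} \<and> t \<le> 3 div 2 + 3 mod 2 \<and> card I + 2 * t \<le> 3}"
  let ?g = "\<lambda>(I, t). (-1) ^ card I * binom (int 3 + k_join 3 d m I t - r_join I t - 1) 3"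
  let ?A = "\<lambda>n. {I \<in> Pow {1..6::nat}. card I \<le> n}"
  have S: "?S = (\<lambda>I. (I, 0)) ` ?A 3 \<union> (\<lambda>I. (I, 1)) ` ?A 1"
  proof (intro set_eqI iffI)
    fix It assume "It \<in> ?S"
    then obtain I t where It: "It = (I, t)" "I \<subseteq> {1..6}" "card I + 2 * t \<le> 3" by auto
    then have "t = 0 \<or> t = 1" by linarith
    then show "It \<in> (\<lambda>I. (I, 0)) ` ?A 3 \<union> (\<lambda>I. (I, 1)) ` ?A 1" using It by auto
  qed auto
  have "secant_linear_vdim 3 d m = sum ?g ((\<lambda>I. (I, 0)) ` ?A 3) + sum ?g ((\<lambda>I. (I, 1)) ` ?A 1)"
    unfolding secant_linear_vdim_def S by (rule sum.union_disjoint) auto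
  also have "sum ?g ((\<lambda>I. (I, 0)) ` ?A 3) = (\<Sum>I\<in>?A 3. (-1) ^ card I * binom (k_join 3 d m I 0 + 3 - int (card I)) 3)"
    by (subst sum.reindex) (auto simp: inj_on_def r_join_def algebra_simps intro!: sum.cong)
  also have "sum ?g ((\<lambda>I. (I, 1)) ` ?A 1) = (\<Sum>I\<in>?A 1. (-1) ^ card I * binom (k_join 3 d m I 1 + 1 - int (card I)) 3)"
    by (subst sum.reindex) (auto simp: inj_on_def r_join_def algebra_simps intro!: sum.cong)
  finally show ?thesis
    by (simp only: sum.inter_filter[OF finite_Pow_iff[THEN iffD2, OF finite_atLeastAtMost]])
qed

lemma secant_linear_vdim_permute:
  assumes bij: "bij_betw \<pi> {1..6} {1..6::nat}"
  shows "secant_linear_vdim 3 d (m \<circ> \<pi>) = secant_linear_vdim 3 d m"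
proof -
  have inj: "inj_on \<pi> I" if "I \<in> Pow {1..6}" for I
    using bij that by (auto simp: bij_betw_def intro: inj_on_subset)
  have kc: "kC 3 d (m \<circ> \<pi>) = kC 3 d m"
    using sum.reindex_bij_betw[OF bij, of "\<lambda>i. int (m i)"] by (simp add: kC_def)
  have k: "k_join 3 d (m \<circ> \<pi>) I t = k_join 3 d m (\<pi> ` I) t" if "I \<in> Pow {1..6}" for I t
    using inj[OF that] by (simp add: k_join_def kc sum.reindex card_image)
  have P: "bij_betw ((`) \<pi>) (Pow {1..6}) (Pow {1..6})" by (rule bij_betw_Pow[OF bij])
  show ?thesis
    unfolding secant_linear_vdim_split
    by (intro arg_cong2[where f = "(+)"]; subst sum.reindex_bij_betw[OF P, symmetric];
        intro sum.cong refl; simp only: k inj card_image)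
qed

lemma secant_linear_vdim_eq_formula:
  "secant_linear_vdim 3 d m =
    secant_formula (int d) (int (m 1)) (int (m 2)) (int (m 3)) (int (m 4)) (int (m 5)) (int (m 6))"
proof -
  have kc: "kC 3 d m = int (m 1) + int (m 2) + int (m 3) + int (m 4) + int (m 5) + int (m 6) - 3 * int d"
    by (simp add: kC_def set_1_6[simplified])
  show ?thesis
    unfolding secant_linear_vdim_split set_1_6 secant_formula_def Let_def
    by (simp add: sum_Pow_insert k_join_def kc algebra_simps)
qed

section \<open>The dimension of a non-empty system\<close>

definition toric_formula :: "int \<Rightarrow> int \<Rightarrow> int \<Rightarrow> int \<Rightarrow> int" where
  "toric_formula D u v w = binom (D + 3) 3 - (binom (u + 2) 3 + binom (v + 2) 3 + binom (w + 2) 3)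
    + (binom (u + v - D + 1) 3 + binom (u + w - D + 1) 3 + binom (v + w - D + 1) 3)"

lemma secant_formula_swap: "secant_formula D u v w x y z = secant_formula D v u w x y z" "secant_formula D u v w x y z = secant_formula D w v u x y z"
  "secant_formula D u v w x y z = secant_formula D x v w u y z"
  by (simp_all add: secant_formula_def Let_def algebra_simps)

text \<open>
  The five remaining multiplicities have sum at most \<open>3 D\<close>, so every term that involves
  the curve vanishes, and so does every term that involves the point of nonpositive multiplicity.
\<close>

lemma secant_formula_nonpos:
  assumes "u \<le> 0" "v \<le> D" "w \<le> D" "x \<le> D" "y \<le> D" "z \<le> D" "0 \<le> D" "v + w + x + y + z \<le> 3 * D"
  shows "secant_formula D u v w x y z = secant_formula D 0 v w x y z"
  using assms by (simp add: secant_formula_def Let_def binom_eq_0)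

text \<open>
  The transformation permutes the lines, planes, and cones in the formula up to the reflection
  \<open>e \<mapsto> 2 - e\<close>: the line through two of the four centres goes to the line
  through the other two, a centre goes to the opposite plane, the line through the last two points
  is exchanged with the curve, and the planes through one centre and the last two points are
  exchanged with the cones over the curve from that centre. What remains after cancellation is an
  alternating sum of the values of one cubic polynomial, a fourth difference, which is zero.
\<close>

lemma secant_formula_cremona:
  assumes "0 \<le> D" "0 \<le> D'" "D' = 3 * D - u - v - w - x"
  shows "secant_formula D' (D' - D + u) (D' - D + v) (D' - D + w) (D' - D + x) y z = secant_formula D u v w x y z"
proof -
  define Q where "Q e = binom e 3 - binom (2 - e) 3" for e
  have Q: "6 * Q e = e * (e - 1) * (e - 2)" for e
    unfolding Q_def by (rule binom_antisym)
  have refl: "binom (2 - e) 3 = binom e 3 - Q e" for e by (simp add: Q_def)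
  have D: "binom (D + 3) 3 = Q (D + 3)" "binom (D' + 3) 3 = Q (D' + 3)"
    using assms(1,2) by (simp_all add: Q_def binom_eq_0)
  define k where "k = u + v + w + x + y + z - 3 * D"
  define k' where "k' = (D' - D + u) + (D' - D + v) + (D' - D + w) + (D' - D + x) + y + z - 3 * D'"
  have args:
    "D' - D + u + 2 = 2 - (v + w + x - 2 * D)"
    "D' - D + v + 2 = 2 - (u + w + x - 2 * D)"
    "D' - D + w + 2 = 2 - (u + v + x - 2 * D)"
    "D' - D + x + 2 = 2 - (u + v + w - 2 * D)"
    "(D' - D + u) + (D' - D + v) - D' + 1 = 2 - (w + x - D + 1)"
    "(D' - D + u) + (D' - D + w) - D' + 1 = 2 - (v + x - D + 1)"
    "(D' - D + u) + (D' - D + x) - D' + 1 = 2 - (v + w - D + 1)"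
    "(D' - D + u) + y - D' + 1 = u + y - D + 1"
    "(D' - D + u) + z - D' + 1 = u + z - D + 1"
    "(D' - D + v) + (D' - D + w) - D' + 1 = 2 - (u + x - D + 1)"
    "(D' - D + v) + (D' - D + x) - D' + 1 = 2 - (u + w - D + 1)"
    "(D' - D + v) + y - D' + 1 = v + y - D + 1"
    "(D' - D + v) + z - D' + 1 = v + z - D + 1"
    "(D' - D + w) + (D' - D + x) - D' + 1 = 2 - (u + v - D + 1)"
    "(D' - D + w) + y - D' + 1 = w + y - D + 1"
    "(D' - D + w) + z - D' + 1 = w + z - D + 1"
    "(D' - D + x) + y - D' + 1 = x + y - D + 1"
    "(D' - D + x) + z - D' + 1 = x + z - D + 1"
    "y + z - D' + 1 = k + 1"
    "(D' - D + u) + (D' - D + v) + (D' - D + w) - 2 * D' = 2 - (x + 2)"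
    "(D' - D + u) + (D' - D + v) + (D' - D + x) - 2 * D' = 2 - (w + 2)"
    "(D' - D + u) + (D' - D + v) + y - 2 * D' = u + v + y - 2 * D"
    "(D' - D + u) + (D' - D + v) + z - 2 * D' = u + v + z - 2 * D"
    "(D' - D + u) + (D' - D + w) + (D' - D + x) - 2 * D' = 2 - (v + 2)"
    "(D' - D + u) + (D' - D + w) + y - 2 * D' = u + w + y - 2 * D"
    "(D' - D + u) + (D' - D + w) + z - 2 * D' = u + w + z - 2 * D"
    "(D' - D + u) + (D' - D + x) + y - 2 * D' = u + x + y - 2 * D"
    "(D' - D + u) + (D' - D + x) + z - 2 * D' = u + x + z - 2 * D"
    "(D' - D + u) + y + z - 2 * D' = u + k - D"
    "(D' - D + v) + (D' - D + w) + (D' - D + x) - 2 * D' = 2 - (u + 2)"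
    "(D' - D + v) + (D' - D + w) + y - 2 * D' = v + w + y - 2 * D"
    "(D' - D + v) + (D' - D + w) + z - 2 * D' = v + w + z - 2 * D"
    "(D' - D + v) + (D' - D + x) + y - 2 * D' = v + x + y - 2 * D"
    "(D' - D + v) + (D' - D + x) + z - 2 * D' = v + x + z - 2 * D"
    "(D' - D + v) + y + z - 2 * D' = v + k - D"
    "(D' - D + w) + (D' - D + x) + y - 2 * D' = w + x + y - 2 * D"
    "(D' - D + w) + (D' - D + x) + z - 2 * D' = w + x + z - 2 * D"
    "(D' - D + w) + y + z - 2 * D' = w + k - D"
    "(D' - D + x) + y + z - 2 * D' = x + k - D"
    "k' + 1 = y + z - D + 1"
    "(D' - D + u) + k' - D' = u + y + z - 2 * D"
    "(D' - D + v) + k' - D' = v + y + z - 2 * D"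
    "(D' - D + w) + k' - D' = w + y + z - 2 * D"
    "(D' - D + x) + k' - D' = x + y + z - 2 * D"
    "y + k' - D' = y + k - D"
    "z + k' - D' = z + k - D"
    using assms(3) by (simp_all add: k_def k'_def)
  have "6 * (Q (D + 3) - Q (D' + 3)
      - (Q (u + 2) + Q (v + 2) + Q (w + 2) + Q (x + 2))
      + (Q (u + v - D + 1) + Q (u + w - D + 1) + Q (u + x - D + 1)
        + Q (v + w - D + 1) + Q (v + x - D + 1) + Q (w + x - D + 1))
      - (Q (u + v + w - 2 * D) + Q (u + v + x - 2 * D) + Q (u + w + x - 2 * D) + Q (v + w + x - 2 * D))) = 0"
    unfolding distrib_left right_diff_distrib Q assms(3) by algebra
  then have poly: "Q (D + 3) - Q (D' + 3)
      - (Q (u + 2) + Q (v + 2) + Q (w + 2) + Q (x + 2))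
      + (Q (u + v - D + 1) + Q (u + w - D + 1) + Q (u + x - D + 1)
        + Q (v + w - D + 1) + Q (v + x - D + 1) + Q (w + x - D + 1))
      - (Q (u + v + w - 2 * D) + Q (u + v + x - 2 * D) + Q (u + w + x - 2 * D) + Q (v + w + x - 2 * D)) = 0"
    by simp
  have "secant_formula D u v w x y z - secant_formula D' (D' - D + u) (D' - D + v) (D' - D + w) (D' - D + x) y z = 0"
    unfolding secant_formula_def Let_def k_def[symmetric] k'_def[symmetric] args refl D poly[symmetric]
    by simp
  then show ?thesis by simp
qed

text \<open>
  Under these inequalities only lines through the first point and the line through the second and
  third can contribute. The right-hand side is the lower bound for the dimension.
\<close>

lemma secant_formula_standard:
  assumes "u \<ge> v" "v \<ge> w" "w \<ge> x" "x \<ge> y" "y \<ge> z" "z \<ge> 0" "u \<le> D" "u + v + w + x \<le> 2 * D"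
  shows "secant_formula D u v w x y z = toric_formula D u v w + toric_formula D u x 0 + toric_formula D u y 0
    + toric_formula D u z 0 - 3 * toric_formula D u 0 0"
  using assms by (simp add: secant_formula_def Let_def toric_formula_def binom_eq_0)

text \<open>
  The formula satisfies the recursion that the restriction to a plane gives as an upper bound for
  the dimension.
\<close>

lemma secant_formula_standard_step:
  assumes "u \<ge> v" "v \<ge> w" "w \<ge> x" "x \<ge> y" "y \<ge> z" "z \<ge> 0" "u \<le> D" "u + v + w + x \<le> 2 * D" "w \<ge> 1"
  shows "secant_formula D u v w x y z + toric_formula (D - 1) (u - 1) (v - 1) (w - 1) =
    secant_formula (D - 1) (u - 1) (v - 1) (w - 1) x y z + toric_formula D u v w"
  using assms by (simp add: secant_formula_def Let_def toric_formula_def binom_eq_0 algebra_simps)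

text \<open>
  The multiplicities that a Cremona transformation makes negative are replaced by zero one after the
  other.
\<close>

lemma secant_formula_truncate:
  assumes "u \<le> D" "v \<le> D" "w \<le> D" "x \<le> D" "y \<le> D" "z \<le> D" "0 \<le> D" "0 \<le> y" "0 \<le> z"
    and five: "u < 0 \<or> v < 0 \<or> w < 0 \<or> x < 0 \<Longrightarrow> max 0 u + max 0 v + max 0 w + max 0 x + y + z \<le> 3 * D"
  shows "secant_formula D (max 0 u) (max 0 v) (max 0 w) (max 0 x) y z = secant_formula D u v w x y z"
proof -
  have 1: "secant_formula D (max 0 u) v w x y z = secant_formula D u v w x y z"
    using secant_formula_nonpos[of u v D w x y z] assms(1-9) five by (cases "u < 0") (auto simp: max_def split: if_splits)
  have 2: "secant_formula D (max 0 v) (max 0 u) w x y z = secant_formula D v (max 0 u) w x y z"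
    using secant_formula_nonpos[of v "max 0 u" D w x y z] assms(1-9) five by (cases "v < 0") (auto simp: max_def split: if_splits)
  have 3: "secant_formula D (max 0 w) (max 0 v) (max 0 u) x y z = secant_formula D w (max 0 v) (max 0 u) x y z"
    using secant_formula_nonpos[of w "max 0 v" D "max 0 u" x y z] assms(1-9) five by (cases "w < 0") (auto simp: max_def split: if_splits)
  have 4: "secant_formula D (max 0 x) (max 0 v) (max 0 w) (max 0 u) y z = secant_formula D x (max 0 v) (max 0 w) (max 0 u) y z"
    using secant_formula_nonpos[of x "max 0 v" D "max 0 w" "max 0 u" y z] assms(1-9) five by (cases "x < 0") (auto simp: max_def split: if_splits)
  have "secant_formula D (max 0 u) (max 0 v) (max 0 w) (max 0 x) y z = secant_formula D (max 0 u) (max 0 v) (max 0 w) x y z"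
    using 4 secant_formula_swap(3) by metis
  also have "\<dots> = secant_formula D (max 0 u) (max 0 v) w x y z" using 3 secant_formula_swap(2) by metis
  also have "\<dots> = secant_formula D (max 0 u) v w x y z" using 2 secant_formula_swap(1) by metis
  finally show ?thesis using 1 by simp
qed

lemma toric_count_formula:
  assumes "x \<le> d" "y \<le> d" "z \<le> d" "x + y + z \<le> 2 * d + 2"
  shows "int (toric_count d x y z) = toric_formula (int d) (int x) (int y) (int z)"
  using toric_count_eq[OF assms] by (simp add: toric_formula_def)

text \<open>
  Induction on the degree, with the multiplicities in decreasing order. If the four largest exceed
  \<open>2 d\<close> in sum, a Cremona transformation lowers the degree and preserves both sides.
  Otherwise the monomial bounds enclose the dimension: the upper bound refers to a system of degree
  \<open>d - 1\<close>, and it is sharp because that system is non-empty, so that the induction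
  hypothesis applies to it.
\<close>

lemma sys_dim_eq_secant_linear_vdim:
  assumes "linearly_general p" "0 < sys_dim p d m"
  shows "int (sys_dim p d m) = secant_linear_vdim 3 d m"
  using assms
proof (induction d arbitrary: p m rule: less_induct)
  case (less d p0 m0)
  obtain \<pi> :: "nat \<Rightarrow> nat" where bij: "bij_betw \<pi> {1..6} {1..6}"
    and sorted: "m0 (\<pi> 1) \<ge> m0 (\<pi> 2)" "m0 (\<pi> 2) \<ge> m0 (\<pi> 3)"
    "m0 (\<pi> 3) \<ge> m0 (\<pi> 4)" "m0 (\<pi> 4) \<ge> m0 (\<pi> 5)" "m0 (\<pi> 5) \<ge> m0 (\<pi> 6)" by (rule sort_six)
  define p m where "p = p0 \<circ> \<pi>" and "m = m0 \<circ> \<pi>"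
  have s: "m 1 \<ge> m 2" "m 2 \<ge> m 3" "m 3 \<ge> m 4" "m 4 \<ge> m 5" "m 5 \<ge> m 6"
    using sorted by (simp_all add: m_def)
  have gp: "linearly_general p" unfolding p_def by (rule linearly_general_permute[OF less.prems(1) bij])
  have dim0: "sys_dim p d m = sys_dim p0 d m0"
    unfolding p_def m_def lin_sys_permute[OF bij] ..
  have pos: "0 < sys_dim p d m" using less.prems(2) dim0 by simp
  have v0: "secant_linear_vdim 3 d m = secant_linear_vdim 3 d m0"
    unfolding m_def by (rule secant_linear_vdim_permute[OF bij])
  have md: "\<forall>i\<in>{1..6}. m i \<le> d" using mult_le_degree[OF gp pos] by blast
  then have md': "m 1 \<le> d" "m 2 \<le> d" "m 3 \<le> d" "m 4 \<le> d" "m 5 \<le> d" "m 6 \<le> d" by auto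
  define S where "S = m 1 + m 2 + m 3 + m 4"
  have "int (sys_dim p d m) = secant_linear_vdim 3 d m"
  proof (cases "S \<le> 2 * d")
    case False
    define d' where "d' = 3 * d - S"
    define m' where "m' = (\<lambda>i. if i \<le> 4 then m i + 2 * d - S else m i)"
    have S3: "S \<le> 3 * d" using cremona_invariance(1)[OF gp pos] by (simp add: S_def)
    obtain q where q: "linearly_general q" and dim: "sys_dim q d' m' = sys_dim p d m"
      using cremona_invariance(2)[OF gp pos] unfolding m'_def d'_def S_def by blast
    have posq: "0 < sys_dim q d' m'" using pos dim by simp
    have "int (sys_dim q d' m') = secant_linear_vdim 3 d' m'"
      using False S3 by (intro less.IH q posq) (simp add: d'_def)
    also have "\<dots> = secant_formula (int d') (int (m' 1)) (int (m' 2)) (int (m' 3)) (int (m' 4)) (int (m 5)) (int (m 6))"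
      unfolding secant_linear_vdim_eq_formula by (simp add: m'_def)
    also have "\<dots> = secant_formula (int d') (int d' - int d + int (m 1)) (int d' - int d + int (m 2))
        (int d' - int d + int (m 3)) (int d' - int d + int (m 4)) (int (m 5)) (int (m 6))"
    proof -
      have m'_max: "int (m' i) = max 0 (int d' - int d + int (m i))" if "i \<le> 4" for i
        using that S3 by (auto simp: m'_def d'_def of_nat_diff)
      have le4: "2 \<le> (4::nat)" "3 \<le> (4::nat)" by simp_all
      have le: "m' 1 \<le> d'" "m' 2 \<le> d'" "m' 3 \<le> d'" "m' 4 \<le> d'" "m 5 \<le> d'" "m 6 \<le> d'"
        using mult_le_degree[OF q posq, of 1] mult_le_degree[OF q posq, of 2]
          mult_le_degree[OF q posq, of 3] mult_le_degree[OF q posq, of 4]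
          mult_le_degree[OF q posq, of 5] mult_le_degree[OF q posq, of 6] by (auto simp: m'_def)
      \<comment> \<open>A multiplicity that vanishes after truncation leaves a system based at five points.\<close>
      have five: "m' 1 + m' 2 + m' 3 + m' 4 + m 5 + m 6 \<le> 3 * d'"
        if j: "j \<in> {1, 2, 3, 4}" "m' j = 0" for j
      proof -
        have "sum m' {1..6} = sum m' ({1..6} - {j})"
          using j sum.remove[of "{1..6}" j m'] by auto
        then have "sum m' {1..6} \<le> 3 * d'" using five_point_bound[OF q posq, of j] j by auto
        then show ?thesis unfolding set_1_6 by (simp add: m'_def add.assoc)
      qed
      show ?thesis
        unfolding m'_max[of 1, OF one_le_numeral] m'_max[of 2, OF le4(1)] m'_max[of 3, OF le4(2)]
          m'_max[of 4, OF order_refl]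
      proof (rule secant_formula_truncate)
        assume "int d' - int d + int (m 1) < 0 \<or> int d' - int d + int (m 2) < 0
          \<or> int d' - int d + int (m 3) < 0 \<or> int d' - int d + int (m 4) < 0"
        then have "m' 1 = 0 \<or> m' 2 = 0 \<or> m' 3 = 0 \<or> m' 4 = 0"
          using m'_max[of 1] m'_max[of 2] m'_max[of 3] m'_max[of 4] by auto
        then have "m' 1 + m' 2 + m' 3 + m' 4 + m 5 + m 6 \<le> 3 * d'" using five by blast
        then show "max 0 (int d' - int d + int (m 1)) + max 0 (int d' - int d + int (m 2))
            + max 0 (int d' - int d + int (m 3)) + max 0 (int d' - int d + int (m 4))
            + int (m 5) + int (m 6) \<le> 3 * int d'"
          using m'_max[of 1] m'_max[of 2] m'_max[of 3] m'_max[of 4] by linarith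
      qed (use le md' in auto)
    qed
    also have "\<dots> = secant_formula (int d) (int (m 1)) (int (m 2)) (int (m 3)) (int (m 4)) (int (m 5)) (int (m 6))"
      by (rule secant_formula_cremona) (use S3 in \<open>auto simp: d'_def S_def of_nat_diff\<close>)
    finally show ?thesis using dim unfolding secant_linear_vdim_eq_formula by simp
  next
    case True
    note standard = s md' True[unfolded S_def]
    let ?t = "\<lambda>x y z. toric_formula (int d) (int x) (int y) (int z)"
    have tc: "int (toric_count d (m 1) (m 2) (m 3)) = ?t (m 1) (m 2) (m 3)"
      using standard by (intro toric_count_formula) auto
    have tc': "int (toric_count d (m 1) (m j) 0) = ?t (m 1) (m j) 0" if "m j \<le> d" for j
      using standard that by (intro toric_count_formula) auto
    have tc'': "int (toric_count d (m 1) 0 0) = ?t (m 1) 0 0"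
      using standard by (intro toric_count_formula) auto
    have eq: "secant_linear_vdim 3 d m = ?t (m 1) (m 2) (m 3) + ?t (m 1) (m 4) 0 + ?t (m 1) (m 5) 0
        + ?t (m 1) (m 6) 0 - 3 * ?t (m 1) 0 0"
      unfolding secant_linear_vdim_eq_formula
      by (subst secant_formula_standard) (use standard in auto)
    have ge: "secant_linear_vdim 3 d m \<le> int (sys_dim p d m)"
      using sys_dim_lower_bound[OF gp md] tc tc'[OF md'(4)] tc'[OF md'(5)] tc'[OF md'(6)] tc'' unfolding eq by linarith
    have "int (sys_dim p d m) \<le> secant_linear_vdim 3 d m"
    proof (cases "m 3 = 0")
      case True
      then have "sys_dim p d m = toric_count d (m 1) (m 2) (m 3)"
        using standard by (intro toric_dim gp) auto
      moreover have "m 4 = 0" "m 5 = 0" "m 6 = 0" using True s by auto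
      ultimately show ?thesis using eq tc by simp
    next
      case False
      then obtain e where e: "d = Suc e" using md' by (cases d) auto
      define m' where "m' = (\<lambda>i. if i \<le> 3 then m i - 1 else m i)"
      have m': "m' 1 = m 1 - 1" "m' 2 = m 2 - 1" "m' 3 = m 3 - 1" "m' 4 = m 4" "m' 5 = m 5" "m' 6 = m 6"
        by (simp_all add: m'_def)
      \<comment> \<open>Being in standard form, the multiplicities have sum at most \<open>3 d\<close>, and three units of it are removed.\<close>
      have "0 < sys_dim p e m'"
      proof (rule lin_sys_nonempty_planes[OF gp])
        show "\<forall>i\<in>{1..6}. m' i \<le> e"
          unfolding set_1_6 using standard False e by (auto simp: m' simp del: One_nat_def)
        show "sum m' {1..6} \<le> 3 * e"
          unfolding set_1_6 using standard False e by (simp add: m' del: One_nat_def)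
      qed
      then have IH: "int (sys_dim p e m') = secant_linear_vdim 3 e m'"
        using e by (intro less.IH gp) auto
      have ub: "sys_dim p d m + toric_count e (m 1 - 1) (m 2 - 1) (m 3 - 1) \<le>
          sys_dim p e m' + toric_count d (m 1) (m 2) (m 3)"
        using sys_dim_upper_bound[OF gp, of m e] md s False unfolding e m'_def by auto
      have i: "int (m j - 1) = int (m j) - 1" if "m j \<noteq> 0" for j using that by simp
      have "int (toric_count e (m 1 - 1) (m 2 - 1) (m 3 - 1)) =
          toric_formula (int d - 1) (int (m 1) - 1) (int (m 2) - 1) (int (m 3) - 1)"
        using standard e False by (subst toric_count_formula) (auto simp: i)
      moreover have "secant_linear_vdim 3 d m + toric_formula (int d - 1) (int (m 1) - 1) (int (m 2) - 1) (int (m 3) - 1)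
          = secant_linear_vdim 3 e m' + ?t (m 1) (m 2) (m 3)"
      proof -
        have "secant_linear_vdim 3 e m' = secant_formula (int d - 1) (int (m 1) - 1) (int (m 2) - 1) (int (m 3) - 1)
            (int (m 4)) (int (m 5)) (int (m 6))"
          unfolding secant_linear_vdim_eq_formula m' using s False e by (simp add: i)
        then show ?thesis
          unfolding secant_linear_vdim_eq_formula[of d]
          by (simp only:) (rule secant_formula_standard_step, use standard False in auto)
      qed
      ultimately show ?thesis using ub tc IH by linarith
    qed
    then show ?thesis using ge by linarith
  qed
  then show ?case using dim0 v0 by simp
qed

section \<open>Forms vanishing on rational curves\<close>

lemma polyfun_curve_poly:
  fixes q :: "'n::finite \<Rightarrow> complex poly"
  assumes "polyfun F"
  shows "\<exists>g. \<forall>z. poly g z = F (\<chi> i. poly (q i) z)"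
  using assms
proof (induction rule: polyfun.induct)
  case (polyfun_const c) show ?case by (rule exI[of _ "[:c:]"]) simp
next
  case (polyfun_coord j) show ?case by (rule exI[of _ "q j"]) simp
next
  case (polyfun_add F G)
  then obtain f g where "\<forall>z. poly f z = F (\<chi> i. poly (q i) z)" "\<forall>z. poly g z = G (\<chi> i. poly (q i) z)" by blast
  then show ?case by (intro exI[of _ "f + g"]) simp
next
  case (polyfun_mult F G)
  then obtain f g where "\<forall>z. poly f z = F (\<chi> i. poly (q i) z)" "\<forall>z. poly g z = G (\<chi> i. poly (q i) z)" by blast
  then show ?case by (intro exI[of _ "f * g"]) simp
qed

lemma polyfun_curve_deriv:
  fixes q :: "'n::finite \<Rightarrow> complex poly"
  assumes "polyfun F"
  shows "((\<lambda>z. F (\<chi> i. poly (q i) z)) has_field_derivative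
    (\<Sum>i\<in>UNIV. partial_deriv i F (\<chi> i. poly (q i) z) * poly (pderiv (q i)) z)) (at z)"
  using assms
proof (induction rule: polyfun.induct)
  case (polyfun_coord j)
  have "(\<Sum>i\<in>UNIV. (if i = j then 1 else 0) * poly (pderiv (q i)) z) = poly (pderiv (q j)) z"
    by (simp add: if_distrib[of "\<lambda>x. x * _"] cong: if_cong)
  then show ?case using poly_DERIV[of "q j" z] by (simp add: partial_deriv_coord)
next
  case (polyfun_add F G)
  show ?case
    using DERIV_add[OF polyfun_add.IH]
    by (simp add: partial_deriv_add polyfun_add.hyps sum.distrib ring_distribs)
next
  case (polyfun_mult F G)
  show ?case
    using DERIV_mult[OF polyfun_mult.IH]
    by (simp add: partial_deriv_mult polyfun_mult.hyps sum.distrib ring_distribs sum_distrib_right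
        sum_distrib_left mult_ac)
qed simp

lemma linear_power_dvd_Suc:
  fixes g :: "complex poly"
  assumes "poly g a = 0" "[:-a, 1:] ^ k dvd pderiv g"
  shows "[:-a, 1:] ^ Suc k dvd g"
proof (cases "pderiv g = 0")
  case True
  then have "degree g = 0" by (simp add: pderiv_eq_0_iff)
  then have "g = 0" using assms(1) by (auto elim: degree_eq_zeroE)
  then show ?thesis by simp
next
  case False
  then have "g \<noteq> 0" by auto
  then have "order a g = Suc (order a (pderiv g))" using assms(1) by (rule order_pderiv)
  moreover have "k \<le> order a (pderiv g)" using assms(2) False by (simp add: order_divides)
  ultimately show ?thesis by (simp add: order_divides del: power_Suc)
qed

text \<open>
  The order of vanishing along a polynomial curve through the point is at least the multiplicity
  there: by the chain rule the derivative of the restriction is a combination of restricted partial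
  derivatives, which vanish to one order less.
\<close>

lemma mult_at_least_curve_dvd:
  fixes q :: "'n::finite \<Rightarrow> complex poly"
  assumes "polyfun F" "mult_at_least F (\<chi> i. poly (q i) a) k" "\<And>z. poly g z = F (\<chi> i. poly (q i) z)"
  shows "[:-a, 1:] ^ k dvd g"
  using assms
proof (induction k arbitrary: F g)
  case (Suc k)
  have "\<forall>i. \<exists>f. \<forall>z. poly f z = partial_deriv i F (\<chi> i. poly (q i) z)"
    using polyfun_curve_poly[OF polyfun_partial_deriv[OF Suc.prems(1)]] by blast
  then obtain f where f: "\<And>i z. poly (f i) z = partial_deriv i F (\<chi> i. poly (q i) z)" by metis
  have "poly (pderiv g) z = poly (\<Sum>i\<in>UNIV. f i * pderiv (q i)) z" for z
  proof -
    have "poly g = (\<lambda>z. F (\<chi> i. poly (q i) z))" using Suc.prems(3) by blast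
    then have "(poly g has_field_derivative poly (\<Sum>i\<in>UNIV. f i * pderiv (q i)) z) (at z)"
      using polyfun_curve_deriv[OF Suc.prems(1), of q z] by (simp add: poly_sum f)
    then show ?thesis using poly_DERIV DERIV_unique by blast
  qed
  then have "pderiv g = (\<Sum>i\<in>UNIV. f i * pderiv (q i))" by (simp add: poly_eq_poly_eq_iff[symmetric] fun_eq_iff)
  moreover have "[:-a, 1:] ^ k dvd f i" for i
    using Suc.prems by (intro Suc.IH[OF polyfun_partial_deriv _ f]) (simp_all add: mult_at_least_Suc)
  ultimately have "[:-a, 1:] ^ k dvd pderiv g" by (simp add: dvd_sum)
  then show ?case
    using Suc.prems by (intro linear_power_dvd_Suc) (simp_all add: mult_at_least_Suc)
qed simp

lemma degree_forms_curve:
  fixes q :: "'n::finite \<Rightarrow> complex poly"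
  assumes "F \<in> forms d" "\<And>i. degree (q i) \<le> e"
  obtains g where "\<And>z. poly g z = F (\<chi> i. poly (q i) z)" "degree g \<le> e * d"
proof -
  obtain c where F: "F = hom_form d c" using assms(1) by (auto simp: forms_eq_hom_form)
  define g where "g = (\<Sum>\<alpha>\<in>exponents d. smult (c \<alpha>) (\<Prod>i\<in>UNIV. q i ^ \<alpha> i))"
  have "degree (\<Prod>i\<in>UNIV. q i ^ \<alpha> i) \<le> e * d" if "sum \<alpha> UNIV = d" for \<alpha>
  proof -
    have "degree (\<Prod>i\<in>UNIV. q i ^ \<alpha> i) \<le> (\<Sum>i\<in>UNIV. degree (q i ^ \<alpha> i))"
      using degree_prod_sum_le[of UNIV "\<lambda>i. q i ^ \<alpha> i"] by simp
    also have "\<dots> \<le> (\<Sum>i\<in>UNIV. e * \<alpha> i)"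
      by (intro sum_mono order.trans[OF degree_power_le] mult_right_mono assms(2)) simp
    also have "\<dots> = e * d" using that by (simp add: sum_distrib_left[symmetric])
    finally show ?thesis .
  qed
  then have "degree g \<le> e * d"
    unfolding g_def by (intro degree_sum_le order.trans[OF degree_smult_le]) auto
  moreover have "poly g z = F (\<chi> i. poly (q i) z)" for z
    by (simp add: g_def F hom_form_def monom_fun_def poly_sum poly_prod)
  ultimately show ?thesis using that by blast
qed

lemma zeros_exceed_degree:
  fixes g :: "complex poly"
  assumes "finite J" "inj_on z J" "\<And>i. i \<in> J \<Longrightarrow> [:- z i, 1:] ^ m i dvd g" "degree g < sum m J"
  shows "g = 0"
proof (rule ccontr)
  assume g: "g \<noteq> 0"
  have "(\<Prod>i\<in>J. [:- z i, 1:] ^ m i) dvd g"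
    using assms(1-3)
  proof (induction J)
    case (insert i J)
    let ?P = "\<Prod>i\<in>J. [:- z i, 1:] ^ m i"
    have "?P dvd g" using insert by auto
    then obtain f where f: "g = ?P * f" by (rule dvdE)
    then have f0: "f \<noteq> 0" "?P \<noteq> 0" using g by auto
    have "poly ?P (z i) \<noteq> 0"
      using insert.hyps insert.prems(1) by (auto simp: poly_prod inj_on_def)
    then have "order (z i) ?P = 0" using f0 order_root by blast
    then have "order (z i) g = order (z i) f" using g unfolding f by (simp add: order_mult)
    moreover have "m i \<le> order (z i) g" using insert.prems(2)[of i] g by (simp add: order_divides)
    ultimately have "[:- z i, 1:] ^ m i dvd f" using f0 by (simp add: order_divides)
    then show ?case unfolding f using insert.hyps by (simp add: mult_dvd_mono mult.commute)
  qed simp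
  then have "degree (\<Prod>i\<in>J. [:- z i, 1:] ^ m i) \<le> degree g" using g by (rule dvd_imp_degree_le)
  moreover have "degree (\<Prod>i\<in>J. [:- z i, 1:] ^ m i) = sum m J"
    by (subst degree_prod_eq_sum_degree) (auto simp: degree_power_eq)
  ultimately show False using assms(4) by simp
qed

lemma mult_at_least_scale:
  fixes F :: "complex^'n::finite \<Rightarrow> complex"
  assumes "F \<in> forms d" "mult_at_least F x k" "s \<noteq> 0"
  shows "mult_at_least F (s *s x) k"
proof -
  let ?A = "mat (inverse s) :: complex^'n^'n"
  have A: "?A *v y = inverse s *s y" for y
    by (simp add: vec_eq_iff matrix_vector_mult_def mat_def if_distrib[of "\<lambda>x. x * _"] cong: if_cong)
  have "mult_at_least (\<lambda>y. F (?A *v y)) (s *s x) k"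
    using assms by (intro mult_at_least_linear polyfun_forms[OF assms(1)]) (simp add: A)
  then have "mult_at_least (\<lambda>y. s ^ d * F (?A *v y)) (s *s x) k"
    by (rule mult_at_least_cmult[OF polyfun_linear[OF polyfun_forms[OF assms(1)]]])
  moreover have "(\<lambda>y. s ^ d * F (?A *v y)) = F"
    using assms(3) by (auto simp: A forms_scale[OF assms(1)] power_inverse fun_eq_iff)
  ultimately show ?thesis by simp
qed

text \<open>
  The curve of degree \<open>e\<close> with coefficient vectors \<open>b\<close>; the case
  \<open>e = 1\<close> is a line and the case \<open>e = 3\<close> of independent coefficients a
  twisted cubic.
\<close>

definition binary_curve :: "nat \<Rightarrow> (nat \<Rightarrow> complex^'n::finite) \<Rightarrow> complex \<Rightarrow> complex \<Rightarrow> complex^'n" where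
  "binary_curve e b u v = (\<Sum>j=0..e. (u ^ (e - j) * v ^ j) *s b j)"

lemma binary_curve_scale: "binary_curve e b (s * u) (s * v) = s ^ e *s binary_curve e b u v"
proof -
  have "(s * u) ^ (e - j) * (s * v) ^ j = s ^ e * (u ^ (e - j) * v ^ j)" if "j \<in> {0..e}" for j
    using that by (simp add: power_mult_distrib mult_ac flip: power_add)
  then show ?thesis
    unfolding binary_curve_def vec.scale_sum_right by (intro sum.cong) (simp_all add: vector_smult_assoc)
qed

text \<open>
  Bezout's theorem on a rational curve: the restriction of a form of degree \<open>d\<close> has
  degree \<open>e d\<close>, too small for its zeros. The points of the parameter line are treated
  uniformly, without a point at infinity, by parametrising along an affine line in the parameter
  plane that starts at the point \<open>(u, v)\<close> under consideration and whose direction is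
  none of the given parameters.
\<close>

lemma form_vanishes_on_curve:
  fixes b :: "nat \<Rightarrow> complex^'n::finite"
  assumes F: "F \<in> forms d" and J: "finite J" and e: "0 < e"
    and distinct: "\<And>i k. i \<in> J \<Longrightarrow> k \<in> J \<Longrightarrow> i \<noteq> k \<Longrightarrow> s i * t k \<noteq> s k * t i"
    and nz: "\<And>i. i \<in> J \<Longrightarrow> s i \<noteq> 0 \<or> t i \<noteq> 0"
    and mult: "\<And>i. i \<in> J \<Longrightarrow> mult_at_least F (binary_curve e b (s i) (t i)) (m i)"
    and many: "e * d < sum m J"
  shows "F (binary_curve e b u v) = 0"
proof -
  have main: "F (binary_curve e b u v) = 0" if uv: "u \<noteq> 0 \<or> v \<noteq> 0" for u v
  proof -
    have "finite (insert (v / u) ((\<lambda>i. t i / s i) ` J))" using J by simp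
    then obtain r where r: "r \<notin> insert (v / u) ((\<lambda>i. t i / s i) ` J)"
      using ex_new_if_finite infinite_UNIV_char_0 by blast
    \<comment> \<open>The direction \<open>(1, r)\<close> is transversal to \<open>(u, v)\<close> and to all parameters, so every parameter is
      \<open>(u, v) + z i *s (1, r)\<close> up to the scalar \<open>l i\<close>.\<close>
    have ur: "u * r - v \<noteq> 0" using r uv by (cases "u = 0") (auto simp: field_simps)
    have sr: "s i * r - t i \<noteq> 0" if "i \<in> J" for i
    proof
      assume eq: "s i * r - t i = 0"
      then have "s i \<noteq> 0" using nz[OF that] by auto
      then have "r = t i / s i" using eq by (simp add: field_simps)
      then show False using r that by auto
    qed
    define z where "z i = (t i * u - s i * v) / (s i * r - t i)" for i
    define l where "l i = (u * r - v) / (s i * r - t i)" for i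
    have zl: "u + z i = l i * s i" "v + z i * r = l i * t i" "l i \<noteq> 0" if "i \<in> J" for i
      using sr[OF that] ur by (simp_all add: z_def l_def field_simps)
    define q where "q a = (\<Sum>j=0..e. smult (b j $ a) ([:u, 1:] ^ (e - j) * [:v, r:] ^ j))" for a
    have q: "(\<chi> a. poly (q a) y) = binary_curve e b (u + y) (v + y * r)" for y
      by (simp add: q_def binary_curve_def vec_eq_iff poly_sum mult_ac)
    have "degree (q a) \<le> e" for a
      unfolding q_def
    proof (intro degree_sum_le order.trans[OF degree_smult_le])
      fix j assume "j \<in> {0..e}"
      have "degree ([:u, 1:] ^ (e - j) * [:v, r:] ^ j) \<le> degree ([:u, 1:] ^ (e - j)) + degree ([:v, r:] ^ j)"
        by (rule degree_mult_le)
      also have "\<dots> \<le> degree [:u, 1:] * (e - j) + degree [:v, r:] * j"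
        by (intro add_mono degree_power_le)
      also have "\<dots> \<le> 1 * (e - j) + 1 * j"
        by (intro add_mono mult_right_mono) auto
      finally show "degree ([:u, 1:] ^ (e - j) * [:v, r:] ^ j) \<le> e" using \<open>j \<in> {0..e}\<close> by simp
    qed simp
    then obtain g where g: "\<And>y. poly g y = F (\<chi> a. poly (q a) y)" "degree g \<le> e * d"
      using degree_forms_curve[OF F] by metis
    have "[:- z i, 1:] ^ m i dvd g" if i: "i \<in> J" for i
    proof (rule mult_at_least_curve_dvd[OF polyfun_forms[OF F] _ g(1)])
      have "(\<chi> a. poly (q a) (z i)) = l i ^ e *s binary_curve e b (s i) (t i)"
        unfolding q zl(1,2)[OF i] by (rule binary_curve_scale)
      then show "mult_at_least F (\<chi> a. poly (q a) (z i)) (m i)"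
        using mult_at_least_scale[OF F mult[OF i]] zl(3)[OF i] by simp
    qed
    moreover have "inj_on z J"
    proof (rule inj_onI, rule ccontr)
      fix i k assume ik: "i \<in> J" "k \<in> J" "z i = z k" "i \<noteq> k"
      have "l i * s i = l k * s k" "l i * t i = l k * t k" using zl[OF ik(1)] zl[OF ik(2)] ik(3) by metis+
      then have "(l i * s i) * (l k * t k) = (l k * s k) * (l i * t i)" by simp
      then have "l i * l k * (s i * t k) = l i * l k * (s k * t i)" by (simp only: mult_ac)
      then show False using distinct[OF ik(1,2,4)] zl(3)[OF ik(1)] zl(3)[OF ik(2)] by simp
    qed
    ultimately have "g = 0" using g(2) many by (intro zeros_exceed_degree[OF J]) auto
    then have "F (\<chi> a. poly (q a) 0) = 0" using g(1)[of 0] by simp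
    then show ?thesis unfolding q by simp
  qed
  show ?thesis
  proof (cases "u = 0 \<and> v = 0")
    case True
    have "binary_curve e b 0 0 = 0 *s binary_curve e b 1 0"
      using binary_curve_scale[of e b 0 1 0] e by simp
    then show ?thesis using True main[of 1 0] forms_scale[OF F, of 0 "binary_curve e b 1 0"] by simp
  qed (use main in auto)
qed

section \<open>Base loci and the theorem\<close>

lemma general_not_proportional:
  assumes "linearly_general p" "i \<in> {1..6}" "k \<in> {1..6}" "i \<noteq> k"
  shows "p i \<noteq> c *s p k"
proof
  assume eq: "p i = c *s p k"
  define l where "l n = (if n = i then 1 else if n = k then - c else (0 :: complex))" for n
  have "card ({1..6} - {i, k}) = 4" using assms by (simp add: card_Diff_subset)
  then obtain A where "A \<subseteq> {1..6} - {i, k}" "card A = 2"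
    using obtain_subset_with_card_n[of 2 "{1..6} - {i, k}"] by auto
  then obtain x y where xy: "x \<in> {1..6} - {i, k}" "y \<in> {1..6} - {i, k}" "x \<noteq> y"
    by (auto simp: card_2_iff)
  have "(\<Sum>n\<in>{1..6}. l n *s p n) = (\<Sum>n\<in>{i, k}. l n *s p n)"
    using assms by (intro sum.mono_neutral_right) (auto simp: l_def)
  also have "\<dots> = 0" using assms(4) eq by (simp add: l_def)
  finally have rel: "relation p l" unfolding relation_def .
  have "l i = 0"
    by (rule linearly_generalD[OF assms(1) rel, of x y]) (use xy assms in \<open>auto simp: l_def\<close>)
  then show False by (simp add: l_def)
qed

lemma general_nonzero:
  assumes "linearly_general p" "i \<in> {1..6}" shows "p i \<noteq> 0"
proof -
  obtain k where "k \<in> {1..6}" "i \<noteq> k" using that[of 1] that[of 2] by fastforce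
  then show ?thesis using general_not_proportional[OF assms, of k 0] by auto
qed

lemma line_in_base_locus:
  assumes gp: "linearly_general p" and ij: "i \<in> {1..6}" "j \<in> {1..6}" "i \<noteq> j" and deg: "d < m i + m j"
  shows "lin_span p {i, j} \<subseteq> base_locus (lin_sys p d m)"
proof
  fix x assume "x \<in> lin_span p {i, j}"
  then obtain a b where x: "x = a *s p i + b *s p j"
    by (auto simp: lin_span_def vec.span_insert vec.span_singleton algebra_simps)
  let ?c = "\<lambda>n. if n = 0 then p i else p j"
  have curve: "binary_curve 1 ?c u v = u *s p i + v *s p j" for u v
    by (simp add: binary_curve_def)
  have "F x = 0" if F: "F \<in> lin_sys p d m" for F
  proof -
    have "F (binary_curve 1 ?c a b) = 0"
    proof (rule form_vanishes_on_curve[where J = "{i, j}" and s = "\<lambda>n. if n = i then 1 else 0"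
          and t = "\<lambda>n. if n = i then 0 else 1" and m = m])
      show "F \<in> forms d" using F by (simp add: lin_sys_def)
      show "mult_at_least F (binary_curve 1 ?c (if n = i then 1 else 0) (if n = i then 0 else 1)) (m n)"
        if "n \<in> {i, j}" for n
        using that F ij unfolding curve by (auto simp: lin_sys_def)
    qed (use ij deg in auto)
    then show ?thesis unfolding curve x .
  qed
  then show "x \<in> base_locus (lin_sys p d m)" by (simp add: base_locus_def)
qed

lemma vanishes_on_rational_normal_curve:
  fixes p :: "nat \<Rightarrow> complex^4"
  assumes gp: "linearly_general p" and C: "rational_normal_curve C" and pC: "\<forall>i\<in>{1..6}. p i \<in> C"
    and deg: "3 * d < sum m {1..6}" and F: "F \<in> lin_sys p d m" and x: "x \<in> C"
  shows "F x = 0"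
proof -
  obtain b :: "nat \<Rightarrow> complex^4" where "C = {(\<Sum>j=0..3. (u ^ (3 - j) * v ^ j) *s b j) | u v. True}"
    using C unfolding rational_normal_curve_def by auto
  then have Cb: "C = {binary_curve 3 b u v | u v. True}" by (simp add: binary_curve_def)
  have "\<forall>i\<in>{1..6}. \<exists>u v. p i = binary_curve 3 b u v" using pC unfolding Cb by blast
  then obtain s t where st: "\<And>i. i \<in> {1..6} \<Longrightarrow> p i = binary_curve 3 b (s i) (t i)" by metis
  have nz: "s i \<noteq> 0 \<or> t i \<noteq> 0" if i: "i \<in> {1..6}" for i
  proof (rule ccontr)
    assume "\<not> (s i \<noteq> 0 \<or> t i \<noteq> 0)"
    then have "p i = binary_curve 3 b (0 * 0) (0 * 0)" using st[OF i] by simp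
    also have "\<dots> = 0" unfolding binary_curve_scale by simp
    finally show False using general_nonzero[OF gp i] by simp
  qed
  have distinct: "s i * t k \<noteq> s k * t i" if ik: "i \<in> {1..6}" "k \<in> {1..6}" "i \<noteq> k" for i k
  proof
    assume eq: "s i * t k = s k * t i"
    obtain l where l: "s i = l * s k" "t i = l * t k"
    proof (cases "s k = 0")
      case True
      then have "t k \<noteq> 0" using nz[OF ik(2)] by simp
      then show ?thesis using that[of "t i / t k"] eq True by (simp add: field_simps)
    next
      case False
      then show ?thesis using that[of "s i / s k"] eq by (simp add: field_simps)
    qed
    then have "p i = l ^ 3 *s p k" using st[OF ik(1)] st[OF ik(2)] by (simp add: binary_curve_scale)
    then show False using general_not_proportional[OF gp ik] by blast
  qed
  obtain u v where "x = binary_curve 3 b u v" using x unfolding Cb by blast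
  moreover have "F (binary_curve 3 b u v) = 0"
    using F st by (intro form_vanishes_on_curve[OF _ _ _ distinct nz _ deg])
      (auto simp: lin_sys_def)
  ultimately show ?thesis by simp
qed

text \<open>
  The first secant variety is the Zariski closure of the lines spanned by vectors of the curve, and
  joining with the cone \<open>{0}\<close> over the empty set adds only a further closure. Forms
  that vanish on a set vanish on its closure.
\<close>

lemma join_curve_in_base_locus:
  fixes p :: "nat \<Rightarrow> complex^'n::finite"
  assumes "\<And>F x. F \<in> lin_sys p d m \<Longrightarrow> x \<in> C \<Longrightarrow> F x = 0"
  shows "join (lin_span p {}) (secant C 1) \<subseteq> base_locus (lin_sys p d m)"
proof
  fix x assume x: "x \<in> join (lin_span p {}) (secant C 1)"
  have "F x = 0" if F: "F \<in> lin_sys p d m" for F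
  proof -
    have Fd: "F \<in> forms d" using F by (simp add: lin_sys_def)
    have "F y = 0" if y: "y \<in> vec.span S" and S: "S \<subseteq> C" "card S = 1" for y S
    proof -
      obtain v where v: "S = {v}" using S(2) by (auto simp: card_1_singleton_iff)
      then obtain k where "y = k *s v" using y by (auto simp: vec.span_singleton)
      then show ?thesis using forms_scale[OF Fd] assms[OF F, of v] S v by simp
    qed
    then have "F y = 0" if "y \<in> secant C 1" for y
      using that Fd unfolding secant_def zariski_closure_def by blast
    then have "\<forall>y\<in>{a + b | a b. a \<in> lin_span p {} \<and> b \<in> secant C 1}. F y = 0"
      by (auto simp: lin_span_def)
    then show ?thesis using x Fd unfolding join_def zariski_closure_def by blast
  qed
  then show "x \<in> base_locus (lin_sys p d m)" by (simp add: base_locus_def)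
qed

lemma binom_nonneg: "0 \<le> binom e n"
  by (simp add: binom_def)

lemma vdim_3:
  "vdim 3 d m = binom (int d + 3) 3 - (binom (int (m 1) + 2) 3 + binom (int (m 2) + 2) 3 + binom (int (m 3) + 2) 3
    + binom (int (m 4) + 2) 3 + binom (int (m 5) + 2) 3 + binom (int (m 6) + 2) 3)"
proof -
  have b: "int ((3 + k - 1) choose 3) = binom (int k + 2) 3" for k
  proof (cases k)
    case (Suc j)
    then have "nat (int k + 2) = 3 + k - 1" by simp
    then show ?thesis using Suc by (simp add: binom_def)
  qed (simp add: binom_def)
  have "int ((3 + d) choose 3) = binom (int d + 3) 3"
    by (simp add: binom_def nat_add_distrib add.commute)
  then show ?thesis
    unfolding vdim_def b by (simp add: set_1_6[simplified] add.assoc)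
qed

text \<open>
  The formula exceeds the virtual dimension only through the terms with a positive sign, which
  belong to lines through two of the points and to the curve.
\<close>

lemma special_excess:
  assumes "vdim 3 d m < secant_linear_vdim 3 d m"
  shows "(\<exists>i\<in>{1..6}. \<exists>j\<in>{1..6}. i \<noteq> j \<and> d < m i + m j) \<or> 3 * d < sum m {1..6}"
proof (rule ccontr)
  assume contra: "\<not> ?thesis"
  have pair: "binom (int (m i) + int (m j) - int d + 1) 3 = 0" if "i \<in> {1..6}" "j \<in> {1..6}" "i \<noteq> j" for i j
  proof -
    have "m i + m j \<le> d" using contra that by (meson not_le)
    then show ?thesis by (intro binom_eq_0) linarith
  qed
  have "m 1 + m 2 + m 3 + m 4 + m 5 + m 6 \<le> 3 * d" using contra by (simp add: set_1_6[simplified] add.assoc)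
  then have curve: "binom (int (m 1) + int (m 2) + int (m 3) + int (m 4) + int (m 5) + int (m 6) - 3 * int d + 1) 3 = 0"
    by (intro binom_eq_0) linarith
  have drop: "a - s + e - f + k - g \<le> a - s" if "e = 0" "k = 0" "0 \<le> f" "0 \<le> g" for a s e f k g :: int
    using that by simp
  have "secant_linear_vdim 3 d m \<le> vdim 3 d m"
    unfolding secant_linear_vdim_eq_formula secant_formula_def Let_def vdim_3
  proof (rule drop)
    show "binom (int (m 1) + int (m 2) + int (m 3) + int (m 4) + int (m 5) + int (m 6) - 3 * int d + 1) 3 = 0"
      by (rule curve)
  qed (intro add_nonneg_nonneg binom_nonneg | simp add: pair del: One_nat_def)+
  then show False using assms by simp
qed

theorem proposition6p11:
  fixes p :: "nat \<Rightarrow> complex^4" and d :: nat and m :: "nat \<Rightarrow> nat" and C :: "(complex^4) set"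
  assumes "general_position p"
    and "rational_normal_curve C" and "\<forall>i\<in>{1..6}. p i \<in> C"
    and "\<exists>F\<in>lin_sys p d m. F \<noteq> (\<lambda>x. 0)"
  shows "(special p d m \<longrightarrow>
            (\<exists>I \<subseteq> {1..6}. 2 \<le> card I \<and> card I \<le> 3 \<and>
               lin_span p I \<subseteq> base_locus (lin_sys p d m)) \<or>
            (\<exists>I \<subseteq> {1..6}. \<exists>t\<ge>1. card I + 2 * t \<le> 3 \<and>
               join (lin_span p I) (secant C t) \<subseteq> base_locus (lin_sys p d m)))
         \<and> int (cfun_dim (lin_sys p d m)) = secant_linear_dim p d m"
proof (intro conjI impI)
  have gp: "linearly_general p" by (rule general_position_linearly_general[OF assms(1)])
  have dim: "int (sys_dim p d m') = secant_linear_vdim 3 d m'" if "lin_sys p d m \<subseteq> lin_sys p d m'" for m'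
  proof (rule sys_dim_eq_secant_linear_vdim[OF gp])
    show "0 < sys_dim p d m'" using assms(4) that unfolding lin_sys_nonempty_iff[symmetric] by blast
  qed
  have "\<not> (\<exists>m'. lin_sys p d m \<subseteq> lin_sys p d m' \<and> secant_linear_vdim 3 d m' < 0)"
    using dim by (metis of_nat_0_le_iff not_less)
  then show "int (sys_dim p d m) = secant_linear_dim p d m"
    using dim[OF order_refl] by (auto simp: secant_linear_dim_def)
  assume "special p d m"
  then have "vdim 3 d m < secant_linear_vdim 3 d m"
    using dim[OF order_refl] by (simp add: special_def)
  then consider i j where "i \<in> {1..6}" "j \<in> {1..6}" "i \<noteq> j" "d < m i + m j" | "3 * d < sum m {1..6}"
    using special_excess by blast
  then show "(\<exists>I \<subseteq> {1..6}. 2 \<le> card I \<and> card I \<le> 3 \<and> lin_span p I \<subseteq> base_locus (lin_sys p d m)) \<or>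
      (\<exists>I \<subseteq> {1..6}. \<exists>t\<ge>1. card I + 2 * t \<le> 3 \<and>
        join (lin_span p I) (secant C t) \<subseteq> base_locus (lin_sys p d m))"
  proof cases
    case 1
    then have "lin_span p {i, j} \<subseteq> base_locus (lin_sys p d m)" by (rule line_in_base_locus[OF gp])
    then show ?thesis using 1 by (intro disjI1 exI[of _ "{i, j}"]) simp
  next
    case 2
    have "join (lin_span p {}) (secant C 1) \<subseteq> base_locus (lin_sys p d m)"
      by (rule join_curve_in_base_locus) (rule vanishes_on_rational_normal_curve[OF gp assms(2,3) 2])
    then show ?thesis by (intro disjI2 exI[of _ "{}"] conjI exI[of _ 1]) simp_all
  qed
qed

end
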